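(* Let $\eta\in(0,1]$, let $d_1>0$ and $$d_n=\frac{1}{n\ln^{\eta}n}\qquad(n\ge 2),$$ and let $X=\{x_n\}_{n=0}^\infty$ with $x_0=0$, $x_n=x_{n-1}+d_n$ for $n\in\mathbb{N}$. For $n\ge 2$ put $$G(n)=\begin{cases}\dfrac14\,\dfrac{\ln^{\eta}n}{n}, & \eta\in(0,\tfrac12],\\[2mm] \dfrac14\,\dfrac{\ln^{\eta}n}{n}+\dfrac{\eta}{n\ln^{1-\eta}n}, & \eta\in(\tfrac12,1].\end{cases}$$ Let $\alpha=\{\alpha_n\}_{n=1}^\infty$ be a real sequence. Then $\mathrm{H}_{X,\alpha}$ is self-adjoint provided that one of the following conditions holds: (sa1) $\displaystyle\sum_{n=2}^{\infty}|\alpha_n|\,n^{-3}\ln^{-3\eta}n=\infty$; (sa2) there exists a constant $C_1>0$ such that $$\alpha_n\le -2\bigl(n\ln^{\eta}n+(n+1)\ln^{\eta}(n+1)\bigr)+G(n)+\frac{C_1}{n\ln^{\eta}n}\qquad(n\ge 2)$$ with $G(n)$ replaced by $-G(n)$; (sa3) there exists a constant $C_2>0$ such that $$\alpha_n\ge G(n)-\frac{C_2}{n\ln^{\eta}n}\qquad(n\ge 2).$$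
   Context: $\mathbb{N}=\{1,2,\dots\}$, $\mathbb{R}_+=(0,\infty)$, and $\ln^{\eta}n=(\ln n)^{\eta}$. In (sa2) the condition to be read is $\alpha_n\le -2\bigl(n\ln^{\eta}n+(n+1)\ln^{\eta}(n+1)\bigr)-G(n)+\frac{C_1}{n\ln^{\eta}n}$ for all $n\ge2$. Given a strictly increasing sequence $X=\{x_n\}_{n=0}^\infty$ with $x_0=0$, $x_n\to\infty$, and a real sequence $\alpha=\{\alpha_n\}_{n=1}^\infty$, let $\mathrm{H}^0_{X,\alpha}$ be the operator $f\mapsto -f''$ (derivatives taken on $\mathbb{R}_+\setminus X$) in $L^2(\mathbb{R}_+)$ with domain consisting of all $f\in W^{2,2}(\mathbb{R}_+\setminus X)$ with compact support in $[0,\infty)$ such that $f'(0+)=0$ and, for every $n\ge1$, $f(x_n+)=f(x_n-)=:f(x_n)$ and $f'(x_n+)-f'(x_n-)=\alpha_n f(x_n)$. The Hamiltonian $\mathrm{H}_{X,\alpha}$ is the closure of $\mathrm{H}^0_{X,\alpha}$ in $L^2(\mathbb{R}_+)$; it is the realization of $-\frac{d^2}{dx^2}+\sum_{n\ge1}\alpha_n\delta(x-x_n)$. *)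

theory Defs
  imports "HOL-Analysis.Analysis"
begin

text \<open>
  Elements of $L^2(S)$ are represented by complex functions on the real line that are read modulo
  equality almost everywhere on \<open>S\<close>; their values outside \<open>S\<close> are irrelevant.
\<close>

definition L2 :: "real set \<Rightarrow> (real \<Rightarrow> complex) set" where
  "L2 S = {f \<in> borel_measurable (lebesgue_on S).
             integrable (lebesgue_on S) (\<lambda>x. (cmod (f x))\<^sup>2)}"

definition l2_inner :: "real set \<Rightarrow> (real \<Rightarrow> complex) \<Rightarrow> (real \<Rightarrow> complex) \<Rightarrow> complex" where
  "l2_inner S f g = (LINT x|lebesgue_on S. f x * cnj (g x))"

definition l2_norm :: "real set \<Rightarrow> (real \<Rightarrow> complex) \<Rightarrow> real" where
  "l2_norm S f = sqrt (LINT x|lebesgue_on S. (cmod (f x))\<^sup>2)"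

text \<open>
  An unbounded operator in $L^2(S)$ is represented by its graph, a set of pairs \<open>(f, g)\<close> of
  representatives that contains with each pair every pair equal to it almost everywhere on \<open>S\<close>.
\<close>

type_synonym l2_graph = "((real \<Rightarrow> complex) \<times> (real \<Rightarrow> complex)) set"

definition graph_closure :: "real set \<Rightarrow> l2_graph \<Rightarrow> l2_graph" where
  "graph_closure S T = {(f, g). f \<in> L2 S \<and> g \<in> L2 S \<and>
     (\<exists>F G. (\<forall>k::nat. (F k, G k) \<in> T) \<and>
        (\<lambda>k. l2_norm S (\<lambda>x. F k x - f x)) \<longlonglongrightarrow> 0 \<and>
        (\<lambda>k. l2_norm S (\<lambda>x. G k x - g x)) \<longlonglongrightarrow> 0)}"

definition graph_adjoint :: "real set \<Rightarrow> l2_graph \<Rightarrow> l2_graph" where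
  "graph_adjoint S T = {(h, k). h \<in> L2 S \<and> k \<in> L2 S \<and>
     (\<forall>(f, g) \<in> T. l2_inner S g h = l2_inner S f k)}"

definition densely_defined :: "real set \<Rightarrow> l2_graph \<Rightarrow> bool" where
  "densely_defined S T \<longleftrightarrow>
     (\<forall>f \<in> L2 S. \<forall>e > 0. \<exists>(h, k) \<in> T. l2_norm S (\<lambda>x. h x - f x) < e)"

text \<open>
  Density of the domain makes the adjoint single-valued modulo null sets, so a graph that
  is self-adjoint in the following sense is indeed the graph of an operator.
\<close>

definition self_adjoint :: "real set \<Rightarrow> l2_graph \<Rightarrow> bool" where
  "self_adjoint S T \<longleftrightarrow> densely_defined S T \<and> graph_adjoint S T = T"

text \<open>
  Weak derivatives on an open set \<open>U\<close> of the real line, tested against $C^1_c(U)$.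
\<close>

definition weak_deriv :: "real set \<Rightarrow> (real \<Rightarrow> complex) \<Rightarrow> (real \<Rightarrow> complex) \<Rightarrow> bool" where
  "weak_deriv U f g \<longleftrightarrow>
     (\<forall>\<phi> \<phi>' :: real \<Rightarrow> complex.
        (\<forall>x. (\<phi> has_vector_derivative \<phi>' x) (at x)) \<and> continuous_on UNIV \<phi>' \<and>
        (\<exists>K. compact K \<and> K \<subseteq> U \<and> (\<forall>x. x \<notin> K \<longrightarrow> \<phi> x = 0)) \<longrightarrow>
        (LINT x|lebesgue_on U. f x * \<phi>' x) = - (LINT x|lebesgue_on U. g x * \<phi> x))"

text \<open>
  \<open>W22 U u v w\<close>: the class of \<open>u\<close> lies in $W^{2,2}(U)$, \<open>u\<close> and \<open>v\<close> are the continuous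
  representatives on \<open>U\<close> of the function and of its first derivative (they exist because \<open>U\<close> is
  one-dimensional), and \<open>w\<close> represents the second derivative.  One-sided limits of
  a $W^{2,2}$ function and of its derivative are those of these continuous representatives.
\<close>

definition W22 :: "real set \<Rightarrow> (real \<Rightarrow> complex) \<Rightarrow> (real \<Rightarrow> complex) \<Rightarrow> (real \<Rightarrow> complex) \<Rightarrow> bool"
  where
  "W22 U u v w \<longleftrightarrow> u \<in> L2 U \<and> v \<in> L2 U \<and> w \<in> L2 U \<and>
     weak_deriv U u v \<and> weak_deriv U v w \<and> continuous_on U u \<and> continuous_on U v"

text \<open>The entry \<open>\<alpha> 0\<close> is not used: there is no point interaction at \<open>x 0 = 0\<close>.\<close>

definition H0_graph :: "(nat \<Rightarrow> real) \<Rightarrow> (nat \<Rightarrow> real) \<Rightarrow> l2_graph" where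
  "H0_graph x \<alpha> = {(f, g). f \<in> L2 {0<..} \<and> g \<in> L2 {0<..} \<and>
     (\<exists>u v w. W22 ({0<..} - range x) u v w \<and>
        (AE t in lebesgue_on {0<..}. f t = u t) \<and>
        (AE t in lebesgue_on {0<..}. g t = - w t) \<and>
        (\<exists>R. \<forall>t \<in> {0<..} - range x. R < t \<longrightarrow> u t = 0) \<and>
        (v \<longlongrightarrow> 0) (at_right 0) \<and>
        (\<forall>n\<ge>1. \<exists>c a b.
           (u \<longlongrightarrow> c) (at_left (x n)) \<and> (u \<longlongrightarrow> c) (at_right (x n)) \<and>
           (v \<longlongrightarrow> a) (at_left (x n)) \<and> (v \<longlongrightarrow> b) (at_right (x n)) \<and>
           b - a = of_real (\<alpha> n) * c))}"

definition H_graph :: "(nat \<Rightarrow> real) \<Rightarrow> (nat \<Rightarrow> real) \<Rightarrow> l2_graph" where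
  "H_graph x \<alpha> = graph_closure {0<..} (H0_graph x \<alpha>)"

definition lnp :: "real \<Rightarrow> nat \<Rightarrow> real" where
  "lnp \<eta> n = (ln (real n)) powr \<eta>"

definition G :: "real \<Rightarrow> nat \<Rightarrow> real" where
  "G \<eta> n = (if \<eta> \<le> 1 / 2 then 1 / 4 * (lnp \<eta> n / real n)
            else 1 / 4 * (lnp \<eta> n / real n) + \<eta> / (real n * lnp (1 - \<eta>) n))"

end

theory Submission
  imports Defs
begin

text \<open>
  Let \<open>T\<close> be the minimal operator, the graph \<open>H0_graph x \<alpha>\<close>.  Its closure is self-adjoint once the adjoint of
  \<open>T\<close> is symmetric, that is, once the boundary form \<open>u1 u2' - u1' u2\<close> of any two elements of the adjoint
  domain vanishes at infinity.  Elements of the adjoint solve \<open>- u'' = k\<close> between the nodes and satisfy the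
  Neumann condition and all interface conditions (\<open>adjoint_imp_solves\<close>).  If the boundary form of two of
  them has a nonzero limit, then every solution of the homogeneous equation \<open>u'' = 0\<close> with the same
  interface conditions (a zero-energy solution) is square integrable (\<open>homogeneous_L2_if_boundary_term\<close>).
  One zero-energy solution outside \<open>L\<^sup>2\<close> therefore suffices (\<open>limit_point_imp_self_adjoint\<close>).

  Zero-energy solutions are piecewise linear.  Their values \<open>y\<^sub>n\<close> at the nodes and their slopes \<open>q\<^sub>n\<close> to the
  right of the nodes obey \<open>y\<^bsub>n+1\<^esub> = y\<^sub>n + d\<^bsub>n+1\<^esub> q\<^sub>n\<close> and \<open>q\<^bsub>n+1\<^esub> = q\<^sub>n + \<alpha>\<^bsub>n+1\<^esub> y\<^bsub>n+1\<^esub>\<close>, and square integrability implies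
  \<open>\<Sum> d\<^bsub>n+1\<^esub> (y\<^sub>n\<^sup>2 + y\<^bsub>n+1\<^esub>\<^sup>2) < \<infinity>\<close> (\<open>homogeneous_L2_imp_nodes_summable\<close>).  It
  remains to show that two solutions with Wronskian \<open>1\<close> cannot both be square summable in this sense.  The
  steps satisfy \<open>\<Sum> d\<^sub>n = \<infinity>\<close>, \<open>\<Sum> d\<^sub>n\<^sup>2 < \<infinity>\<close> and \<open>d\<^bsub>n+1\<^esub> \<le> d\<^sub>n \<le> 3 d\<^bsub>n+1\<^esub>\<close> for \<open>n \<ge> 2\<close>.

  Under the first condition, the Wronskian over two steps shows that two square-summable solutions would
  give \<open>\<Sum> |\<alpha>\<^sub>n| d\<^sub>n\<^sup>3 < \<infinity>\<close> (\<open>strong_coupling_not_both_l2\<close>).  Since \<open>G \<ge> 0\<close>, the third condition yields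
  \<open>\<alpha>\<^sub>n \<ge> - C d\<^sub>n\<close>; then the energy estimate \<open>slopes_summable\<close> makes the slopes of square-summable solutions
  square summable as well, and the constancy of the Wronskian contradicts \<open>\<Sum> d\<^sub>n = \<infinity>\<close>
  (\<open>bounded_below_not_both_l2\<close>).  The second condition is the image of the third under \<open>y\<^sub>n \<mapsto> (-1)\<^sup>n y\<^sub>n\<close>
  (\<open>alternating_not_both_l2\<close>).
\<close>

section \<open>The Hilbert space of square integrable functions\<close>

lemma L2_measurable: "f \<in> L2 S \<Longrightarrow> f \<in> borel_measurable (lebesgue_on S)"
  by (simp add: L2_def)

lemma L2_sq_integrable: "f \<in> L2 S \<Longrightarrow> integrable (lebesgue_on S) (\<lambda>x. (cmod (f x))\<^sup>2)"
  by (simp add: L2_def)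

lemma L2_bound:
  assumes "f \<in> borel_measurable (lebesgue_on S)" and "g \<in> L2 S" and "h \<in> L2 S"
    and le: "AE x in lebesgue_on S. (cmod (f x))\<^sup>2 \<le> C * ((cmod (g x))\<^sup>2 + (cmod (h x))\<^sup>2)"
  shows "f \<in> L2 S"
proof -
  have "integrable (lebesgue_on S) (\<lambda>x. C * ((cmod (g x))\<^sup>2 + (cmod (h x))\<^sup>2))"
    using assms by (intro integrable_mult_right Bochner_Integration.integrable_add L2_sq_integrable)
  then have "integrable (lebesgue_on S) (\<lambda>x. (cmod (f x))\<^sup>2)"
  proof (rule Bochner_Integration.integrable_bound)
    show "(\<lambda>x. (cmod (f x))\<^sup>2) \<in> borel_measurable (lebesgue_on S)"
      using assms(1) by measurable
    show "AE x in lebesgue_on S. norm ((cmod (f x))\<^sup>2) \<le> norm (C * ((cmod (g x))\<^sup>2 + (cmod (h x))\<^sup>2))"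
      using le by eventually_elim (simp add: order_trans[OF _ abs_ge_self])
  qed
  with assms(1) show ?thesis by (simp add: L2_def)
qed

lemma norm_add_sq_le: "(norm (a + b :: 'a::real_normed_vector))\<^sup>2 \<le> 2 * ((norm a)\<^sup>2 + (norm b)\<^sup>2)"
proof -
  have "(norm (a + b))\<^sup>2 \<le> (norm a + norm b)\<^sup>2"
    by (intro power_mono norm_triangle_ineq) auto
  also have "\<dots> \<le> 2 * ((norm a)\<^sup>2 + (norm b)\<^sup>2)"
    using sum_squares_bound[of "norm a" "norm b"] by (simp add: power2_sum)
  finally show ?thesis .
qed

lemma L2_zero [simp]: "(\<lambda>_. 0) \<in> L2 S"
  by (simp add: L2_def)

lemma L2_add:
  assumes "f \<in> L2 S" "g \<in> L2 S"
  shows "(\<lambda>x. f x + g x) \<in> L2 S"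
proof (rule L2_bound[OF _ assms])
  show "(\<lambda>x. f x + g x) \<in> borel_measurable (lebesgue_on S)"
    using assms[THEN L2_measurable] by measurable
  show "AE x in lebesgue_on S. (cmod (f x + g x))\<^sup>2 \<le> 2 * ((cmod (f x))\<^sup>2 + (cmod (g x))\<^sup>2)"
    by (intro AE_I2 norm_add_sq_le)
qed

lemma L2_scale:
  assumes "f \<in> L2 S"
  shows "(\<lambda>x. c * f x) \<in> L2 S"
proof (rule L2_bound[OF _ assms L2_zero])
  show "(\<lambda>x. c * f x) \<in> borel_measurable (lebesgue_on S)"
    using assms[THEN L2_measurable] by measurable
  show "AE x in lebesgue_on S. (cmod (c * f x))\<^sup>2 \<le> (cmod c)\<^sup>2 * ((cmod (f x))\<^sup>2 + (cmod 0)\<^sup>2)"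
    by (simp add: norm_mult power_mult_distrib)
qed

lemma L2_uminus: "f \<in> L2 S \<Longrightarrow> (\<lambda>x. - f x) \<in> L2 S"
  using L2_scale[of f S "-1"] by simp

lemma L2_diff:
  assumes "f \<in> L2 S" "g \<in> L2 S"
  shows "(\<lambda>x. f x - g x) \<in> L2 S"
  using L2_add[OF assms(1) L2_uminus[OF assms(2)]] by simp

lemma borel_measurable_cnj:
  "f \<in> borel_measurable M \<Longrightarrow> (\<lambda>x. cnj (f x)) \<in> borel_measurable M"
  by (rule borel_measurable_continuous_on[of cnj]) (auto intro: continuous_intros)

lemma L2_cong_AE:
  assumes "f \<in> L2 S" "g \<in> borel_measurable (lebesgue_on S)" "AE x in lebesgue_on S. f x = g x"
  shows "g \<in> L2 S"
  using assms(3) by (intro L2_bound[OF assms(2) assms(1) L2_zero, where C = 1]) auto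

lemma L2_prod_integrable:
  assumes "f \<in> L2 S" "g \<in> L2 S"
  shows "integrable (lebesgue_on S) (\<lambda>x. cmod (f x) * cmod (g x))"
proof (rule Bochner_Integration.integrable_bound)
  show "integrable (lebesgue_on S) (\<lambda>x. (cmod (f x))\<^sup>2 + (cmod (g x))\<^sup>2)"
    using assms by (intro Bochner_Integration.integrable_add L2_sq_integrable)
  show "(\<lambda>x. cmod (f x) * cmod (g x)) \<in> borel_measurable (lebesgue_on S)"
    using assms[THEN L2_measurable] by measurable
  have "a * b \<le> a\<^sup>2 + b\<^sup>2" if "a \<ge> 0" "b \<ge> 0" for a b :: real
  proof -
    have "2 * (a * b) \<le> a\<^sup>2 + b\<^sup>2"
      using sum_squares_bound[of a b] by simp
    moreover have "0 \<le> a * b"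
      using that by simp
    ultimately show ?thesis by linarith
  qed
  then show "AE x in lebesgue_on S. norm (cmod (f x) * cmod (g x))
      \<le> norm ((cmod (f x))\<^sup>2 + (cmod (g x))\<^sup>2)"
    by simp
qed

lemma L2_inner_integrable:
  assumes "f \<in> L2 S" "g \<in> L2 S"
  shows "integrable (lebesgue_on S) (\<lambda>x. f x * cnj (g x))"
proof (rule Bochner_Integration.integrable_bound[OF L2_prod_integrable[OF assms]])
  show "(\<lambda>x. f x * cnj (g x)) \<in> borel_measurable (lebesgue_on S)"
    using assms by (intro borel_measurable_times borel_measurable_cnj L2_measurable)
qed (simp add: norm_mult)

lemma l2_inner_scale_left: "l2_inner S (\<lambda>x. c * f x) h = c * l2_inner S f h"
  by (simp add: l2_inner_def mult.assoc)

lemma l2_inner_cnj: "l2_inner S f g = cnj (l2_inner S g f)"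
  unfolding l2_inner_def by (subst Bochner_Integration.integral_cnj [symmetric]) (simp add: mult.commute)

lemma l2_inner_diff_right:
  assumes "f \<in> L2 S" "g \<in> L2 S" "h \<in> L2 S"
  shows "l2_inner S h (\<lambda>x. f x - g x) = l2_inner S h f - l2_inner S h g"
  using assms by (simp add: l2_inner_def right_diff_distrib L2_inner_integrable)

lemma l2_inner_uminus_right: "l2_inner S h (\<lambda>x. - f x) = - l2_inner S h f"
  by (simp add: l2_inner_def)

lemma l2_norm_nonneg [simp]: "0 \<le> l2_norm S f"
  by (simp add: l2_norm_def)

lemma l2_norm_sq: "(l2_norm S f)\<^sup>2 = (LINT x|lebesgue_on S. (cmod (f x))\<^sup>2)"
  by (simp add: l2_norm_def)

lemma l2_inner_self: "l2_inner S f f = of_real ((l2_norm S f)\<^sup>2)"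
proof -
  have "f x * cnj (f x) = complex_of_real ((cmod (f x))\<^sup>2)" for x
    by (rule complex_norm_square [symmetric])
  then show ?thesis
    unfolding l2_norm_sq l2_inner_def by (simp only: integral_complex_of_real)
qed

lemma l2_norm_cong_AE:
  assumes "f \<in> borel_measurable (lebesgue_on S)" "g \<in> borel_measurable (lebesgue_on S)"
    "AE x in lebesgue_on S. f x = g x"
  shows "l2_norm S f = l2_norm S g"
proof -
  have "(LINT x|lebesgue_on S. (cmod (f x))\<^sup>2) = (LINT x|lebesgue_on S. (cmod (g x))\<^sup>2)"
    using assms by (intro integral_cong_AE) auto
  then show ?thesis by (simp add: l2_norm_def)
qed

lemma l2_norm_eq_0:
  assumes "f \<in> L2 S" "l2_norm S f = 0"
  shows "AE x in lebesgue_on S. f x = 0"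
proof -
  have "(LINT x|lebesgue_on S. (cmod (f x))\<^sup>2) = 0"
    using assms(2) l2_norm_sq[of S f] by simp
  then have "AE x in lebesgue_on S. (cmod (f x))\<^sup>2 = 0"
    using integral_nonneg_eq_0_iff_AE[OF L2_sq_integrable[OF assms(1)]] by simp
  then show ?thesis by simp
qed

lemma l2_Cauchy_Schwarz:
  assumes f: "f \<in> L2 S" and g: "g \<in> L2 S"
  shows "cmod (l2_inner S f g) \<le> l2_norm S f * l2_norm S g"
proof -
  define A where "A = (l2_norm S f)\<^sup>2"
  define B where "B = (l2_norm S g)\<^sup>2"
  define I where "I = (LINT x|lebesgue_on S. cmod (f x) * cmod (g x))"
  have I0: "I \<ge> 0" unfolding I_def by (rule integral_nonneg_AE) simp
  have quad: "0 \<le> t\<^sup>2 * A - 2 * t * I + B" for t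
  proof -
    have "0 \<le> (LINT x|lebesgue_on S. (t * cmod (f x) - cmod (g x))\<^sup>2)"
      by (rule integral_nonneg_AE) simp
    also have "\<dots> = (LINT x|lebesgue_on S. t\<^sup>2 * (cmod (f x))\<^sup>2 - 2 * t * (cmod (f x) * cmod (g x)) + (cmod (g x))\<^sup>2)"
      by (simp add: power2_diff power_mult_distrib algebra_simps)
    also have "\<dots> = t\<^sup>2 * A - 2 * t * I + B"
      using f g by (simp add: A_def B_def I_def l2_norm_sq L2_sq_integrable L2_prod_integrable)
    finally show ?thesis .
  qed
  have A0: "A \<ge> 0" by (simp add: A_def)
  have "I\<^sup>2 \<le> A * B"
  proof (cases "A = 0")
    case True
    have "I = 0"
    proof (rule ccontr)
      assume "I \<noteq> 0"
      with quad[of "(B + 1) / (2 * I)"] True show False by simp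
    qed
    with True show ?thesis by simp
  next
    case False
    with A0 have "A > 0" by simp
    moreover have "0 \<le> B - I\<^sup>2 / A"
      using quad[of "I / A"] \<open>A > 0\<close> by (simp add: field_simps power2_eq_square)
    ultimately show ?thesis by (simp add: field_simps)
  qed
  then have "I\<^sup>2 \<le> (l2_norm S f * l2_norm S g)\<^sup>2"
    by (simp add: A_def B_def power_mult_distrib)
  then have "I \<le> l2_norm S f * l2_norm S g"
    by (rule power2_le_imp_le) simp
  moreover have "cmod (l2_inner S f g) \<le> I"
    unfolding l2_inner_def I_def
    by (rule order_trans[OF integral_norm_bound]) (simp add: norm_mult)
  ultimately show ?thesis by simp
qed

lemma l2_norm_add_sq:
  assumes f: "f \<in> L2 S" and g: "g \<in> L2 S"
  shows "(l2_norm S (\<lambda>x. f x + g x))\<^sup>2 = (l2_norm S f)\<^sup>2 + 2 * Re (l2_inner S f g) + (l2_norm S g)\<^sup>2"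
proof -
  define q where "q x = Re (f x * cnj (g x))" for x
  have q: "(cmod (f x + g x))\<^sup>2 = (cmod (f x))\<^sup>2 + 2 * q x + (cmod (g x))\<^sup>2" for x
    unfolding cmod_power2 q_def by (simp add: power2_eq_square algebra_simps)
  have "integrable (lebesgue_on S) q"
    unfolding q_def by (intro integrable_Re L2_inner_integrable f g)
  moreover have "Re (l2_inner S f g) = (LINT x|lebesgue_on S. q x)"
    unfolding l2_inner_def q_def by (rule integral_Re[OF L2_inner_integrable[OF f g], symmetric])
  ultimately show ?thesis
    using f g by (simp add: l2_norm_sq L2_sq_integrable q)
qed

lemma l2_norm_uminus: "l2_norm S (\<lambda>x. - f x) = l2_norm S f"
  by (simp add: l2_norm_def)

lemma l2_norm_scale: "l2_norm S (\<lambda>x. c * f x) = cmod c * l2_norm S f"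
  by (simp add: l2_norm_def norm_mult power_mult_distrib real_sqrt_mult)

lemma l2_parallelogram:
  assumes f: "f \<in> L2 S" and g: "g \<in> L2 S"
  shows "(l2_norm S (\<lambda>x. f x + g x))\<^sup>2 + (l2_norm S (\<lambda>x. f x - g x))\<^sup>2
       = 2 * (l2_norm S f)\<^sup>2 + 2 * (l2_norm S g)\<^sup>2"
  using l2_norm_add_sq[OF f g] l2_norm_add_sq[OF f L2_uminus[OF g]]
  by (simp add: l2_inner_uminus_right l2_norm_uminus)

lemma l2_inner_tendsto_right:
  assumes F: "\<And>k. F k \<in> L2 S" and f: "f \<in> L2 S" and h: "h \<in> L2 S"
    and lim: "(\<lambda>k::nat. l2_norm S (\<lambda>x. F k x - f x)) \<longlonglongrightarrow> 0"
  shows "(\<lambda>k. l2_inner S h (F k)) \<longlonglongrightarrow> l2_inner S h f"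
proof (rule LIM_zero_cancel, rule Lim_null_comparison)
  show "\<forall>\<^sub>F k in sequentially. norm (l2_inner S h (F k) - l2_inner S h f)
      \<le> l2_norm S h * l2_norm S (\<lambda>x. F k x - f x)"
    using l2_Cauchy_Schwarz[OF h L2_diff[OF F f]] l2_inner_diff_right[OF F f h] by simp
  show "(\<lambda>k. l2_norm S h * l2_norm S (\<lambda>x. F k x - f x)) \<longlonglongrightarrow> 0"
    using tendsto_mult_right_zero[OF lim] .
qed

lemma nn_integral_L2:
  assumes "f \<in> L2 S"
  shows "(\<integral>\<^sup>+x. ennreal ((cmod (f x))\<^sup>2) \<partial>lebesgue_on S) = ennreal ((l2_norm S f)\<^sup>2)"
  unfolding l2_norm_sq by (rule nn_integral_eq_integral[OF L2_sq_integrable[OF assms]]) simp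

text \<open>
  The weights \<open>4 ^ k\<close> make \<open>\<Sum> 4\<^sup>k |f\<^bsub>k+1\<^esub> - f\<^sub>k|\<^sup>2\<close> integrable, hence finite almost everywhere; at such points the
  increments are dominated by a geometric series.
\<close>

lemma L2_fast_Cauchy_convergent:
  assumes L: "\<And>k. f k \<in> L2 S"
    and small: "\<And>k. (l2_norm S (\<lambda>x. f (Suc k) x - f k x))\<^sup>2 \<le> (1/8) ^ k"
  shows "AE x in lebesgue_on S. convergent (\<lambda>k. f k x)"
proof -
  define D where "D k x = f (Suc k) x - f k x" for k x
  have DL: "D k \<in> L2 S" for k
    unfolding D_def by (rule L2_diff[OF L L])
  have meas: "(\<lambda>x. ennreal (4 ^ k * (cmod (D k x))\<^sup>2)) \<in> borel_measurable (lebesgue_on S)" for k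
    using L2_measurable[OF DL[of k]] by measurable
  have int1: "(\<integral>\<^sup>+x. ennreal (4 ^ k * (cmod (D k x))\<^sup>2) \<partial>lebesgue_on S) \<le> ennreal ((1/2) ^ k)" for k
  proof -
    have "(\<integral>\<^sup>+x. ennreal (4 ^ k * (cmod (D k x))\<^sup>2) \<partial>lebesgue_on S) =
        ennreal (LINT x|lebesgue_on S. 4 ^ k * (cmod (D k x))\<^sup>2)"
      using L2_sq_integrable[OF DL] by (intro nn_integral_eq_integral) auto
    also have "(LINT x|lebesgue_on S. 4 ^ k * (cmod (D k x))\<^sup>2) = 4 ^ k * (l2_norm S (D k))\<^sup>2"
      by (simp add: l2_norm_sq)
    also have "\<dots> \<le> 4 ^ k * (1/8) ^ k"
      using small[of k] by (intro mult_left_mono) (auto simp: D_def[abs_def])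
    also have "\<dots> = (1/2) ^ k"
      by (simp flip: power_mult_distrib)
    finally show ?thesis by (simp add: ennreal_leI)
  qed
  have "(\<integral>\<^sup>+x. (\<Sum>k. ennreal (4 ^ k * (cmod (D k x))\<^sup>2)) \<partial>lebesgue_on S)
      = (\<Sum>k. \<integral>\<^sup>+x. ennreal (4 ^ k * (cmod (D k x))\<^sup>2) \<partial>lebesgue_on S)"
    using meas by (intro nn_integral_suminf) auto
  also have "\<dots> \<le> (\<Sum>k. ennreal ((1/2) ^ k))"
    by (intro suminf_le int1) auto
  also have "\<dots> = ennreal (\<Sum>k. (1/2) ^ k)"
    by (intro suminf_ennreal2) (auto intro: summable_geometric)
  finally have "(\<integral>\<^sup>+x. (\<Sum>k. ennreal (4 ^ k * (cmod (D k x))\<^sup>2)) \<partial>lebesgue_on S) \<noteq> \<infinity>"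
    by (metis ennreal_neq_top infinity_ennreal_def top.extremum_uniqueI)
  then have "AE x in lebesgue_on S. (\<Sum>k. ennreal (4 ^ k * (cmod (D k x))\<^sup>2)) \<noteq> \<infinity>"
    using meas by (intro nn_integral_PInf_AE borel_measurable_suminf_order) auto
  then show ?thesis
  proof eventually_elim
    fix x assume fin: "(\<Sum>k. ennreal (4 ^ k * (cmod (D k x))\<^sup>2)) \<noteq> \<infinity>"
    then have "summable (\<lambda>k. 4 ^ k * (cmod (D k x))\<^sup>2)"
      by (intro summable_suminf_not_top) auto
    then have "bounded (range (\<lambda>k. 4 ^ k * (cmod (D k x))\<^sup>2))"
      using convergent_imp_bounded summable_LIMSEQ_zero by blast
    then obtain C where C: "\<And>k. 4 ^ k * (cmod (D k x))\<^sup>2 \<le> C"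
      unfolding bounded_iff by fastforce
    have C0: "0 \<le> C" using C[of 0] order_trans[OF zero_le_power2[of "cmod (D 0 x)"]] by simp
    have "cmod (D k x) \<le> sqrt C * (1/2) ^ k" for k
    proof (rule power2_le_imp_le)
      have "(cmod (D k x))\<^sup>2 = (4 ^ k * (cmod (D k x))\<^sup>2) * (1/4) ^ k"
        by (simp add: power_one_over)
      also have "\<dots> \<le> C * (1/4) ^ k"
        using C by (intro mult_right_mono) auto
      also have "\<dots> = (sqrt C * (1/2) ^ k)\<^sup>2"
        proof -
        have "(1/4 :: real) ^ k = ((1/2) ^ k)\<^sup>2"
          by (simp add: power2_eq_square flip: power_mult_distrib)
        then show ?thesis using C0 by (simp add: power_mult_distrib)
      qed
      finally show "(cmod (D k x))\<^sup>2 \<le> (sqrt C * (1/2) ^ k)\<^sup>2" .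
    qed (use C0 in auto)
    then have "summable (\<lambda>k. D k x)"
      by (intro summable_comparison_test'[OF summable_mult[OF summable_geometric]]) auto
    then have "convergent (\<lambda>n. \<Sum>k<n. D k x)"
      using summable_iff_convergent by blast
    moreover have "(\<Sum>k<n. D k x) = f n x - f 0 x" for n
      unfolding D_def by (rule sum_lessThan_telescope)
    ultimately have "convergent (\<lambda>n. (f n x - f 0 x) + f 0 x)"
      by (intro convergent_add convergent_const) simp
    then show "convergent (\<lambda>k. f k x)" by simp
  qed
qed

text \<open>
  Riesz--Fischer: a fast subsequence converges pointwise, and Fatou's lemma turns the Cauchy bounds
  into bounds for the distance to the pointwise limit.
\<close>

lemma L2_complete:
  fixes f :: "nat \<Rightarrow> real \<Rightarrow> complex"
  assumes L: "\<And>k. f k \<in> L2 S"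
    and Cauchy: "\<And>e. e > 0 \<Longrightarrow> \<exists>N. \<forall>m\<ge>N. \<forall>n\<ge>N. (l2_norm S (\<lambda>x. f m x - f n x))\<^sup>2 \<le> e"
  obtains F where "F \<in> L2 S" "(\<lambda>k. l2_norm S (\<lambda>x. f k x - F x)) \<longlonglongrightarrow> 0"
proof -
  have "\<forall>k. \<exists>N. \<forall>m\<ge>N. \<forall>n\<ge>N. (l2_norm S (\<lambda>x. f m x - f n x))\<^sup>2 \<le> (1/8) ^ k"
    using Cauchy by simp
  then obtain N where N: "\<And>k m n. m \<ge> N k \<Longrightarrow> n \<ge> N k \<Longrightarrow> (l2_norm S (\<lambda>x. f m x - f n x))\<^sup>2 \<le> (1/8) ^ k"
    by metis
  define r where "r k = (\<Sum>i\<le>k. N i) + k" for k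
  have rN: "r k \<ge> N k" for k
    unfolding r_def using member_le_sum[of k "{..k}" N] by simp
  have rS: "r k < r (Suc k)" for k by (simp add: r_def)
  have rk: "r k \<ge> k" for k by (simp add: r_def)
  define F where "F x = lim (\<lambda>k. f (r k) x)" for x
  have Fm: "F \<in> borel_measurable (lebesgue_on S)"
    unfolding F_def using L2_measurable[OF L] by (intro borel_measurable_lim_metric) auto
  have "AE x in lebesgue_on S. convergent (\<lambda>k. f (r k) x)"
    by (rule L2_fast_Cauchy_convergent) (use L N rN rS in \<open>auto intro!: N order_trans[OF rN less_imp_le[OF rS]]\<close>)
  then have conv: "AE x in lebesgue_on S. (\<lambda>k. f (r k) x) \<longlonglongrightarrow> F x"
    by eventually_elim (simp add: F_def convergent_LIMSEQ_iff)
  have bound: "(\<integral>\<^sup>+x. ennreal ((cmod (f n x - F x))\<^sup>2) \<partial>lebesgue_on S) \<le> ennreal e"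
    if e: "\<forall>m\<ge>M. \<forall>n\<ge>M. (l2_norm S (\<lambda>x. f m x - f n x))\<^sup>2 \<le> e" and "n \<ge> M" for M n e
  proof -
    have "(\<integral>\<^sup>+x. ennreal ((cmod (f n x - F x))\<^sup>2) \<partial>lebesgue_on S)
        = (\<integral>\<^sup>+x. liminf (\<lambda>k. ennreal ((cmod (f n x - f (r k) x))\<^sup>2)) \<partial>lebesgue_on S)"
    proof (rule nn_integral_cong_AE, use conv in eventually_elim)
      fix x assume "(\<lambda>k. f (r k) x) \<longlonglongrightarrow> F x"
      then have "(\<lambda>k. ennreal ((cmod (f n x - f (r k) x))\<^sup>2)) \<longlonglongrightarrow> ennreal ((cmod (f n x - F x))\<^sup>2)"
        by (intro tendsto_intros)
      then show "ennreal ((cmod (f n x - F x))\<^sup>2) = liminf (\<lambda>k. ennreal ((cmod (f n x - f (r k) x))\<^sup>2))"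
        by (simp only: lim_imp_Liminf[OF trivial_limit_sequentially])
    qed
    also have "\<dots> \<le> liminf (\<lambda>k. \<integral>\<^sup>+x. ennreal ((cmod (f n x - f (r k) x))\<^sup>2) \<partial>lebesgue_on S)"
    proof (rule nn_integral_liminf)
      fix k
      show "(\<lambda>x. ennreal ((cmod (f n x - f (r k) x))\<^sup>2)) \<in> borel_measurable (lebesgue_on S)"
        using L2_measurable[OF L2_diff[OF L[of n] L[of "r k"]]] by measurable
    qed
    also have "\<dots> \<le> ennreal e"
    proof (rule Liminf_le)
      have "(\<integral>\<^sup>+x. ennreal ((cmod (f n x - f (r k) x))\<^sup>2) \<partial>lebesgue_on S) \<le> ennreal e" if "k \<ge> M" for k
        unfolding nn_integral_L2[OF L2_diff[OF L L]] using e \<open>n \<ge> M\<close> rk[of k] that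
        by (intro ennreal_leI) auto
      then show "\<forall>\<^sub>F k in sequentially. (\<integral>\<^sup>+x. ennreal ((cmod (f n x - f (r k) x))\<^sup>2) \<partial>lebesgue_on S) \<le> ennreal e"
        by (rule eventually_mono[OF eventually_ge_at_top[of M]])
    qed simp
    finally show ?thesis .
  qed
  have diffm: "(\<lambda>x. f n x - F x) \<in> borel_measurable (lebesgue_on S)" for n
    using L2_measurable[OF L[of n]] Fm by measurable
  have diffL: "(\<lambda>x. f n x - F x) \<in> L2 S" if "\<forall>m\<ge>M. \<forall>n\<ge>M. (l2_norm S (\<lambda>x. f m x - f n x))\<^sup>2 \<le> e" "n \<ge> M" for M n e
    unfolding L2_def using diffm[of n] bound[OF that]
    by (auto intro!: integrableI_bounded simp: top_unique less_top[symmetric])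
  obtain M1 where M1: "\<forall>m\<ge>M1. \<forall>n\<ge>M1. (l2_norm S (\<lambda>x. f m x - f n x))\<^sup>2 \<le> 1"
    using Cauchy[of 1] by auto
  have FL: "F \<in> L2 S"
    using L2_diff[OF L diffL[OF M1 order_refl], of M1] by simp
  have "(\<lambda>k. (l2_norm S (\<lambda>x. f k x - F x))\<^sup>2) \<longlonglongrightarrow> 0"
  proof (rule LIMSEQ_I)
    fix e :: real assume "e > 0"
    then obtain M where M: "\<forall>m\<ge>M. \<forall>n\<ge>M. (l2_norm S (\<lambda>x. f m x - f n x))\<^sup>2 \<le> e/2"
      using Cauchy[of "e/2"] by auto
    have "(l2_norm S (\<lambda>x. f n x - F x))\<^sup>2 \<le> e/2" if "n \<ge> M" for n
      using bound[OF M that] unfolding nn_integral_L2[OF L2_diff[OF L FL]]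
      using \<open>e > 0\<close> by (simp add: ennreal_le_iff)
    then show "\<exists>no. \<forall>n\<ge>no. norm ((l2_norm S (\<lambda>x. f n x - F x))\<^sup>2 - 0) < e"
      using \<open>e > 0\<close> by (intro exI[of _ M]) fastforce
  qed
  then have "(\<lambda>k. sqrt ((l2_norm S (\<lambda>x. f k x - F x))\<^sup>2)) \<longlonglongrightarrow> sqrt 0"
    by (rule tendsto_real_sqrt)
  with FL show thesis by (intro that[of F]) auto
qed

text \<open>
  A minimizing sequence for the distance of \<open>(h, k)\<close> to \<open>V\<close> is Cauchy by the parallelogram law, and the
  first variation of the distance vanishes in the limit.  The graph of the minimal operator and,
  padded with zeros, its domain are the two instances of \<open>V\<close>.
\<close>

lemma l2_projection:
  assumes V: "V \<subseteq> L2 S \<times> L2 S" and ne: "V \<noteq> {}"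
    and add: "\<And>f g f' g'. (f, g) \<in> V \<Longrightarrow> (f', g') \<in> V \<Longrightarrow> (\<lambda>x. f x + f' x, \<lambda>x. g x + g' x) \<in> V"
    and scale: "\<And>f g c. (f, g) \<in> V \<Longrightarrow> (\<lambda>x. c * f x, \<lambda>x. c * g x) \<in> V"
    and h: "h \<in> L2 S" and k: "k \<in> L2 S"
  obtains F G where "(F, G) \<in> graph_closure S V"
    "\<And>f g. (f, g) \<in> V \<Longrightarrow> l2_inner S f (\<lambda>x. h x - F x) + l2_inner S g (\<lambda>x. k x - G x) = 0"
proof -
  define E where "E f g = (l2_norm S f)\<^sup>2 + (l2_norm S g)\<^sup>2" for f g
  define D where "D = (\<lambda>(f, g). E (\<lambda>x. h x - f x) (\<lambda>x. k x - g x)) ` V"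
  have E0: "E f g \<ge> 0" for f g by (simp add: E_def)
  have Dne: "D \<noteq> {}" using ne by (auto simp: D_def)
  have Dbdd: "bdd_below D" by (rule bdd_belowI[of _ 0]) (auto simp: D_def E0)
  define \<delta> where "\<delta> = Inf D"
  have low: "\<delta> \<le> E (\<lambda>x. h x - f x) (\<lambda>x. k x - g x)" if "(f, g) \<in> V" for f g
    unfolding \<delta>_def by (rule cInf_lower[OF _ Dbdd]) (use that in \<open>force simp: D_def\<close>)
  have "\<exists>p\<in>V. E (\<lambda>x. h x - fst p x) (\<lambda>x. k x - snd p x) < \<delta> + 1 / real (Suc n)" for n
  proof -
    have "\<exists>d\<in>D. d < \<delta> + 1 / real (Suc n)"
      unfolding \<delta>_def by (rule cInf_lessD[OF Dne]) simp
    then show ?thesis by (force simp: D_def)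
  qed
  then obtain p where pV: "\<And>n. p n \<in> V"
    and pE: "\<And>n. E (\<lambda>x. h x - fst (p n) x) (\<lambda>x. k x - snd (p n) x) < \<delta> + 1 / real (Suc n)"
    by metis
  define f where "f n = fst (p n)" for n
  define g where "g n = snd (p n)" for n
  have fgV: "(f n, g n) \<in> V" for n using pV[of n] by (simp add: f_def g_def)
  have fL: "f n \<in> L2 S" and gL: "g n \<in> L2 S" for n using fgV[of n] V by auto
  have fgE: "E (\<lambda>x. h x - f n x) (\<lambda>x. k x - g n x) < \<delta> + 1 / real (Suc n)" for n
    using pE[of n] by (simp add: f_def g_def)
  have par: "(l2_norm S (\<lambda>x. a m x - a n x))\<^sup>2 = 2 * (l2_norm S (\<lambda>x. b x - a n x))\<^sup>2
      + 2 * (l2_norm S (\<lambda>x. b x - a m x))\<^sup>2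
      - 4 * (l2_norm S (\<lambda>x. b x - (1/2 * a n x + 1/2 * a m x)))\<^sup>2"
    if aL: "\<And>n. a n \<in> L2 S" and bL: "b \<in> L2 S" for a :: "nat \<Rightarrow> real \<Rightarrow> complex" and b m n
  proof -
    have "(l2_norm S (\<lambda>x. (b x - a n x) + (b x - a m x)))\<^sup>2 =
        (l2_norm S (\<lambda>x. 2 * (b x - (1/2 * a n x + 1/2 * a m x))))\<^sup>2"
      by (simp add: algebra_simps)
    also have "\<dots> = 4 * (l2_norm S (\<lambda>x. b x - (1/2 * a n x + 1/2 * a m x)))\<^sup>2"
      unfolding l2_norm_scale by (simp add: power_mult_distrib)
    finally show ?thesis
      using l2_parallelogram[OF L2_diff[OF bL aL[of n]] L2_diff[OF bL aL[of m]]]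
      by simp
  qed
  have close: "(l2_norm S (\<lambda>x. f m x - f n x))\<^sup>2 + (l2_norm S (\<lambda>x. g m x - g n x))\<^sup>2
      \<le> 2 / real (Suc n) + 2 / real (Suc m)" for m n
  proof -
    have "(\<lambda>x. 1/2 * f n x + 1/2 * f m x, \<lambda>x. 1/2 * g n x + 1/2 * g m x) \<in> V"
      by (intro add scale fgV)
    then have "\<delta> \<le> E (\<lambda>x. h x - (1/2 * f n x + 1/2 * f m x)) (\<lambda>x. k x - (1/2 * g n x + 1/2 * g m x))"
      by (rule low)
    then show ?thesis
      using fgE[of n] fgE[of m] par[where a = f and b = h and m = m and n = n, OF fL h]
        par[where a = g and b = k and m = m and n = n, OF gL k]
      unfolding E_def by linarith
  qed
  have Cau: "\<exists>N. \<forall>m\<ge>N. \<forall>n\<ge>N. (l2_norm S (\<lambda>x. f m x - f n x))\<^sup>2 + (l2_norm S (\<lambda>x. g m x - g n x))\<^sup>2 \<le> e"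
    if "e > 0" for e
  proof -
    obtain N where N: "4 / e < real N" using reals_Archimedean2 by blast
    have "2 / real (Suc n) \<le> e / 2" if "n \<ge> N" for n
    proof -
      have "4 / e \<le> real (Suc n)" using N that by linarith
      then have "4 \<le> e * real (Suc n)" using \<open>e > 0\<close> by (simp add: pos_divide_le_eq mult.commute)
      then show ?thesis by (simp add: pos_divide_le_eq)
    qed
    then have "2 / real (Suc n) + 2 / real (Suc m) \<le> e" if "n \<ge> N" "m \<ge> N" for n m
      using that by (metis add_mono field_sum_of_halves)
    then show ?thesis using close by (meson order_trans)
  qed
  have drop: "u \<le> e" "v \<le> e" if "u + v \<le> e" "0 \<le> u" "0 \<le> v" for u v e :: real
    using that by linarith+
  have Cf: "\<exists>N. \<forall>m\<ge>N. \<forall>n\<ge>N. (l2_norm S (\<lambda>x. f m x - f n x))\<^sup>2 \<le> e" if e: "e > 0" for e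
  proof -
    obtain N where "\<forall>m\<ge>N. \<forall>n\<ge>N. (l2_norm S (\<lambda>x. f m x - f n x))\<^sup>2 + (l2_norm S (\<lambda>x. g m x - g n x))\<^sup>2 \<le> e"
      using Cau[OF e] by blast
    then show ?thesis by (meson drop zero_le_power2)
  qed
  have Cg: "\<exists>N. \<forall>m\<ge>N. \<forall>n\<ge>N. (l2_norm S (\<lambda>x. g m x - g n x))\<^sup>2 \<le> e" if e: "e > 0" for e
  proof -
    obtain N where "\<forall>m\<ge>N. \<forall>n\<ge>N. (l2_norm S (\<lambda>x. f m x - f n x))\<^sup>2 + (l2_norm S (\<lambda>x. g m x - g n x))\<^sup>2 \<le> e"
      using Cau[OF e] by blast
    then show ?thesis by (meson drop zero_le_power2)
  qed
  obtain F where F: "F \<in> L2 S" "(\<lambda>k. l2_norm S (\<lambda>x. f k x - F x)) \<longlonglongrightarrow> 0"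
    using L2_complete[OF fL Cf] by blast
  obtain G where G: "G \<in> L2 S" "(\<lambda>k. l2_norm S (\<lambda>x. g k x - G x)) \<longlonglongrightarrow> 0"
    using L2_complete[OF gL Cg] by blast
  have "(F, G) \<in> graph_closure S V"
    using F G fgV by (auto simp: graph_closure_def)
  moreover have "l2_inner S a (\<lambda>x. h x - F x) + l2_inner S b (\<lambda>x. k x - G x) = 0" if ab: "(a, b) \<in> V" for a b
  proof -
    have aL: "a \<in> L2 S" and bL: "b \<in> L2 S" using ab V by auto
    define z where "z n = l2_inner S a (\<lambda>x. h x - f n x) + l2_inner S b (\<lambda>x. k x - g n x)" for n
    have lim: "z \<longlonglongrightarrow> l2_inner S a (\<lambda>x. h x - F x) + l2_inner S b (\<lambda>x. k x - G x)"
      unfolding z_def l2_inner_diff_right[OF h fL aL] l2_inner_diff_right[OF h F(1) aL]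
        l2_inner_diff_right[OF k gL bL] l2_inner_diff_right[OF k G(1) bL]
      by (intro tendsto_intros l2_inner_tendsto_right[OF fL F(1) aL F(2)] l2_inner_tendsto_right[OF gL G(1) bL G(2)])
    define e where "e = E a b"
    have e0: "e \<ge> 0" by (simp add: e_def E0)
    have zb: "(cmod (z n))\<^sup>2 \<le> (e + 1) * (1 / real (Suc n))" for n
    proof -
      \<comment> \<open>Moving from \<open>(f n, g n)\<close> along \<open>(a, b)\<close> cannot bring the distance below \<open>\<delta>\<close>; this step length
        turns that into a bound for the pairing \<open>z n\<close>.\<close>
      define s where "s = 1 / (e + 1)"
      have s0: "s > 0" using e0 by (simp add: s_def)
      define c where "c = - of_real s * cnj (z n)"
      have expand: "(l2_norm S (\<lambda>x. (h' x - f' x) - - c * a' x))\<^sup>2 = (l2_norm S (\<lambda>x. h' x - f' x))\<^sup>2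
          + 2 * Re (c * l2_inner S a' (\<lambda>x. h' x - f' x)) + (cmod c)\<^sup>2 * (l2_norm S a')\<^sup>2"
        if "h' \<in> L2 S" "f' \<in> L2 S" "a' \<in> L2 S" for h' f' a'
      proof -
        have "Re (l2_inner S (\<lambda>x. h' x - f' x) (\<lambda>x. c * a' x)) = Re (c * l2_inner S a' (\<lambda>x. h' x - f' x))"
          by (subst l2_inner_cnj) (simp add: l2_inner_scale_left)
        then show ?thesis
          using l2_norm_add_sq[OF L2_diff[OF that(1,2)] L2_scale[OF that(3), of c]]
          by (simp add: l2_norm_scale power_mult_distrib)
      qed
      have "(\<lambda>x. f n x + - c * a x, \<lambda>x. g n x + - c * b x) \<in> V"
        by (intro add scale fgV ab)
      then have "\<delta> \<le> E (\<lambda>x. h x - (f n x + - c * a x)) (\<lambda>x. k x - (g n x + - c * b x))"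
        by (rule low)
      also have "\<dots> = E (\<lambda>x. (h x - f n x) - - c * a x) (\<lambda>x. (k x - g n x) - - c * b x)"
        by (simp only: diff_diff_eq)
      also have "\<dots> = E (\<lambda>x. h x - f n x) (\<lambda>x. k x - g n x) + 2 * Re (c * z n) + (cmod c)\<^sup>2 * e"
        unfolding E_def e_def expand[OF h fL aL] expand[OF k gL bL] z_def by (simp add: algebra_simps)
      finally have "- (2 * Re (c * z n)) - (cmod c)\<^sup>2 * e \<le> 1 / real (Suc n)"
        using fgE[of n] by linarith
      moreover have "Re (c * z n) = - s * (cmod (z n))\<^sup>2"
        unfolding c_def cmod_power2 by (simp add: power2_eq_square algebra_simps)
      moreover have "(cmod c)\<^sup>2 = s\<^sup>2 * (cmod (z n))\<^sup>2"
        by (simp add: c_def norm_mult power_mult_distrib)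
      ultimately have *: "2 * s * (cmod (z n))\<^sup>2 - s\<^sup>2 * (cmod (z n))\<^sup>2 * e \<le> 1 / real (Suc n)"
        by simp
      have "s * e \<le> 1" using e0 by (simp add: s_def field_simps)
      then have "s * (cmod (z n))\<^sup>2 * (s * e) \<le> s * (cmod (z n))\<^sup>2 * 1"
        using s0 by (intro mult_left_mono) auto
      then have "s * (cmod (z n))\<^sup>2 \<le> 1 / real (Suc n)"
        using * by (simp add: power2_eq_square algebra_simps)
      then have "(e + 1) * (s * (cmod (z n))\<^sup>2) \<le> (e + 1) * (1 / real (Suc n))"
        using e0 by (intro mult_left_mono) auto
      then show ?thesis using e0 by (simp add: s_def)
    qed
    have "(\<lambda>n. (e + 1) * (1 / real (Suc n))) \<longlonglongrightarrow> 0"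
      using tendsto_mult_right_zero[OF LIMSEQ_Suc[OF lim_1_over_n]] by blast
    then have "(\<lambda>n. (cmod (z n))\<^sup>2) \<longlonglongrightarrow> 0"
      by (rule Lim_null_comparison[rotated]) (use zb in auto)
    then have "(\<lambda>n. sqrt ((cmod (z n))\<^sup>2)) \<longlonglongrightarrow> sqrt 0"
      by (rule tendsto_real_sqrt)
    then have "z \<longlonglongrightarrow> 0" by (simp add: tendsto_norm_zero_iff)
    with lim show ?thesis using LIMSEQ_unique by blast
  qed
  ultimately show thesis by (rule that)
qed

section \<open>Indefinite integrals and weak derivatives\<close>

lemmas HK_add = Henstock_Kurzweil_Integration.integral_add
lemmas HK_diff = Henstock_Kurzweil_Integration.integral_diff
lemmas HK_combine = Henstock_Kurzweil_Integration.integral_combine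
lemmas HK_cnj = Henstock_Kurzweil_Integration.integral_cnj

lemma measurable_ident_lebesgue_on: "(\<lambda>x::real. x) \<in> borel_measurable (lebesgue_on S)"
  by (rule measurable_restrict_space1) (auto intro: borel_measurable_continuous_onI measurable_completion)

lemma abs_int_mult_continuous:
  fixes p :: "real \<Rightarrow> complex"
  assumes p: "p absolutely_integrable_on {a..b}" and f: "continuous_on {a..b} f"
  shows "(\<lambda>x. f x * p x) absolutely_integrable_on {a..b}"
proof (rule absolutely_integrable_bounded_measurable_product[OF bilinear_times _ _ _ p])
  show "f \<in> borel_measurable (lebesgue_on {a..b})"
    using f by (rule continuous_imp_measurable_on_sets_lebesgue) auto
  show "bounded (f ` {a..b})"
    using f by (intro compact_imp_bounded compact_continuous_image) auto
qed auto

lemma primitive_continuous: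
  fixes p :: "real \<Rightarrow> complex"
  assumes "p absolutely_integrable_on {a..b}"
  shows "continuous_on {a..b} (\<lambda>x. integral {a..x} p)"
  using assms by (intro indefinite_integral_continuous_1) (simp add: absolutely_integrable_on_def)

text \<open>
  Integration by parts for indefinite integrals of merely integrable functions, by integrating
  \<open>p s * q t\<close> over the two triangles of the square.
\<close>

lemma primitive_Fubini:
  fixes p q :: "real \<Rightarrow> complex"
  assumes p: "p absolutely_integrable_on {a..b}" and q: "q absolutely_integrable_on {a..b}"
  shows "integral {a..b} (\<lambda>x. integral {a..x} q * p x)
       + integral {a..b} (\<lambda>x. integral {a..x} p * q x) = integral {a..b} p * integral {a..b} q"
proof -
  let ?M = "lebesgue_on {a..b}"
  interpret finite_measure ?M by (rule finite_measure_lebesgue_on) auto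
  interpret PS: pair_sigma_finite ?M ?M ..
  have pM: "integrable ?M p" and qM: "integrable ?M q"
    using p q by (auto intro: absolutely_integrable_imp_integrable)
  note [measurable] = borel_measurable_integrable[OF pM] borel_measurable_integrable[OF qM]
    measurable_ident_lebesgue_on
  have pq: "integrable (?M \<Otimes>\<^sub>M ?M) (\<lambda>z. p (fst z) * q (snd z))"
  proof (rule PS.Fubini_integrable)
    show "(\<lambda>z. p (fst z) * q (snd z)) \<in> borel_measurable (?M \<Otimes>\<^sub>M ?M)" by measurable
    show "integrable ?M (\<lambda>x. LINT y|?M. norm (p (fst (x, y)) * q (snd (x, y))))"
      using pM by (simp add: norm_mult)
    show "AE x in ?M. integrable ?M (\<lambda>y. p (fst (x, y)) * q (snd (x, y)))"
      using qM by simp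
  qed
  define A where "A = {z \<in> space (?M \<Otimes>\<^sub>M ?M). snd z \<le> fst z}"
  have A: "A \<in> sets (?M \<Otimes>\<^sub>M ?M)"
    unfolding A_def by (intro borel_measurable_le measurable_compose[OF measurable_fst measurable_ident_lebesgue_on]
        measurable_compose[OF measurable_snd measurable_ident_lebesgue_on])
  have tri: "integrable (?M \<Otimes>\<^sub>M ?M) (case_prod (\<lambda>x y. indicator A (x, y) *\<^sub>R (p x * q y)))"
    using integrable_mult_indicator[OF A pq] by (simp add: case_prod_unfold)
  have restr: "(LINT y|?M. (if P y then h y else 0)) = integral {c..d} h"
    if h: "integrable ?M h" and P: "\<And>y. y \<in> {a..b} \<Longrightarrow> P y \<longleftrightarrow> y \<in> {c..d}" and cd: "{c..d} \<subseteq> {a..b}"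
    for h :: "real \<Rightarrow> complex" and P c d
  proof -
    have "integrable ?M (\<lambda>y. indicator {c..d} y *\<^sub>R h y)"
      by (rule integrable_mult_indicator[OF _ h]) (use cd in \<open>auto simp: sets_restrict_space\<close>)
    then have "(LINT y|?M. indicator {c..d} y *\<^sub>R h y) = integral {a..b} (\<lambda>y. indicator {c..d} y *\<^sub>R h y)"
      by (rule lebesgue_integral_eq_integral) auto
    moreover have "(LINT y|?M. (if P y then h y else 0)) = (LINT y|?M. indicator {c..d} y *\<^sub>R h y)"
      by (intro Bochner_Integration.integral_cong) (auto simp: P)
    moreover have "integral {a..b} (\<lambda>y. indicator {c..d} y *\<^sub>R h y) = integral ({c..d} \<inter> {a..b}) h"
      by (subst integral_restrict_Int[symmetric]) (auto intro!: integral_cong)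
    moreover have "{c..d} \<inter> {a..b} = {c..d}" using cd by blast
    ultimately show ?thesis by (simp only:)
  qed
  have inner1: "(LINT y|?M. indicator A (x, y) *\<^sub>R (p x * q y)) = integral {a..x} q * p x"
    if x: "x \<in> {a..b}" for x
  proof -
    have "(LINT y|?M. indicator A (x, y) *\<^sub>R (p x * q y)) = (LINT y|?M. p x * (if y \<le> x then q y else 0))"
      using x by (intro Bochner_Integration.integral_cong) (auto simp: A_def space_pair_measure)
    also have "\<dots> = p x * (LINT y|?M. (if y \<le> x then q y else 0))"
      by simp
    also have "(LINT y|?M. (if y \<le> x then q y else 0)) = integral {a..x} q"
      using x by (intro restr qM) auto
    finally show ?thesis by (simp add: mult.commute)
  qed
  have inner2: "(LINT x|?M. indicator A (x, y) *\<^sub>R (p x * q y)) = (integral {a..b} p - integral {a..y} p) * q y"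
    if y: "y \<in> {a..b}" for y
  proof -
    have "(LINT x|?M. indicator A (x, y) *\<^sub>R (p x * q y)) = (LINT x|?M. (if y \<le> x then p x else 0) * q y)"
      using y by (intro Bochner_Integration.integral_cong) (auto simp: A_def space_pair_measure)
    also have "\<dots> = (LINT x|?M. (if y \<le> x then p x else 0)) * q y"
      by simp
    also have "(LINT x|?M. (if y \<le> x then p x else 0)) = integral {y..b} p"
      using y by (intro restr pM) auto
    also have "\<dots> = integral {a..b} p - integral {a..y} p"
      using HK_combine[of a y b p] y p
      by (simp add: absolutely_integrable_on_def algebra_simps)
    finally show ?thesis .
  qed
  have ai1: "(\<lambda>x. integral {a..x} q * p x) absolutely_integrable_on {a..b}"
    by (intro abs_int_mult_continuous p primitive_continuous q)
  have ai2: "(\<lambda>x. integral {a..x} p * q x) absolutely_integrable_on {a..b}"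
    by (intro abs_int_mult_continuous p primitive_continuous q)
  have ai3: "(\<lambda>y. (integral {a..b} p - integral {a..y} p) * q y) absolutely_integrable_on {a..b}"
    by (intro abs_int_mult_continuous p primitive_continuous q continuous_intros)
  have "integral {a..b} (\<lambda>x. integral {a..x} q * p x) = (LINT x|?M. integral {a..x} q * p x)"
    using ai1 by (intro lebesgue_integral_eq_integral[symmetric] absolutely_integrable_imp_integrable) auto
  also have "\<dots> = (LINT x|?M. LINT y|?M. indicator A (x, y) *\<^sub>R (p x * q y))"
    by (intro Bochner_Integration.integral_cong refl) (simp add: inner1)
  also have "\<dots> = (LINT y|?M. LINT x|?M. indicator A (x, y) *\<^sub>R (p x * q y))"
    by (rule PS.Fubini_integral[OF tri, symmetric])
  also have "\<dots> = (LINT y|?M. (integral {a..b} p - integral {a..y} p) * q y)"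
    by (intro Bochner_Integration.integral_cong refl) (simp add: inner2)
  also have "\<dots> = integral {a..b} (\<lambda>y. (integral {a..b} p - integral {a..y} p) * q y)"
    using ai3 by (intro lebesgue_integral_eq_integral absolutely_integrable_imp_integrable) auto
  also have "\<dots> = integral {a..b} (\<lambda>y. integral {a..b} p * q y - integral {a..y} p * q y)"
    by (simp add: left_diff_distrib)
  also have "\<dots> = integral {a..b} (\<lambda>y. integral {a..b} p * q y) - integral {a..b} (\<lambda>y. integral {a..y} p * q y)"
    using q ai2 by (intro HK_diff integrable_on_mult_right)
      (auto simp: absolutely_integrable_on_def)
  also have "integral {a..b} (\<lambda>y. integral {a..b} p * q y) = integral {a..b} p * integral {a..b} q"
    by simp
  finally show ?thesis by simp
qed

lemma primitive_product:
  fixes p q f g :: "real \<Rightarrow> complex"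
  assumes p: "p absolutely_integrable_on {a..b}" and q: "q absolutely_integrable_on {a..b}"
    and f: "\<And>t. t \<in> {a..b} \<Longrightarrow> f t = f a + integral {a..t} p"
    and g: "\<And>t. t \<in> {a..b} \<Longrightarrow> g t = g a + integral {a..t} q"
    and ab: "a \<le> b"
  shows "(\<lambda>t. f t * q t + g t * p t) absolutely_integrable_on {a..b}"
    "integral {a..b} (\<lambda>t. f t * q t + g t * p t) = f b * g b - f a * g a"
proof -
  let ?P = "\<lambda>t. integral {a..t} p" and ?Q = "\<lambda>t. integral {a..t} q"
  have ai: "(\<lambda>t. ?Q t * p t) absolutely_integrable_on {a..b}" "(\<lambda>t. ?P t * q t) absolutely_integrable_on {a..b}"
    by (intro abs_int_mult_continuous p primitive_continuous q)+
  note pq = ai[unfolded absolutely_integrable_on_def] p[unfolded absolutely_integrable_on_def] q[unfolded absolutely_integrable_on_def]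
  have cf: "continuous_on {a..b} f"
    using primitive_continuous[OF p] by (subst continuous_on_cong[OF refl f]) (auto intro!: continuous_intros)
  have cg: "continuous_on {a..b} g"
    using primitive_continuous[OF q] by (subst continuous_on_cong[OF refl g]) (auto intro!: continuous_intros)
  show "(\<lambda>t. f t * q t + g t * p t) absolutely_integrable_on {a..b}"
    by (intro set_integral_add abs_int_mult_continuous p q cf cg)
  have "integral {a..b} (\<lambda>t. f t * q t + g t * p t)
     = integral {a..b} (\<lambda>t. (f a * q t + g a * p t) + (?P t * q t + ?Q t * p t))"
    by (intro integral_cong) (subst f g; simp add: algebra_simps)+
  also have "\<dots> = (f a * ?Q b + g a * ?P b) + (integral {a..b} (\<lambda>t. ?P t * q t) + integral {a..b} (\<lambda>t. ?Q t * p t))"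
  proof -
    have i: "(\<lambda>t. f a * q t) integrable_on {a..b}" "(\<lambda>t. g a * p t) integrable_on {a..b}"
      "(\<lambda>t. ?P t * q t) integrable_on {a..b}" "(\<lambda>t. ?Q t * p t) integrable_on {a..b}"
      using pq by (auto intro: integrable_on_mult_right)
    show ?thesis
      unfolding HK_add[OF integrable_add[OF i(1,2)] integrable_add[OF i(3,4)]]
        HK_add[OF i(1,2)] HK_add[OF i(3,4)]
      by simp
  qed
  also have "\<dots> = f a * ?Q b + g a * ?P b + ?P b * ?Q b"
    using primitive_Fubini[OF p q] by (simp add: add.commute)
  also have "\<dots> = (f a + ?P b) * (g a + ?Q b) - f a * g a"
    by (simp add: algebra_simps)
  also have "\<dots> = f b * g b - f a * g a"
    using f[of b] g[of b] ab by simp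
  finally show "integral {a..b} (\<lambda>t. f t * q t + g t * p t) = f b * g b - f a * g a" .
qed

text \<open>
  The intervals \<open>{..t}\<close> form an intersection-stable generator of the Borel sets, so the integral of \<open>w\<close>
  vanishes over every Borel set and then over every Lebesgue set.
\<close>

lemma zero_integrals_imp_AE_zero:
  fixes w :: "real \<Rightarrow> complex"
  assumes w: "w absolutely_integrable_on {0..R}"
    and zero: "\<And>t. t \<in> {0..R} \<Longrightarrow> integral {0..t} w = 0"
  shows "AE t in lebesgue_on {0..R}. w t = 0"
proof -
  interpret finite_measure "lebesgue_on {0..R}" by (rule finite_measure_lebesgue_on) auto
  show ?thesis
  proof (rule density_zero)
  show int: "integrable (lebesgue_on {0..R}) w"
    using w by (rule absolutely_integrable_imp_integrable) auto
  let ?w = "\<lambda>t. indicator {0..R} t *\<^sub>R w t"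
  have wi: "integrable lebesgue ?w"
    using w by (simp add: set_integrable_def)
  have si: "set_integrable lebesgue A ?w" if "A \<in> sets lebesgue" for A
    unfolding set_integrable_def by (rule integrable_mult_indicator[OF that wi])
  have tot: "(LINT t:UNIV|lebesgue. ?w t) = 0"
  proof (cases "R \<ge> 0")
    case True
    have "(LINT t:UNIV|lebesgue. ?w t) = (LINT t:{0..R}|lebesgue. w t)"
      by (simp add: set_lebesgue_integral_def)
    also have "\<dots> = integral {0..R} w" by (rule set_lebesgue_integral_eq_integral(2)[OF w])
    finally show ?thesis using zero[of R] True by simp
  qed (simp add: set_lebesgue_integral_def)
  have borel: "(LINT t:B|lebesgue. ?w t) = 0" if "B \<in> sets borel" for B
  proof -
    have sub: "sigma_sets UNIV (range (\<lambda>t::real. {..t})) = sets borel"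
      unfolding borel_eq_atMost by simp
    have "Int_stable (range (\<lambda>t::real. {..t}))"
      by (auto simp: Int_stable_def)
    moreover have "range (\<lambda>t::real. {..t}) \<subseteq> Pow UNIV" by simp
    moreover have "B \<in> sigma_sets UNIV (range (\<lambda>t::real. {..t}))"
      using that sub by simp
    ultimately show ?thesis
    proof (induction B rule: sigma_sets_induct_disjoint)
      case (basic A)
      then obtain t where A: "A = {..t}" by blast
      have "(LINT t:A|lebesgue. ?w t) = (LINT s:{0..min t R}|lebesgue. w s)"
        unfolding A set_lebesgue_integral_def
        by (intro Bochner_Integration.integral_cong) (auto simp: indicator_def)
      also have "\<dots> = integral {0..min t R} w"
        by (rule set_lebesgue_integral_eq_integral(2), rule set_integrable_subset[OF w]) auto
      also have "\<dots> = 0"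
        using zero[of "min t R"] by (cases "0 \<le> min t R") auto
      finally show ?case .
    next
      case empty
      then show ?case by (simp add: set_lebesgue_integral_def)
    next
      case (compl A)
      then have A: "A \<in> sets lebesgue" using sub by auto
      have "(LINT t:A \<union> (UNIV - A)|lebesgue. ?w t) = (LINT t:A|lebesgue. ?w t) + (LINT t:UNIV - A|lebesgue. ?w t)"
        using A by (intro set_integral_Un si) auto
      then show ?case using tot compl by simp
    next
      case (union A)
      then have A: "A i \<in> sets lebesgue" for i using sub by auto
      then have U: "(\<Union>i. A i) \<in> sets lebesgue" by auto
      have "(LINT t:(\<Union>i. A i)|lebesgue. ?w t) = (\<Sum>i. LINT t:A i|lebesgue. ?w t)"
        by (rule lebesgue_integral_countable_add[OF A _ si[OF U]])
          (use union in \<open>auto simp: disjoint_family_on_def\<close>)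
      then show ?case using union by simp
    qed
  qed
  fix A assume "A \<in> sets (lebesgue_on {0..R})"
  then have A: "A \<in> sets lebesgue" "A \<subseteq> {0..R}" by (auto simp: sets_restrict_space)
  then obtain S N N' where S: "A = S \<union> N" "N \<subseteq> N'" "N' \<in> null_sets lborel" "S \<in> sets lborel"
    by (auto elim: sets_completionE)
  have "set_lebesgue_integral (lebesgue_on {0..R}) A w = (LINT t:A|lebesgue. ?w t)"
    unfolding set_lebesgue_integral_def
    by (subst integral_restrict_space) (auto simp: mult.commute intro!: Bochner_Integration.integral_cong)
  also have "\<dots> = (LINT t:S|lebesgue. ?w t)"
    unfolding set_lebesgue_integral_def
  proof (rule integral_cong_AE)
    show "(\<lambda>t. indicat_real A t *\<^sub>R indicat_real {0..R} t *\<^sub>R w t) \<in> borel_measurable lebesgue"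
      using si[OF A(1)] by (simp add: set_integrable_def)
    show "(\<lambda>t. indicat_real S t *\<^sub>R indicat_real {0..R} t *\<^sub>R w t) \<in> borel_measurable lebesgue"
      using si[of S] S(4) by (simp add: set_integrable_def)
    have "AE t in lebesgue. t \<notin> N'"
      by (rule AE_not_in) (use S(3) in \<open>simp add: null_sets_completionI\<close>)
    then show "AE t in lebesgue. indicat_real A t *\<^sub>R indicat_real {0..R} t *\<^sub>R w t = indicat_real S t *\<^sub>R indicat_real {0..R} t *\<^sub>R w t"
      by eventually_elim (use S in \<open>auto simp: indicator_def\<close>)
  qed
  also have "\<dots> = 0" using borel S(4) by simp
  finally show "set_lebesgue_integral (lebesgue_on {0..R}) A w = 0" .
  qed
qed

lemma LINT_supported_in_interval:
  fixes h :: "real \<Rightarrow> complex"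
  assumes h: "h absolutely_integrable_on {a..b}" and U: "U \<in> sets lebesgue" and sub: "{a<..<b} \<subseteq> U"
    and out: "\<And>t. t \<in> U \<Longrightarrow> t \<notin> {a<..<b} \<Longrightarrow> h t = 0"
  shows "(LINT t|lebesgue_on U. h t) = integral {a..b} h"
proof -
  have h': "h absolutely_integrable_on {a<..<b}"
    using h absolutely_integrable_on_Icc_iff_Ioo by blast
  have "(LINT t|lebesgue_on U. h t) = (LINT t|lebesgue. indicator U t *\<^sub>R h t)"
    using U by (simp add: integral_restrict_space)
  also have "\<dots> = (LINT t:{a<..<b}|lebesgue. h t)"
    unfolding set_lebesgue_integral_def
    using sub out by (intro Bochner_Integration.integral_cong) (auto simp: indicator_def)
  also have "\<dots> = integral {a<..<b} h"
    by (rule set_lebesgue_integral_eq_integral(2)[OF h'])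
  also have "\<dots> = integral {a..b} h"
    by (rule integral_open_interval_real[symmetric])
  finally show ?thesis .
qed

lemma integral_subset_zero:
  fixes f :: "real \<Rightarrow> complex"
  assumes "T \<subseteq> S" and "\<And>x. x \<in> S \<Longrightarrow> x \<notin> T \<Longrightarrow> f x = 0"
  shows "integral S f = integral T f"
proof -
  have "integral S f = integral S (\<lambda>x. if x \<in> T then f x else 0)"
    using assms(2) by (intro integral_cong) auto
  also have "\<dots> = integral (T \<inter> S) f"
    by (rule integral_restrict_Int)
  also have "T \<inter> S = T" using assms(1) by blast
  finally show ?thesis .
qed

text \<open>
  The difference \<open>z\<close> of \<open>f\<close> and the primitive of \<open>g\<close> has weak derivative zero, hence is orthogonal to every
  continuous function with compact support and mean zero.  A localized version of \<open>z\<close> minus its mean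
  is itself such a function.
\<close>

lemma du_Bois_Reymond:
  fixes f g :: "real \<Rightarrow> complex"
  assumes wd: "weak_deriv U f g" and U: "U \<in> sets lebesgue" and sub: "{a<..<b} \<subseteq> U" and ab: "a < b"
    and f: "continuous_on {a<..<b} f" and g: "g absolutely_integrable_on {a..b}"
  obtains c where "\<And>t. t \<in> {a<..<b} \<Longrightarrow> f t = c + integral {a..t} g"
proof -
  define F where "F t = integral {a..t} g" for t
  have Fc: "continuous_on {a..b} F"
    unfolding F_def by (rule primitive_continuous[OF g])
  define z where "z t = f t - F t" for t
  have zc: "continuous_on {a<..<b} z"
    unfolding z_def by (intro continuous_intros f continuous_on_subset[OF Fc]) auto
  have const: "z s = z t" if st: "a < a'" "a' < s" "s \<le> t" "t < b'" "b' < b" for s t a' b'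
  proof -
    have ab': "a' < b'" using st by linarith
    define zt where "zt x = z (max a' (min b' x))" for x
    have ztc: "continuous_on UNIV zt"
      unfolding zt_def by (rule continuous_on_compose2[OF zc]) (use st ab' in \<open>auto intro!: continuous_intros\<close>)
    have zt: "zt x = z x" if "x \<in> {a'..b'}" for x
      using that by (simp add: zt_def)
    define \<rho> where "\<rho> x = max 0 ((x - a') * (b' - x))" for x
    have \<rho>c: "continuous_on A \<rho>" for A unfolding \<rho>_def by (intro continuous_intros)
    have \<rho>0: "\<rho> x = 0" if "x \<notin> {a'..b'}" for x
      proof -
      have "(x - a') * (b' - x) \<le> 0"
        using that ab' by (cases "x < a'") (auto intro: mult_nonpos_nonneg mult_nonneg_nonpos)
      then show ?thesis by (simp add: \<rho>_def)
    qed
    have \<rho>pos: "\<rho> x > 0" if "a' < x" "x < b'" for x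
      using that by (simp add: \<rho>_def)
    have \<rho>nn: "\<rho> x \<ge> 0" for x by (simp add: \<rho>_def)
    define r where "r = integral {a'..b'} \<rho>"
    have "r \<noteq> 0"
    proof
      assume "r = 0"
      then have "\<rho> ((a' + b') / 2) = 0"
        unfolding r_def using integral_eq_0_iff[OF \<rho>c ab'] \<rho>nn ab' by simp
      moreover have "\<rho> ((a' + b') / 2) > 0" using ab' by (intro \<rho>pos) auto
      ultimately show False by simp
    qed
    \<comment> \<open>With \<open>m\<close> the \<open>\<rho>\<close>-weighted mean of \<open>z\<close>, the function \<open>\<psi>\<close> has integral zero and hence a compactly
      supported primitive \<open>\<phi>\<close>, and \<open>(z - m) \<psi> = \<rho> |z - m|\<^sup>2\<close>.\<close>
    define m where "m = integral {a'..b'} (\<lambda>x. of_real (\<rho> x) * zt x) / of_real r"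
    define \<psi> where "\<psi> x = of_real (\<rho> x) * cnj (zt x - m)" for x
    have \<psi>c: "continuous_on A \<psi>" for A
      unfolding \<psi>_def by (intro continuous_intros continuous_on_subset[OF ztc] \<rho>c) auto
    have \<psi>0: "\<psi> x = 0" if "x \<notin> {a'..b'}" for x
      using \<rho>0[OF that] by (simp add: \<psi>_def)
    have int_\<psi>: "integral {a'..b'} \<psi> = 0"
    proof -
      have i1: "(\<lambda>x. of_real (\<rho> x) * zt x) integrable_on {a'..b'}"
        by (intro integrable_continuous_real continuous_intros continuous_on_subset[OF ztc] \<rho>c) auto
      have i2: "(\<lambda>x. of_real (\<rho> x) * m) integrable_on {a'..b'}"
        by (intro integrable_continuous_real continuous_intros \<rho>c)
      have "integral {a'..b'} \<psi> = integral {a'..b'} (\<lambda>x. cnj (of_real (\<rho> x) * zt x - of_real (\<rho> x) * m))"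
        by (simp add: \<psi>_def[abs_def] algebra_simps)
      also have "\<dots> = cnj (integral {a'..b'} (\<lambda>x. of_real (\<rho> x) * zt x - of_real (\<rho> x) * m))"
        by (rule HK_cnj[symmetric])
      also have "integral {a'..b'} (\<lambda>x. of_real (\<rho> x) * zt x - of_real (\<rho> x) * m)
          = integral {a'..b'} (\<lambda>x. of_real (\<rho> x) * zt x) - integral {a'..b'} (\<lambda>x. of_real (\<rho> x) * m)"
        by (rule HK_diff[OF i1 i2])
      also have "integral {a'..b'} (\<lambda>x. of_real (\<rho> x) * m) = of_real r * m"
        using integral_linear[OF integrable_continuous_real[OF \<rho>c] bounded_linear_of_real[where 'a = complex], of a' b']
        by (simp add: r_def o_def)
      also have "\<dots> = integral {a'..b'} (\<lambda>x. of_real (\<rho> x) * zt x)"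
        using \<open>r \<noteq> 0\<close> by (simp add: m_def)
      finally show ?thesis by simp
    qed
    define \<phi> where "\<phi> x = integral {a..x} \<psi>" for x
    have \<phi>0: "\<phi> x = 0" if "x \<notin> {a'..b'}" for x
    proof (cases "x < a'")
      case True
      then have "integral {a..x} \<psi> = integral {a..x} (\<lambda>_. 0)"
        by (intro integral_cong) (auto intro: \<psi>0)
      then show ?thesis by (simp add: \<phi>_def)
    next
      case False
      with that have x: "b' < x" by auto
      have "integral {a..x} \<psi> = integral {a'..b'} \<psi>"
        using x st \<psi>0 by (intro integral_subset_zero) auto
      then show ?thesis by (simp add: \<phi>_def int_\<psi>)
    qed
    have \<phi>d: "(\<phi> has_vector_derivative \<psi> x) (at x)" for x
    proof (cases "x < a'")
      case True
      have "\<forall>\<^sub>F y in nhds x. y \<in> {..<a'}"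
        using True by (intro eventually_nhds_in_open) auto
      then have "\<forall>\<^sub>F y in nhds x. y \<in> UNIV \<longrightarrow> \<phi> y = 0"
        by eventually_elim (simp add: \<phi>0)
      then have "(\<phi> has_vector_derivative 0) (at x) \<longleftrightarrow> ((\<lambda>_. 0 :: complex) has_vector_derivative 0) (at x)"
        using \<phi>0[of x] True by (intro has_vector_derivative_cong_ev[where g = "\<lambda>_. 0"]) auto
      then show ?thesis using \<psi>0[of x] True by simp
    next
      case False
      then have x: "a < x" using st by linarith
      have "(\<phi> has_vector_derivative \<psi> x) (at x within {a..x + 1})"
        unfolding \<phi>_def using x by (intro integral_has_vector_derivative \<psi>c) auto
      then show ?thesis
        using x by (simp add: at_within_Icc_at)
    qed
    have wd': "(LINT x|lebesgue_on U. f x * \<psi> x) = - (LINT x|lebesgue_on U. g x * \<phi> x)"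
    proof -
      have "{a'..b'} \<subseteq> U" using st sub by auto
      then show ?thesis
        using wd \<phi>d \<psi>c \<phi>0 unfolding weak_deriv_def by (meson compact_Icc)
    qed
    have \<phi>c: "continuous_on A \<phi>" for A
      using \<phi>d by (meson continuous_at_imp_continuous_on has_vector_derivative_continuous)
    have supp: "x \<notin> {a'..b'}" if "x \<notin> {a<..<b}" for x using that st by auto
    have ai_z: "(\<lambda>x. z x * \<psi> x) absolutely_integrable_on {a..b}"
    proof -
      have "(\<lambda>x. zt x * \<psi> x) absolutely_integrable_on {a..b}"
        by (intro absolutely_integrable_continuous_real continuous_intros \<psi>c continuous_on_subset[OF ztc]) auto
      moreover have "zt x * \<psi> x = z x * \<psi> x" for x
        using zt[of x] \<psi>0[of x] by (cases "x \<in> {a'..b'}") auto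
      ultimately show ?thesis by simp
    qed
    have ai_F: "(\<lambda>x. F x * \<psi> x) absolutely_integrable_on {a..b}"
      by (intro absolutely_integrable_continuous_real continuous_intros \<psi>c Fc)
    have ai_g: "(\<lambda>x. \<phi> x * g x) absolutely_integrable_on {a..b}"
      by (intro abs_int_mult_continuous g \<phi>c)
    have ai_f: "(\<lambda>x. f x * \<psi> x) absolutely_integrable_on {a..b}"
    proof -
      have "(\<lambda>x. z x * \<psi> x + F x * \<psi> x) absolutely_integrable_on {a..b}"
        by (intro set_integral_add ai_z ai_F)
      then show ?thesis by (simp add: z_def algebra_simps)
    qed
    have 1: "integral {a..b} (\<lambda>x. f x * \<psi> x) = - integral {a..b} (\<lambda>x. \<phi> x * g x)"
    proof -
      have "integral {a..b} (\<lambda>x. f x * \<psi> x) = (LINT x|lebesgue_on U. f x * \<psi> x)"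
        by (rule LINT_supported_in_interval[OF ai_f U sub, symmetric]) (use \<psi>0 supp in auto)
      moreover have "integral {a..b} (\<lambda>x. \<phi> x * g x) = (LINT x|lebesgue_on U. \<phi> x * g x)"
        by (rule LINT_supported_in_interval[OF ai_g U sub, symmetric]) (use \<phi>0 supp in auto)
      ultimately show ?thesis using wd' by (simp add: mult.commute)
    qed
    have ai_\<psi>: "\<psi> absolutely_integrable_on {a..b}"
      by (intro absolutely_integrable_continuous_real \<psi>c)
    have 2: "integral {a..b} (\<lambda>x. F x * \<psi> x + \<phi> x * g x) = 0"
      using primitive_product(2)[OF g ai_\<psi>, of F \<phi>] ab \<phi>0[of b] st
      by (simp add: F_def \<phi>_def)
    have "integral {a..b} (\<lambda>x. z x * \<psi> x) = 0"
    proof -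
      have "integral {a..b} (\<lambda>x. z x * \<psi> x) = integral {a..b} (\<lambda>x. f x * \<psi> x) - integral {a..b} (\<lambda>x. F x * \<psi> x)"
        using ai_f ai_F unfolding z_def left_diff_distrib
        by (intro HK_diff) (auto simp: absolutely_integrable_on_def)
      moreover have "integral {a..b} (\<lambda>x. F x * \<psi> x + \<phi> x * g x) = integral {a..b} (\<lambda>x. F x * \<psi> x) + integral {a..b} (\<lambda>x. \<phi> x * g x)"
        using ai_F ai_g by (intro HK_add) (auto simp: absolutely_integrable_on_def)
      ultimately show ?thesis using 1 2 by (metis add.inverse_inverse add_eq_0_iff2 diff_self)
    qed
    moreover have "integral {a..b} (\<lambda>x. z x * \<psi> x) = integral {a'..b'} (\<lambda>x. z x * \<psi> x)"
      using st \<psi>0 by (intro integral_subset_zero) auto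
    moreover have "integral {a'..b'} (\<lambda>x. z x * \<psi> x) = integral {a'..b'} (\<lambda>x. zt x * \<psi> x)"
      by (intro integral_cong) (simp add: zt)
    ultimately have 3: "integral {a'..b'} (\<lambda>x. zt x * \<psi> x) = 0" by simp
    have "integral {a'..b'} (\<lambda>x. (zt x - m) * \<psi> x) = integral {a'..b'} (\<lambda>x. zt x * \<psi> x) - integral {a'..b'} (\<lambda>x. m * \<psi> x)"
      unfolding left_diff_distrib
      by (intro HK_diff integrable_continuous_real continuous_intros \<psi>c continuous_on_subset[OF ztc]) auto
    also have "\<dots> = 0" using 3 int_\<psi> by simp
    also have "(\<lambda>x. (zt x - m) * \<psi> x) = (\<lambda>x. complex_of_real (\<rho> x * (cmod (zt x - m))\<^sup>2))"
      by (simp only: of_real_mult complex_norm_square \<psi>_def) (simp add: algebra_simps)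
    finally have "integral {a'..b'} (\<lambda>x. complex_of_real (\<rho> x * (cmod (zt x - m))\<^sup>2)) = 0" .
    moreover have qc: "continuous_on {a'..b'} (\<lambda>x. \<rho> x * (cmod (zt x - m))\<^sup>2)"
      by (intro continuous_intros \<rho>c continuous_on_subset[OF ztc]) auto
    ultimately have "integral {a'..b'} (\<lambda>x. \<rho> x * (cmod (zt x - m))\<^sup>2) = 0"
      using integral_linear[OF integrable_continuous_real[OF qc] bounded_linear_of_real[where 'a = complex]]
      by (simp add: o_def)
    then have null: "\<rho> x * (cmod (zt x - m))\<^sup>2 = 0" if "x \<in> {a'..b'}" for x
      using integral_eq_0_iff[OF qc ab'] \<rho>nn that by simp
    have "z x = m" if "a' < x" "x < b'" for x
      using null[of x] \<rho>pos[of x] zt[of x] that by simp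
    then show ?thesis using st by simp
  qed
  have "z t = z ((a + b) / 2)" if t: "t \<in> {a<..<b}" for t
  proof (cases "t \<le> (a + b) / 2")
    case True
    show ?thesis
      by (rule const[of "(a + t) / 2" _ _ "(b + (a + b) / 2) / 2"]) (use True t ab in auto)
  next
    case False
    show ?thesis
      by (rule const[of "(a + (a + b) / 2) / 2" _ _ "(b + t) / 2", symmetric]) (use False t ab in auto)
  qed
  then show thesis
    by (intro that[of "z ((a + b) / 2)"]) (metis F_def diff_add_cancel z_def)
qed

section \<open>Initial value problems with point interactions\<close>

locale point_interactions =
  fixes x \<alpha> :: "nat \<Rightarrow> real"
  assumes x0: "x 0 = 0" and smono: "strict_mono x" and unb: "\<And>R. \<exists>n. R < x n"
begin

text \<open>
  The equation \<open>u'' = w\<close> off the nodes with the interface conditions at the nodes, in integrated form: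
  \<open>u\<close> is continuous, and \<open>v\<close> is the right-continuous representative of \<open>u'\<close>, whose jump at a node
  is \<open>\<alpha>\<close> times the value of \<open>u\<close>.  There is no condition on \<open>v\<close> at zero.
\<close>

definition solves :: "(real \<Rightarrow> complex) \<Rightarrow> (real \<Rightarrow> complex) \<Rightarrow> (real \<Rightarrow> complex) \<Rightarrow> bool" where
  "solves w u v \<longleftrightarrow>
     (\<forall>n. \<forall>t \<in> {x n..<x (Suc n)}. v t = v (x n) + integral {x n..t} w) \<and>
     (\<forall>n. \<forall>t \<in> {x n..x (Suc n)}. u t = u (x n) + integral {x n..t} v) \<and>
     (\<forall>n. v (x (Suc n)) = v (x n) + integral {x n..x (Suc n)} w + of_real (\<alpha> (Suc n)) * u (x (Suc n)))"

definition locally_integrable :: "(real \<Rightarrow> complex) \<Rightarrow> bool" where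
  "locally_integrable w \<longleftrightarrow> (\<forall>R. w absolutely_integrable_on {0..R})"

lemma x_less: "x n < x (Suc n)" using smono by (simp add: strict_mono_def)

lemma x_nonneg: "0 \<le> x n"
  using smono x0 by (metis le0 strict_mono_less_eq)

lemma ex_cell:
  assumes "0 \<le> t" shows "\<exists>n. x n \<le> t \<and> t < x (Suc n)"
proof -
  define n where "n = (LEAST n. t < x n)"
  have n: "t < x n" unfolding n_def using unb[of t] by (auto intro: LeastI)
  then have "n \<noteq> 0" using x0 assms by (metis not_less)
  then obtain m where m: "n = Suc m" by (cases n) auto
  have "\<not> t < x m" using not_less_Least[of m "\<lambda>n. t < x n"] m by (simp add: n_def)
  with n m show ?thesis by (intro exI[of _ m]) auto
qed

lemma locally_integrable_cell: "locally_integrable w \<Longrightarrow> 0 \<le> a \<Longrightarrow> w absolutely_integrable_on {a..b}"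
  unfolding locally_integrable_def
  by (rule absolutely_integrable_on_subinterval[where S = "{0..b}"]) auto

lemma locally_integrableI:
  assumes "\<And>n. w absolutely_integrable_on {x n..x (Suc n)}"
  shows "locally_integrable w"
proof -
  have *: "w absolutely_integrable_on {0..x n}" for n
  proof (induction n)
    case (Suc n)
    have "{0..x (Suc n)} = {0..x n} \<union> {x n..x (Suc n)}"
      using x_nonneg[of n] x_less[of n] by auto
    then show ?case using Suc assms by (auto intro!: set_integrable_Un)
  qed (simp add: x0 absolutely_integrable_negligible)
  show ?thesis
    unfolding locally_integrable_def
  proof
    fix R
    obtain n where "R < x n" using unb by blast
    then show "w absolutely_integrable_on {0..R}"
      by (intro absolutely_integrable_on_subinterval[OF *[of n]]) auto
  qed
qed

lemma locally_integrable_uminus: "locally_integrable w \<Longrightarrow> locally_integrable (\<lambda>t. - w t)"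
  by (auto simp: locally_integrable_def absolutely_integrable_on_def intro: integrable_neg)

lemma locally_integrable_cnj: "locally_integrable w \<Longrightarrow> locally_integrable (\<lambda>t. cnj (w t))"
  by (auto simp: locally_integrable_def absolutely_integrable_on_def integrable_on_cnj_iff)

lemma locally_integrable_zero: "locally_integrable (\<lambda>_. 0)"
  by (simp add: locally_integrable_def)

lemma integral_combine_loc:
  assumes "locally_integrable h" "0 \<le> a" "a \<le> b" "b \<le> c"
  shows "integral {a..c} h = integral {a..b} h + integral {b..c} h"
  using HK_combine[of a b c h] locally_integrable_cell[OF assms(1,2), of c] assms
  by (simp add: absolutely_integrable_on_def)

lemma primitive_glue:
  assumes h: "locally_integrable h"
    and cell: "\<And>n t. t \<in> {x n..x (Suc n)} \<Longrightarrow> F t = F (x n) + integral {x n..t} h"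
    and t: "0 \<le> t"
  shows "F t = F 0 + integral {0..t} h"
proof -
  have *: "F (x n) = F 0 + integral {0..x n} h" for n
  proof (induction n)
    case (Suc n)
    then show ?case
      using cell[of "x (Suc n)" n] x_less[of n] integral_combine_loc[OF h _ x_nonneg[of n], of "x (Suc n)"]
      by simp
  qed (simp add: x0)
  obtain n where n: "x n \<le> t" "t < x (Suc n)" using ex_cell[OF t] by blast
  then show ?thesis
    using cell[of t n] *[of n] integral_combine_loc[OF h _ x_nonneg[of n], of t] by simp
qed

lemma solvesD:
  assumes "solves w u v"
  shows "\<And>n t. t \<in> {x n..<x (Suc n)} \<Longrightarrow> v t = v (x n) + integral {x n..t} w"
    and "\<And>n t. t \<in> {x n..x (Suc n)} \<Longrightarrow> u t = u (x n) + integral {x n..t} v"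
    and "\<And>n. v (x (Suc n)) = v (x n) + integral {x n..x (Suc n)} w + of_real (\<alpha> (Suc n)) * u (x (Suc n))"
  using assms unfolding solves_def by blast+

lemma solves_v_cell:
  assumes w: "locally_integrable w" and s: "solves w u v"
  shows "v absolutely_integrable_on {x n..x (Suc n)}"
proof -
  have "continuous_on {x n..x (Suc n)} (\<lambda>t. v (x n) + integral {x n..t} w)"
    by (intro continuous_intros primitive_continuous locally_integrable_cell[OF w x_nonneg])
  then have "(\<lambda>t. v (x n) + integral {x n..t} w) absolutely_integrable_on {x n..x (Suc n)}"
    by (rule absolutely_integrable_continuous_real)
  then show ?thesis
    by (rule absolutely_integrable_spike[OF _ negligible_sing[of "x (Suc n)"]])
      (use solvesD(1)[OF s] in auto)
qed

lemma solves_v_locally_integrable: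
  "locally_integrable w \<Longrightarrow> solves w u v \<Longrightarrow> locally_integrable v"
  by (rule locally_integrableI) (rule solves_v_cell)

lemma solves_u_primitive:
  assumes w: "locally_integrable w" and s: "solves w u v" and "0 \<le> t"
  shows "u t = u 0 + integral {0..t} v"
  by (rule primitive_glue[OF solves_v_locally_integrable[OF w s] solvesD(2)[OF s] \<open>0 \<le> t\<close>])

lemma solves_u_continuous:
  assumes w: "locally_integrable w" and s: "solves w u v"
  shows "continuous_on {0..R} u"
proof -
  have "continuous_on {0..R} (\<lambda>t. u 0 + integral {0..t} v)"
    by (intro continuous_intros primitive_continuous
        locally_integrable_cell[OF solves_v_locally_integrable[OF w s]]) auto
  then show ?thesis
    by (rule continuous_on_eq) (simp add: solves_u_primitive[OF w s, symmetric])
qed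

text \<open>
  The Wronskian is continuous across the nodes, because both derivatives jump there by the same
  multiple of the respective value; between the nodes its derivative is \<open>u1 w2 - u2 w1\<close>.
\<close>

lemma Lagrange_identity:
  assumes w: "locally_integrable w1" "locally_integrable w2"
    and s: "solves w1 u1 v1" "solves w2 u2 v2"
  shows "locally_integrable (\<lambda>t. u1 t * w2 t - u2 t * w1 t)"
    and "\<And>t. 0 \<le> t \<Longrightarrow> u1 t * v2 t - v1 t * u2 t
        = (u1 0 * v2 0 - v1 0 * u2 0) + integral {0..t} (\<lambda>t. u1 t * w2 t - u2 t * w1 t)"
proof -
  let ?h = "\<lambda>t. u1 t * w2 t - u2 t * w1 t"
  show loc: "locally_integrable ?h"
    unfolding locally_integrable_def
    by (intro allI set_integral_diff abs_int_mult_continuous solves_u_continuous[OF w(1) s(1)]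
        solves_u_continuous[OF w(2) s(2)] locally_integrable_cell[OF w(1)] locally_integrable_cell[OF w(2)]) auto
  fix t :: real assume "0 \<le> t"
  let ?W = "\<lambda>t. u1 t * v2 t - v1 t * u2 t"
  have "?W t = ?W 0 + integral {0..t} ?h"
  proof (rule primitive_glue[OF loc _ \<open>0 \<le> t\<close>])
    fix n t assume t: "t \<in> {x n..x (Suc n)}"
    define V1 where "V1 r = v1 (x n) + integral {x n..r} w1" for r
    define V2 where "V2 r = v2 (x n) + integral {x n..r} w2" for r
    have V0: "V1 (x n) = v1 (x n)" "V2 (x n) = v2 (x n)" by (simp_all add: V1_def V2_def)
    have ai: "w1 absolutely_integrable_on {x n..t}" "w2 absolutely_integrable_on {x n..t}"
      "v1 absolutely_integrable_on {x n..t}" "v2 absolutely_integrable_on {x n..t}"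
      using locally_integrable_cell[OF _ x_nonneg] w solves_v_locally_integrable[OF w(1) s(1)]
        solves_v_locally_integrable[OF w(2) s(2)] by blast+
    have u1: "u1 r = u1 (x n) + integral {x n..r} v1" and u2: "u2 r = u2 (x n) + integral {x n..r} v2"
      if "r \<in> {x n..t}" for r
      using solvesD(2)[OF s(1), of r n] solvesD(2)[OF s(2), of r n] that t by auto
    have A: "(\<lambda>r. u1 r * w2 r + V2 r * v1 r) absolutely_integrable_on {x n..t}"
        "integral {x n..t} (\<lambda>r. u1 r * w2 r + V2 r * v1 r) = u1 t * V2 t - u1 (x n) * V2 (x n)"
      using primitive_product[OF ai(3) ai(2) u1, of V2] t V0 by (auto simp: V2_def)
    have B: "(\<lambda>r. u2 r * w1 r + V1 r * v2 r) absolutely_integrable_on {x n..t}"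
        "integral {x n..t} (\<lambda>r. u2 r * w1 r + V1 r * v2 r) = u2 t * V1 t - u2 (x n) * V1 (x n)"
      using primitive_product[OF ai(4) ai(1) u2, of V1] t V0 by (auto simp: V1_def)
    have "integral {x n..t} ?h = integral {x n..t} (\<lambda>r. (u1 r * w2 r + V2 r * v1 r) - (u2 r * w1 r + V1 r * v2 r))"
    proof (rule integral_spike[OF negligible_sing[of "x (Suc n)"]])
      fix r assume r: "r \<in> {x n..t} - {x (Suc n)}"
      then have "v1 r = V1 r" "v2 r = V2 r"
        using solvesD(1)[OF s(1), of r n] solvesD(1)[OF s(2), of r n] t by (auto simp: V1_def V2_def)
      then show "(u1 r * w2 r + V2 r * v1 r) - (u2 r * w1 r + V1 r * v2 r) = u1 r * w2 r - u2 r * w1 r"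
        by (simp add: algebra_simps)
    qed
    also have "\<dots> = (u1 t * V2 t - u1 (x n) * V2 (x n)) - (u2 t * V1 t - u2 (x n) * V1 (x n))"
      using A B by (subst HK_diff) (auto simp: absolutely_integrable_on_def)
    also have "\<dots> = (u1 t * V2 t - V1 t * u2 t) - ?W (x n)"
      by (simp add: V0 algebra_simps)
    also have "u1 t * V2 t - V1 t * u2 t = ?W t"
    proof (cases "t = x (Suc n)")
      case True
      then show ?thesis
        using solvesD(3)[OF s(1), of n] solvesD(3)[OF s(2), of n] by (simp add: V1_def V2_def algebra_simps)
    next
      case False
      then show ?thesis
        using solvesD(1)[OF s(1), of t n] solvesD(1)[OF s(2), of t n] t by (simp add: V1_def V2_def)
    qed
    finally show "?W t = ?W (x n) + integral {x n..t} ?h" by simp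
  qed
  then show "?W t = ?W 0 + integral {0..t} ?h" .
qed

lemma solves_add:
  assumes w: "locally_integrable w1" "locally_integrable w2"
    and s: "solves w1 u1 v1" "solves w2 u2 v2"
  shows "solves (\<lambda>t. w1 t + w2 t) (\<lambda>t. u1 t + u2 t) (\<lambda>t. v1 t + v2 t)"
proof -
  note i = locally_integrable_cell[OF _ x_nonneg, unfolded absolutely_integrable_on_def, THEN conjunct1]
  have "integral {x n..t} (\<lambda>t. w1 t + w2 t) = integral {x n..t} w1 + integral {x n..t} w2" for n t
    by (intro HK_add i w)
  moreover have "integral {x n..t} (\<lambda>t. v1 t + v2 t) = integral {x n..t} v1 + integral {x n..t} v2" for n t
    using w s by (intro HK_add i) (rule solves_v_locally_integrable; assumption)+
  ultimately have I: "integral {x n..t} (\<lambda>t. w1 t + w2 t) = integral {x n..t} w1 + integral {x n..t} w2"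
    "integral {x n..t} (\<lambda>t. v1 t + v2 t) = integral {x n..t} v1 + integral {x n..t} v2" for n t
    by blast+
  show ?thesis
    (is "solves ?w ?u ?V")
    unfolding solves_def
  proof (intro conjI allI ballI)
    fix n t
    show "?V t = ?V (x n) + integral {x n..t} ?w" if "t \<in> {x n..<x (Suc n)}"
      using solvesD(1)[OF s(1) that] solvesD(1)[OF s(2) that] unfolding I by simp
    show "?u t = ?u (x n) + integral {x n..t} ?V" if "t \<in> {x n..x (Suc n)}"
      using solvesD(2)[OF s(1) that] solvesD(2)[OF s(2) that] unfolding I by simp
    show "?V (x (Suc n)) = ?V (x n) + integral {x n..x (Suc n)} ?w + of_real (\<alpha> (Suc n)) * ?u (x (Suc n))"
      using solvesD(3)[OF s(1), of n] solvesD(3)[OF s(2), of n] unfolding I by (simp add: algebra_simps)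
  qed
qed

lemma solves_scale:
  assumes s: "solves w u v"
  shows "solves (\<lambda>t. c * w t) (\<lambda>t. c * u t) (\<lambda>t. c * v t)" (is "solves ?w ?u ?V")
  unfolding solves_def
proof (intro conjI allI ballI)
  fix n t
  show "?V t = ?V (x n) + integral {x n..t} ?w" if "t \<in> {x n..<x (Suc n)}"
    using solvesD(1)[OF s that] by (simp add: distrib_left)
  show "?u t = ?u (x n) + integral {x n..t} ?V" if "t \<in> {x n..x (Suc n)}"
    using solvesD(2)[OF s that] by (simp add: distrib_left)
  show "?V (x (Suc n)) = ?V (x n) + integral {x n..x (Suc n)} ?w + of_real (\<alpha> (Suc n)) * ?u (x (Suc n))"
    using solvesD(3)[OF s, of n] by (simp add: algebra_simps)
qed

lemma solves_cnj:
  assumes s: "solves w u v"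
  shows "solves (\<lambda>t. cnj (w t)) (\<lambda>t. cnj (u t)) (\<lambda>t. cnj (v t))" (is "solves ?w ?u ?V")
  unfolding solves_def
proof (intro conjI allI ballI)
  fix n t
  show "?V t = ?V (x n) + integral {x n..t} ?w" if "t \<in> {x n..<x (Suc n)}"
    using solvesD(1)[OF s that] by (simp flip: HK_cnj)
  show "?u t = ?u (x n) + integral {x n..t} ?V" if "t \<in> {x n..x (Suc n)}"
    using solvesD(2)[OF s that] by (simp flip: HK_cnj)
  show "?V (x (Suc n)) = ?V (x n) + integral {x n..x (Suc n)} ?w + of_real (\<alpha> (Suc n)) * ?u (x (Suc n))"
    using solvesD(3)[OF s, of n] by (simp flip: HK_cnj)
qed

lemma solves_exists:
  assumes w: "locally_integrable w"
  obtains u v where "solves w u v" "u 0 = c" "v 0 = b"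
proof -
  define V where "V n b t = b + integral {x n..t} w" for n b t
  define st where "st = rec_nat (c, b) (\<lambda>n (c, b).
     let c' = c + integral {x n..x (Suc n)} (V n b)
     in (c', V n b (x (Suc n)) + of_real (\<alpha> (Suc n)) * c'))"
  have st0: "st 0 = (c, b)" by (simp add: st_def)
  have stS: "fst (st (Suc n)) = fst (st n) + integral {x n..x (Suc n)} (V n (snd (st n)))"
    "snd (st (Suc n)) = V n (snd (st n)) (x (Suc n)) + of_real (\<alpha> (Suc n)) * fst (st (Suc n))" for n
    by (simp_all add: st_def Let_def case_prod_beta)
  define idx where "idx t = (THE n. x n \<le> t \<and> t < x (Suc n))" for t
  have idx: "idx t = n" if "x n \<le> t" "t < x (Suc n)" for n t
    unfolding idx_def
  proof (rule the_equality)
    fix m assume m: "x m \<le> t \<and> t < x (Suc m)"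
    then have "x m < x (Suc n)" "x n < x (Suc m)" using that by auto
    then show "m = n" using smono by (simp add: strict_mono_less)
  qed (use that in auto)
  define v where "v t = V (idx t) (snd (st (idx t))) t" for t
  define u where "u t = fst (st (idx t)) + integral {x (idx t)..t} (V (idx t) (snd (st (idx t))))" for t
  have vn: "v t = V n (snd (st n)) t" if "t \<in> {x n..<x (Suc n)}" for n t
    using idx[of n t] that by (simp add: v_def)
  have vx: "v (x n) = snd (st n)" for n
    using vn[of "x n" n] x_less[of n] by (simp add: V_def)
  have ux: "u (x n) = fst (st n)" for n
    using idx[of n "x n"] x_less[of n] by (simp add: u_def)
  have iv: "integral {x n..t} (V n (snd (st n))) = integral {x n..t} v" if "t \<in> {x n..x (Suc n)}" for n t
    by (rule integral_spike[OF negligible_sing[of "x (Suc n)"]]) (use vn that in auto)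
  have "solves w u v"
    unfolding solves_def
  proof (intro conjI allI ballI)
    fix n t
    show "v t = v (x n) + integral {x n..t} w" if "t \<in> {x n..<x (Suc n)}"
      using vn[OF that] vx[of n] by (simp add: V_def)
    show "u t = u (x n) + integral {x n..t} v" if t: "t \<in> {x n..x (Suc n)}"
    proof (cases "t = x (Suc n)")
      case True
      then show ?thesis using iv[OF t] stS(1)[of n] by (simp add: ux)
    next
      case False
      then show ?thesis using iv[OF t] idx[of n t] t unfolding ux by (simp add: u_def)
    qed
    show "v (x (Suc n)) = v (x n) + integral {x n..x (Suc n)} w + of_real (\<alpha> (Suc n)) * u (x (Suc n))"
      using stS(2)[of n] unfolding vx ux by (simp add: V_def)
  qed
  moreover have "u 0 = c" "v 0 = b" using ux[of 0] vx[of 0] st0 by (simp_all add: x0)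
  ultimately show thesis by (rule that)
qed

end

section \<open>The minimal operator through initial value problems\<close>

lemma negligible_of_countable: "countable (S :: real set) \<Longrightarrow> negligible S"
  by (simp add: negligible_iff_null_sets null_sets_completionI countable_imp_null_set_lborel)

lemma AE_lebesgue_on_negligible:
  fixes S :: "real set"
  assumes "AE t in lebesgue_on S. P t" and S: "S \<in> sets lebesgue"
  obtains N where "negligible N" "\<And>t. t \<in> S \<Longrightarrow> t \<notin> N \<Longrightarrow> P t"
proof -
  have "AE t in lebesgue. t \<in> S \<longrightarrow> P t"
    using assms by (simp add: AE_restrict_space_iff)
  then obtain N where "N \<in> null_sets lebesgue" "{t \<in> space lebesgue. \<not> (t \<in> S \<longrightarrow> P t)} \<subseteq> N"
    unfolding eventually_ae_filter by blast
  then show thesis by (intro that[of N]) (auto simp: negligible_iff_null_sets)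
qed

lemma negligible_AE_lebesgue_on:
  fixes S :: "real set"
  assumes "negligible N" "\<And>t. t \<in> S \<Longrightarrow> t \<notin> N \<Longrightarrow> P t" and S: "S \<in> sets lebesgue"
  shows "AE t in lebesgue_on S. P t"
proof -
  have "AE t in lebesgue. t \<notin> N"
    using assms(1) by (intro AE_not_in) (simp add: negligible_iff_null_sets)
  then have "AE t in lebesgue. t \<in> S \<longrightarrow> P t"
    by eventually_elim (use assms(2) in auto)
  then show ?thesis using S by (simp add: AE_restrict_space_iff)
qed

lemma L2_subset:
  assumes f: "f \<in> L2 S" and "T \<subseteq> S" "S \<in> sets lebesgue" "T \<in> sets lebesgue"
  shows "f \<in> L2 T"
proof -
  have "set_integrable lebesgue S (\<lambda>x. (cmod (f x))\<^sup>2)"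
    using L2_sq_integrable[OF f] assms(3) by (simp add: integrable_restrict_space set_integrable_def)
  then have "set_integrable lebesgue T (\<lambda>x. (cmod (f x))\<^sup>2)"
    by (rule set_integrable_subset) (use assms in auto)
  then have "integrable (lebesgue_on T) (\<lambda>x. (cmod (f x))\<^sup>2)"
    using assms(4) by (simp add: integrable_restrict_space set_integrable_def)
  moreover have "f \<in> borel_measurable (lebesgue_on T)"
    using L2_measurable[OF f] \<open>T \<subseteq> S\<close> by (rule measurable_restrict_mono)
  ultimately show ?thesis by (simp add: L2_def)
qed

lemma L2_absolutely_integrable:
  assumes f: "f \<in> L2 {0<..}"
  shows "f absolutely_integrable_on {0..R}"
proof -
  have f': "f \<in> L2 {0<..<R}"
    by (rule L2_subset[OF f]) auto
  interpret finite_measure "lebesgue_on {0<..<R}"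
    by (rule finite_measure_lebesgue_on) auto
  have "integrable (lebesgue_on {0<..<R}) (\<lambda>x. (f x)\<^sup>2)"
    using L2_sq_integrable[OF f'] L2_measurable[OF f']
    by (subst integrable_norm_iff[symmetric]) (auto simp: norm_power)
  then have "integrable (lebesgue_on {0<..<R}) f"
    by (rule square_integrable_imp_integrable[OF L2_measurable[OF f']])
  then have "f absolutely_integrable_on {0<..<R}"
    by (simp add: integrable_restrict_space set_integrable_def)
  then show ?thesis using absolutely_integrable_on_Icc_iff_Ioo by blast
qed

lemma L2_bounded_support:
  assumes p: "p \<in> borel_measurable (lebesgue_on S)" and S: "S \<in> sets lebesgue" "S \<subseteq> {0<..}"
    and B: "\<And>t. t \<in> S \<Longrightarrow> t \<le> R \<Longrightarrow> cmod (p t) \<le> B"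
    and out: "\<And>t. t \<in> S \<Longrightarrow> R < t \<Longrightarrow> p t = 0"
  shows "p \<in> L2 S"
proof -
  let ?A = "S \<inter> {0<..R}"
  have A: "?A \<in> sets (lebesgue_on S)" using S by (auto simp: sets_restrict_space)
  have "emeasure (lebesgue_on S) ?A = emeasure lebesgue ?A"
    using S by (intro emeasure_restrict_space) auto
  also have "\<dots> \<le> emeasure lebesgue {0<..R}" by (rule emeasure_mono) auto
  also have "\<dots> < \<infinity>" by (cases "0 \<le> R") auto
  finally have fin: "emeasure (lebesgue_on S) ?A < \<infinity>" .
  have "integrable (lebesgue_on S) (\<lambda>t. (cmod (p t))\<^sup>2)"
  proof (rule integrableI_bounded_set[OF A _ fin])
    show "(\<lambda>t. (cmod (p t))\<^sup>2) \<in> borel_measurable (lebesgue_on S)" using p by measurable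
    show "AE t in lebesgue_on S. t \<in> ?A \<longrightarrow> norm ((cmod (p t))\<^sup>2) \<le> B\<^sup>2"
      using B by (intro AE_I2) (auto intro!: power_mono)
    show "AE t in lebesgue_on S. t \<notin> ?A \<longrightarrow> (cmod (p t))\<^sup>2 = 0"
      using S out by (intro AE_I2) (force simp: space_restrict_space not_le)
  qed
  with p show ?thesis by (simp add: L2_def)
qed

lemma primitive_limits:
  fixes f p :: "real \<Rightarrow> complex"
  assumes p: "p absolutely_integrable_on {a..b}" and ab: "a < b"
    and f: "\<And>t. t \<in> {a<..<b} \<Longrightarrow> f t = c + integral {a..t} p"
  shows "(f \<longlongrightarrow> c) (at_right a)" "(f \<longlongrightarrow> c + integral {a..b} p) (at_left b)"
proof -
  let ?F = "\<lambda>t. c + integral {a..t} p"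
  have c: "continuous_on {a..b} ?F" by (intro continuous_intros primitive_continuous p)
  have "(?F \<longlongrightarrow> ?F a) (at_right a)" by (rule continuous_on_Icc_at_rightD[OF c ab])
  moreover have "\<forall>\<^sub>F t in at_right a. ?F t = f t"
    using ab f by (intro eventually_at_rightI[of a b]) auto
  ultimately show "(f \<longlongrightarrow> c) (at_right a)"
    by (simp add: tendsto_cong)
  have "(?F \<longlongrightarrow> ?F b) (at_left b)" by (rule continuous_on_Icc_at_leftD[OF c ab])
  moreover have "\<forall>\<^sub>F t in at_left b. ?F t = f t"
    using ab f by (intro eventually_at_leftI[of a b]) auto
  ultimately show "(f \<longlongrightarrow> c + integral {a..b} p) (at_left b)"
    by (simp add: tendsto_cong)
qed

context point_interactions
begin

abbreviation cells :: "real set" where "cells \<equiv> {0<..} - range x"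

lemma L2_locally_integrable: "w \<in> L2 {0<..} \<Longrightarrow> locally_integrable w"
  by (simp add: locally_integrable_def L2_absolutely_integrable)

lemma negligible_range_x: "negligible (range x)"
  by (rule negligible_of_countable) simp

lemma cells_sets: "cells \<in> sets lebesgue"
  using negligible_range_x by (intro sets.Diff) (auto simp: negligible_imp_sets)

lemma cell_subset: "{x n<..<x (Suc n)} \<subseteq> cells"
proof
  fix t assume t: "t \<in> {x n<..<x (Suc n)}"
  have "t \<noteq> x m" for m
  proof
    assume "t = x m"
    with t have "n < m" "m < Suc n" using smono by (auto simp: strict_mono_less)
    then show False by simp
  qed
  then show "t \<in> cells" using t x_nonneg[of n] by auto
qed

lemma cellsE:
  assumes "t \<in> cells" obtains n where "t \<in> {x n<..<x (Suc n)}"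
proof -
  obtain n where "x n \<le> t" "t < x (Suc n)" using ex_cell[of t] assms by auto
  moreover have "x n \<noteq> t" using assms by auto
  ultimately show thesis by (intro that[of n]) auto
qed

text \<open>
  The continuous representatives of a \<open>W\<^bsup>2,2\<^esup>\<close> function are primitives on every cell; their values at the
  nodes are filled in by the right limits.
\<close>

lemma H0_imp_solves:
  assumes fg: "(f, g) \<in> H0_graph x \<alpha>"
  obtains u v R where "solves (\<lambda>t. - g t) u v" "v 0 = 0" "AE t in lebesgue_on {0<..}. f t = u t"
    "\<And>t. R < t \<Longrightarrow> u t = 0"
proof -
  from fg have gL: "g \<in> L2 {0<..}" by (simp add: H0_graph_def)
  from fg obtain u v w R where W: "W22 cells u v w" and fu: "AE t in lebesgue_on {0<..}. f t = u t"
    and gw: "AE t in lebesgue_on {0<..}. g t = - w t" and R: "\<And>t. t \<in> cells \<Longrightarrow> R < t \<Longrightarrow> u t = 0"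
    and v0: "(v \<longlongrightarrow> 0) (at_right 0)"
    and jump: "\<And>n. n \<ge> 1 \<Longrightarrow> \<exists>c a b. (u \<longlongrightarrow> c) (at_left (x n)) \<and> (u \<longlongrightarrow> c) (at_right (x n)) \<and>
           (v \<longlongrightarrow> a) (at_left (x n)) \<and> (v \<longlongrightarrow> b) (at_right (x n)) \<and> b - a = of_real (\<alpha> n) * c"
    unfolding H0_graph_def by blast
  from W have wd: "weak_deriv cells u v" "weak_deriv cells v w" and uc: "continuous_on cells u"
    and vc: "continuous_on cells v" by (auto simp: W22_def)
  obtain N where N: "negligible N" "\<And>t. t \<in> {0<..} \<Longrightarrow> t \<notin> N \<Longrightarrow> g t = - w t"
    using AE_lebesgue_on_negligible[OF gw] by auto
  have N0: "negligible (N \<union> {0})" using N(1) by simp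
  have gloc: "locally_integrable (\<lambda>t. - g t)"
    by (intro locally_integrable_uminus L2_locally_integrable gL)
  have wi: "w absolutely_integrable_on {x n..x (Suc n)}" for n
    by (rule absolutely_integrable_spike[OF locally_integrable_cell[OF gloc x_nonneg] N0])
      (use N(2) x_nonneg[of n] in auto)
  have iw: "integral {x n..t} w = integral {x n..t} (\<lambda>t. - g t)" for n t
    by (rule integral_spike[OF N0]) (use N(2) x_nonneg[of n] in auto)
  have "\<exists>b. \<forall>t\<in>{x n<..<x (Suc n)}. v t = b + integral {x n..t} w" for n
    by (rule du_Bois_Reymond[OF wd(2) cells_sets cell_subset x_less continuous_on_subset[OF vc cell_subset] wi])
      blast
  then obtain b where b: "\<And>n t. t \<in> {x n<..<x (Suc n)} \<Longrightarrow> v t = b n + integral {x n..t} w"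
    by metis
  have vi: "v absolutely_integrable_on {x n..x (Suc n)}" for n
  proof -
    have "continuous_on {x n..x (Suc n)} (\<lambda>t. b n + integral {x n..t} w)"
      by (intro continuous_intros primitive_continuous wi)
    then have *: "(\<lambda>t. b n + integral {x n..t} w) absolutely_integrable_on {x n..x (Suc n)}"
      by (rule absolutely_integrable_continuous_real)
    have "negligible {x n, x (Suc n)}" by simp
    then show ?thesis
      by (rule absolutely_integrable_spike[OF *]) (use b[of _ n] in auto)
  qed
  have "\<exists>c. \<forall>t\<in>{x n<..<x (Suc n)}. u t = c + integral {x n..t} v" for n
    by (rule du_Bois_Reymond[OF wd(1) cells_sets cell_subset x_less continuous_on_subset[OF uc cell_subset] vi])
      blast
  then obtain c where c: "\<And>n t. t \<in> {x n<..<x (Suc n)} \<Longrightarrow> u t = c n + integral {x n..t} v"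
    by metis
  note vlim = primitive_limits[OF wi x_less b] and ulim = primitive_limits[OF vi x_less c]
  have trans: "c (Suc n) = c n + integral {x n..x (Suc n)} v"
    "b (Suc n) = b n + integral {x n..x (Suc n)} w + of_real (\<alpha> (Suc n)) * c (Suc n)" for n
  proof -
    obtain c' a' b' where l: "(u \<longlongrightarrow> c') (at_left (x (Suc n)))" "(u \<longlongrightarrow> c') (at_right (x (Suc n)))"
      "(v \<longlongrightarrow> a') (at_left (x (Suc n)))" "(v \<longlongrightarrow> b') (at_right (x (Suc n)))" "b' - a' = of_real (\<alpha> (Suc n)) * c'"
      using jump[of "Suc n"] by auto
    have "c' = c n + integral {x n..x (Suc n)} v" "a' = b n + integral {x n..x (Suc n)} w"
      "c' = c (Suc n)" "b' = b (Suc n)"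
      using tendsto_unique[OF _ l(1) ulim(2)] tendsto_unique[OF _ l(3) vlim(2)]
        tendsto_unique[OF _ l(2) ulim(1)] tendsto_unique[OF _ l(4) vlim(1)] by simp_all
    with l(5) show "c (Suc n) = c n + integral {x n..x (Suc n)} v"
      "b (Suc n) = b n + integral {x n..x (Suc n)} w + of_real (\<alpha> (Suc n)) * c (Suc n)"
      by (simp_all add: algebra_simps)
  qed
  have b0: "b 0 = 0"
    using tendsto_unique[OF _ vlim(1)[of 0] v0[folded x0]] by simp
  have injx: "inj x" using smono strict_mono_imp_inj_on by blast
  define v' where "v' t = (if t \<in> range x then b (inv x t) else v t)" for t
  define u' where "u' t = (if t \<in> range x then c (inv x t) else u t)" for t
  have node: "v' (x n) = b n" "u' (x n) = c n" for n
    using injx by (simp_all add: v'_def u'_def)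
  have off: "v' t = v t" "u' t = u t" if "t \<in> {x n<..<x (Suc n)}" for n t
    using cell_subset[of n] that by (auto simp: v'_def u'_def)
  have iv: "integral {x n..t} v = integral {x n..t} v'" if "t \<le> x (Suc n)" for n t
    by (rule integral_spike[of "{x n, x (Suc n)}"]) (use off[of _ n] that in auto)
  have "solves (\<lambda>t. - g t) u' v'"
    unfolding solves_def
  proof (intro conjI allI ballI)
    fix n t
    show "v' t = v' (x n) + integral {x n..t} (\<lambda>t. - g t)" if t: "t \<in> {x n..<x (Suc n)}"
    proof (cases "t = x n")
      case False
      then show ?thesis using b[of t n] off(1)[of t n] t unfolding node iw[symmetric] by simp
    qed simp
    show "u' t = u' (x n) + integral {x n..t} v'" if t: "t \<in> {x n..x (Suc n)}"
    proof -
      consider "t = x n" | "t = x (Suc n)" | "t \<in> {x n<..<x (Suc n)}" using t by force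
      then show ?thesis
      proof cases
        case 2
        then show ?thesis using trans(1)[of n] iv[of t n] by (simp add: node)
      next
        case 3
        then show ?thesis using c[of t n] iv[of t n] off(2)[of t n] by (simp add: node)
      qed simp
    qed
    show "v' (x (Suc n)) = v' (x n) + integral {x n..x (Suc n)} (\<lambda>t. - g t) + of_real (\<alpha> (Suc n)) * u' (x (Suc n))"
      using trans(2)[of n] unfolding node iw .
  qed
  moreover have "v' 0 = 0" using node(1)[of 0] b0 by (simp add: x0)
  moreover have "AE t in lebesgue_on {0<..}. f t = u' t"
  proof -
    have "AE t in lebesgue_on {0<..}. t \<notin> range x"
      by (rule negligible_AE_lebesgue_on[OF negligible_range_x]) auto
    with fu show ?thesis by eventually_elim (simp add: u'_def)
  qed
  moreover have "u' t = 0" if t: "max R 0 < t" for t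
  proof (cases "t \<in> range x")
    case True
    then obtain n where n: "t = x n" by blast
    have "\<forall>\<^sub>F s in at_right (x n). u s = 0"
    proof (rule eventually_at_rightI[of _ "x (Suc n)"])
      fix s assume s: "s \<in> {x n<..<x (Suc n)}"
      then show "u s = 0" using R[of s] cell_subset[of n] t n by auto
    qed (rule x_less)
    then have "(u \<longlongrightarrow> 0) (at_right (x n))" by (simp add: tendsto_eventually)
    then have "c n = 0" using tendsto_unique[OF _ ulim(1)] by simp
    then show ?thesis using n node(2) by simp
  next
    case False
    then show ?thesis using R[of t] t by (simp add: u'_def)
  qed
  ultimately show thesis by (rule that)
qed

text \<open>
  The nodes form a null set, so the integral over the cells splits into integrals over closed intervals.
\<close>

lemma LINT_cells:
  fixes h :: "real \<Rightarrow> complex"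
  assumes h: "locally_integrable h" and out: "\<And>t. x N < t \<Longrightarrow> t \<in> cells \<Longrightarrow> h t = 0"
  shows "(LINT t|lebesgue_on cells. h t) = (\<Sum>n<N. integral {x n..x (Suc n)} h)"
proof -
  have hi: "h absolutely_integrable_on {0..x N}" using h by (simp add: locally_integrable_def)
  have sub: "cells \<inter> {..x N} \<subseteq> {0..x N}" by auto
  have hi': "h absolutely_integrable_on (cells \<inter> {..x N})"
    by (rule set_integrable_subset[OF hi _ sub]) (use cells_sets in auto)
  have "(LINT t|lebesgue_on cells. h t) = (LINT t|lebesgue. indicator cells t *\<^sub>R h t)"
    using cells_sets by (simp add: integral_restrict_space)
  also have "\<dots> = (LINT t:cells \<inter> {..x N}|lebesgue. h t)"
    unfolding set_lebesgue_integral_def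
    by (intro Bochner_Integration.integral_cong) (use out in \<open>auto simp: indicator_def not_le\<close>)
  also have "\<dots> = integral (cells \<inter> {..x N}) h"
    by (rule set_lebesgue_integral_eq_integral(2)[OF hi'])
  also have "\<dots> = integral {0..x N} h"
    by (rule integral_spike_set)
      (auto intro!: negligible_subset[OF negligible_range_x] simp: x0[symmetric])
  also have "\<dots> = (\<Sum>n<N. integral {x n..x (Suc n)} h)"
    by (induction N) (simp_all add: x0 integral_combine_loc[OF h _ x_nonneg less_imp_le[OF x_less]])
  finally show ?thesis .
qed

text \<open>
  A test function supported off the nodes vanishes at them, so that integration by parts on each cell
  produces no boundary terms.
\<close>

lemma weak_deriv_cellwise:
  assumes q: "locally_integrable q"
    and pq: "\<And>n. \<exists>c. \<forall>t\<in>{x n<..<x (Suc n)}. p t = c + integral {x n..t} q"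
  shows "weak_deriv cells p q"
  unfolding weak_deriv_def
proof (intro allI impI, elim conjE exE)
  fix \<phi> \<phi>' :: "real \<Rightarrow> complex" and K
  assume d: "\<forall>t. (\<phi> has_vector_derivative \<phi>' t) (at t)" and c: "continuous_on UNIV \<phi>'"
    and K: "compact K" "K \<subseteq> cells" "\<forall>t. t \<notin> K \<longrightarrow> \<phi> t = 0"
  obtain B where B: "\<And>t. t \<in> K \<Longrightarrow> t \<le> B"
    using compact_imp_bounded[OF K(1)] by (meson bounded_imp_bdd_above bdd_above.unfold)
  obtain N where N: "B < x N" using unb by blast
  have \<phi>0: "\<phi> (x n) = 0" for n using K by auto
  have \<phi>out: "\<phi> t = 0" if "x N < t" for t using K(3) B[of t] N that by force
  have \<phi>'out: "\<phi>' t = 0" if "x N < t" for t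
  proof -
    have "\<forall>\<^sub>F s in nhds t. s \<in> {x N<..}" using that by (intro eventually_nhds_in_open) auto
    then have "\<forall>\<^sub>F s in nhds t. s \<in> UNIV \<longrightarrow> \<phi> s = 0" by eventually_elim (use \<phi>out in auto)
    then have "(\<phi> has_vector_derivative 0) (at t) \<longleftrightarrow> ((\<lambda>_. 0 :: complex) has_vector_derivative 0) (at t)"
      using \<phi>out[OF that] by (intro has_vector_derivative_cong_ev[where g = "\<lambda>_. 0"]) auto
    then have "(\<phi> has_vector_derivative 0) (at t)" by simp
    then show ?thesis using d vector_derivative_unique_at by blast
  qed
  have \<phi>c: "continuous_on A \<phi>" for A
    using d by (meson continuous_at_imp_continuous_on has_vector_derivative_continuous)
  have \<phi>'c: "continuous_on A \<phi>'" for A using c continuous_on_subset by blast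
  have \<phi>prim: "\<phi> t = \<phi> a + integral {a..t} \<phi>'" if "a \<le> t" for a t
  proof -
    have "(\<phi>' has_integral (\<phi> t - \<phi> a)) {a..t}"
      using d that by (intro fundamental_theorem_of_calculus) (auto intro: has_vector_derivative_at_within)
    then show ?thesis by (simp add: integral_unique)
  qed
  have cell: "(\<lambda>t. p t * \<phi>' t) absolutely_integrable_on {x n..x (Suc n)}"
      "integral {x n..x (Suc n)} (\<lambda>t. p t * \<phi>' t) = - integral {x n..x (Suc n)} (\<lambda>t. \<phi> t * q t)" for n
  proof -
    obtain c where c: "\<And>t. t \<in> {x n<..<x (Suc n)} \<Longrightarrow> p t = c + integral {x n..t} q"
      using pq by blast
    define P where "P t = c + integral {x n..t} q" for t
    have qi: "q absolutely_integrable_on {x n..x (Suc n)}" by (rule locally_integrable_cell[OF q x_nonneg])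
    have P: "continuous_on {x n..x (Suc n)} P"
      unfolding P_def by (intro continuous_intros primitive_continuous qi)
    have neg: "negligible {x n, x (Suc n)}" by simp
    have Pi: "(\<lambda>t. P t * \<phi>' t) absolutely_integrable_on {x n..x (Suc n)}"
      by (intro absolutely_integrable_continuous_real continuous_intros P \<phi>'c)
    show "(\<lambda>t. p t * \<phi>' t) absolutely_integrable_on {x n..x (Suc n)}"
      by (rule absolutely_integrable_spike[OF Pi neg]) (use c in \<open>auto simp: P_def\<close>)
    have qi': "(\<lambda>t. \<phi> t * q t) absolutely_integrable_on {x n..x (Suc n)}"
      by (intro abs_int_mult_continuous qi \<phi>c)
    have "integral {x n..x (Suc n)} (\<lambda>t. P t * \<phi>' t + \<phi> t * q t) = P (x (Suc n)) * \<phi> (x (Suc n)) - P (x n) * \<phi> (x n)"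
      by (rule primitive_product(2)[OF qi absolutely_integrable_continuous_real[OF \<phi>'c] _ \<phi>prim less_imp_le[OF x_less]])
        (auto simp: P_def)
    then have "integral {x n..x (Suc n)} (\<lambda>t. P t * \<phi>' t) + integral {x n..x (Suc n)} (\<lambda>t. \<phi> t * q t) = 0"
      using Pi qi' by (subst (asm) HK_add)
        (auto simp: absolutely_integrable_on_def \<phi>0)
    moreover have "integral {x n..x (Suc n)} (\<lambda>t. P t * \<phi>' t) = integral {x n..x (Suc n)} (\<lambda>t. p t * \<phi>' t)"
      by (rule integral_spike[OF neg]) (use c in \<open>auto simp: P_def\<close>)
    ultimately show "integral {x n..x (Suc n)} (\<lambda>t. p t * \<phi>' t) = - integral {x n..x (Suc n)} (\<lambda>t. \<phi> t * q t)"
      by (simp add: add_eq_0_iff2)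
  qed
  have "(LINT t|lebesgue_on cells. p t * \<phi>' t) = (\<Sum>n<N. integral {x n..x (Suc n)} (\<lambda>t. p t * \<phi>' t))"
    by (rule LINT_cells[OF locally_integrableI[OF cell(1)]]) (use \<phi>'out in auto)
  also have "\<dots> = - (\<Sum>n<N. integral {x n..x (Suc n)} (\<lambda>t. \<phi> t * q t))"
    by (simp add: cell(2) sum_negf)
  also have "(\<Sum>n<N. integral {x n..x (Suc n)} (\<lambda>t. \<phi> t * q t)) = (LINT t|lebesgue_on cells. \<phi> t * q t)"
  proof (rule LINT_cells[symmetric])
    show "locally_integrable (\<lambda>t. \<phi> t * q t)"
      using q unfolding locally_integrable_def by (intro allI abs_int_mult_continuous \<phi>c) auto
  qed (use \<phi>out in auto)
  finally show "(LINT t|lebesgue_on cells. p t * \<phi>' t) = - (LINT t|lebesgue_on cells. q t * \<phi> t)"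
    by (simp add: mult.commute)
qed

lemma solves_u_continuous_pos:
  assumes "locally_integrable w" "solves w u v"
  shows "continuous_on {0<..} u"
proof -
  have "isCont u t" if "0 < t" for t
    using solves_u_continuous[OF assms, of "t + 1"] that
    by (intro continuous_on_interior[of "{0..t + 1}"]) auto
  then show ?thesis by (simp add: continuous_at_imp_continuous_on)
qed

lemma solves_v_continuous_cells:
  assumes "locally_integrable w" "solves w u v"
  shows "continuous_on cells v"
proof -
  have "isCont v t" if t: "t \<in> cells" for t
  proof -
    obtain n where n: "t \<in> {x n<..<x (Suc n)}" using t by (rule cellsE)
    have "continuous_on {x n<..<x (Suc n)} (\<lambda>t. v (x n) + integral {x n..t} w)"
      by (intro continuous_intros continuous_on_subset[OF primitive_continuous[OF locally_integrable_cell[OF assms(1) x_nonneg], of n "x (Suc n)"]]) auto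
    then have "continuous_on {x n<..<x (Suc n)} v"
      by (rule continuous_on_eq) (use solvesD(1)[OF assms(2), of _ n, symmetric] in auto)
    then show ?thesis using n by (simp add: continuous_on_eq_continuous_at)
  qed
  then show ?thesis by (simp add: continuous_at_imp_continuous_on)
qed

lemma solves_v_bounded:
  assumes w: "locally_integrable w" and s: "solves w u v"
  obtains B where "\<And>t. t \<in> {0..<x n} \<Longrightarrow> cmod (v t) \<le> B"
proof -
  have "bounded (v ` {0..<x n})"
  proof (induction n)
    case (Suc n)
    have "bounded ((\<lambda>t. v (x n) + integral {x n..t} w) ` {x n..x (Suc n)})"
      by (intro compact_imp_bounded compact_continuous_image continuous_intros primitive_continuous
          locally_integrable_cell[OF w x_nonneg]) auto
    moreover have "v ` {x n..<x (Suc n)} = (\<lambda>t. v (x n) + integral {x n..t} w) ` {x n..<x (Suc n)}"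
      by (rule image_cong[OF refl]) (rule solvesD(1)[OF s])
    ultimately have "bounded (v ` {x n..<x (Suc n)})"
      by (metis atLeastLessThan_subseteq_atLeastAtMost_iff bounded_subset image_mono order_refl)
    moreover have "{0..<x (Suc n)} = {0..<x n} \<union> {x n..<x (Suc n)}"
      using x_nonneg[of n] x_less[of n] by auto
    ultimately show ?case using Suc by (simp add: image_Un)
  qed (simp add: x0)
  then obtain B where "\<forall>y\<in>v ` {0..<x n}. cmod y \<le> B" unfolding bounded_iff by blast
  then show thesis by (intro that[of B]) auto
qed

lemma solves_v_zero_beyond:
  assumes w: "locally_integrable w" and s: "solves w u v" and R: "\<And>t. R < t \<Longrightarrow> u t = 0"
    and t: "max R 0 < t"
  shows "v t = 0"
  proof -
  note vloc = solves_v_locally_integrable[OF w s]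
  obtain n where n: "x n \<le> t" "t < x (Suc n)" using ex_cell[of t] t by auto
  define b where "b = (t + x (Suc n)) / 2"
  have b: "t < b" "b < x (Suc n)" using n by (auto simp: b_def)
  have "continuous_on {t..b} (\<lambda>t. v (x n) + integral {x n..t} w)"
    by (intro continuous_intros continuous_on_subset[OF primitive_continuous[OF locally_integrable_cell[OF w x_nonneg], of n "x (Suc n)"]])
      (use n b in auto)
  then have vc: "continuous_on {t..b} v"
    by (rule continuous_on_eq) (use solvesD(1)[OF s, of _ n, symmetric] n b in auto)
  have "((\<lambda>r. integral {t..r} v) has_vector_derivative v t) (at t within {t..b})"
    using b by (intro integral_has_vector_derivative vc) auto
  moreover have z: "integral {t..r} v = 0" if "r \<in> {t..b}" for r
  proof -
    have "u r = u t + integral {t..r} v"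
      using integral_combine_loc[OF vloc x_nonneg n(1), of r] solvesD(2)[OF s, of t n] solvesD(2)[OF s, of r n]
        that n b by simp
    then show ?thesis using R[of t] R[of r] that t by simp
qed
  ultimately have "((\<lambda>r. 0) has_vector_derivative v t) (at t within {t..b})"
    using b by (subst (asm) has_vector_derivative_cong_ev[where g = "\<lambda>_. 0"]) auto
  moreover have "((\<lambda>r. 0 :: complex) has_vector_derivative 0) (at t within {t..b})" by simp
  ultimately show ?thesis
    using vector_derivative_unique_within_closed_interval[of t b t "\<lambda>r. 0 :: complex"] b by auto
qed

text \<open>
  Together with \<open>H0_imp_solves\<close> this describes the minimal operator by initial value problems instead of
  weak derivatives.
\<close>

lemma solves_imp_H0:
  assumes fL: "f \<in> L2 {0<..}" and gL: "g \<in> L2 {0<..}" and s: "solves (\<lambda>t. - g t) u v" and v0: "v 0 = 0"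
    and fu: "AE t in lebesgue_on {0<..}. f t = u t" and R: "\<And>t. R < t \<Longrightarrow> u t = 0"
  shows "(f, g) \<in> H0_graph x \<alpha>"
proof -
  have gloc: "locally_integrable (\<lambda>t. - g t)"
    by (intro locally_integrable_uminus L2_locally_integrable gL)
  note vloc = solves_v_locally_integrable[OF gloc s]
  note vzero = solves_v_zero_beyond[OF gloc s R]
  have uc: "continuous_on {0<..} u" by (rule solves_u_continuous_pos[OF gloc s])
  have vc: "continuous_on cells v" by (rule solves_v_continuous_cells[OF gloc s])
  have subs: "cells \<subseteq> {0<..}" by auto
  have uL: "u \<in> L2 {0<..}"
    by (rule L2_cong_AE[OF fL _ fu]) (use uc in \<open>auto intro: continuous_imp_measurable_on_sets_lebesgue\<close>)
  have L2cells: "p \<in> L2 {0<..} \<Longrightarrow> p \<in> L2 cells" for p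
    by (rule L2_subset[OF _ subs _ cells_sets]) auto
  have vL: "v \<in> L2 cells"
  proof -
    obtain n where n: "max R 0 < x n" using unb by blast
    obtain B where B: "\<And>t. t \<in> {0..<x n} \<Longrightarrow> cmod (v t) \<le> B"
      using solves_v_bounded[OF gloc s, of n] by blast
    show ?thesis
    proof (rule L2_bounded_support[OF continuous_imp_measurable_on_sets_lebesgue[OF vc cells_sets] cells_sets subs])
      fix t assume "t \<in> cells" "t \<le> x n"
      then show "cmod (v t) \<le> B"
        using B[of t] by (cases "t = x n") auto
    next
      fix t assume "x n < t"
      then show "v t = 0" using n by (intro vzero) auto
    qed
  qed
  have vcell: "v t = v (x n) + integral {x n..t} (\<lambda>t. - g t)" if "t \<in> {x n<..<x (Suc n)}" for n t
    using solvesD(1)[OF s, of t n] that by auto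
  have ucell: "u t = u (x n) + integral {x n..t} v" if "t \<in> {x n<..<x (Suc n)}" for n t
    using solvesD(2)[OF s, of t n] that by auto
  note vlim = primitive_limits[OF locally_integrable_cell[OF gloc x_nonneg] x_less vcell]
    and ulim = primitive_limits[OF locally_integrable_cell[OF vloc x_nonneg] x_less ucell]
  have "W22 cells u v (\<lambda>t. - g t)"
    unfolding W22_def
  proof (intro conjI)
    show "weak_deriv cells u v" using ucell by (intro weak_deriv_cellwise[OF vloc]) blast
    show "weak_deriv cells v (\<lambda>t. - g t)" using vcell by (intro weak_deriv_cellwise[OF gloc]) blast
    show "continuous_on cells u" using uc subs by (rule continuous_on_subset)
  qed (use uL gL vL vc in \<open>auto intro: L2cells L2_uminus\<close>)
  moreover have "(v \<longlongrightarrow> 0) (at_right 0)" using vlim(1)[of 0] v0 by (simp add: x0)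
  moreover have "\<exists>c a b. (u \<longlongrightarrow> c) (at_left (x n)) \<and> (u \<longlongrightarrow> c) (at_right (x n)) \<and>
           (v \<longlongrightarrow> a) (at_left (x n)) \<and> (v \<longlongrightarrow> b) (at_right (x n)) \<and> b - a = of_real (\<alpha> n) * c"
    if n1: "n \<ge> 1" for n
  proof -
    obtain m where m: "n = Suc m" using n1 by (cases n) auto
    have "u (x n) = u (x m) + integral {x m..x n} v"
      using solvesD(2)[OF s, of "x n" m] x_less[of m] m by simp
    then have "(u \<longlongrightarrow> u (x n)) (at_left (x n))" using ulim(2)[of m] m by simp
    then show ?thesis
      using ulim(1)[of n] vlim(2)[of m] vlim(1)[of n] solvesD(3)[OF s, of m] unfolding m
      by (intro exI conjI) (assumption | simp)+
  qed
  moreover have "\<exists>R. \<forall>t\<in>cells. R < t \<longrightarrow> u t = 0" using R by blast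
  moreover have "AE t in lebesgue_on {0<..}. g t = - (- g t)" by simp
  ultimately show ?thesis
    unfolding H0_graph_def using fL gL fu by blast
qed

end

section \<open>The adjoint of the minimal operator\<close>

lemma negligible_Icc_Ioc:
  "negligible {t \<in> {0..R} - {0<..R}. P t}" "negligible {t \<in> {0<..R} - {0..R}. P t}" for R :: real
  by (rule negligible_subset[of "{0}"]; force)+

lemma l2_inner_cong_AE:
  assumes "f \<in> L2 S" "f' \<in> L2 S" "g \<in> L2 S" "g' \<in> L2 S"
    and "AE t in lebesgue_on S. f t = f' t" "AE t in lebesgue_on S. g t = g' t"
  shows "l2_inner S f g = l2_inner S f' g'"
  unfolding l2_inner_def
proof (rule integral_cong_AE)
  show "AE t in lebesgue_on S. f t * cnj (g t) = f' t * cnj (g' t)"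
    using assms(5,6) by eventually_elim simp
qed (use assms in \<open>auto intro: borel_measurable_integrable L2_inner_integrable\<close>)

lemma LINT_truncate:
  fixes h :: "real \<Rightarrow> complex"
  assumes h: "integrable (lebesgue_on {0<..}) h" and out: "\<And>t. R < t \<Longrightarrow> h t = 0" and R: "0 \<le> R"
  shows "(LINT t|lebesgue_on {0<..}. h t) = integral {0..R} h"
proof -
  have "(LINT t|lebesgue_on {0<..}. h t) = integral {0<..} h"
    by (rule lebesgue_integral_eq_integral[OF h]) auto
  also have "\<dots> = integral {0<..R} h"
    by (rule integral_subset_zero) (use out in auto)
  also have "\<dots> = integral {0..R} h"
    by (rule integral_spike_set[OF negligible_Icc_Ioc(2,1)])
  finally show ?thesis .
qed

lemma continuous_AE_zero:
  fixes f :: "real \<Rightarrow> complex"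
  assumes f: "continuous_on {0<..} f" and z: "AE t in lebesgue_on {0<..}. f t = 0" and t: "0 < t"
  shows "f t = 0"
proof (rule ccontr)
  assume ne: "f t \<noteq> 0"
  obtain N where N: "negligible N" "\<And>t. t \<in> {0<..} \<Longrightarrow> t \<notin> N \<Longrightarrow> f t = 0"
    using AE_lebesgue_on_negligible[OF z] by auto
  have "open ({0<..} \<inter> f -` (- {0}))"
    by (rule continuous_open_preimage[OF f]) auto
  moreover have "t \<in> {0<..} \<inter> f -` (- {0})" using t ne by simp
  moreover have "{0<..} \<inter> f -` (- {0}) \<subseteq> N" using N(2) by blast
  ultimately show False
    using open_not_negligible negligible_subset[OF N(1)] by blast
qed

context point_interactions
begin

lemma H0_L2: "(f, g) \<in> H0_graph x \<alpha> \<Longrightarrow> f \<in> L2 {0<..} \<and> g \<in> L2 {0<..}"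
  by (simp add: H0_graph_def)

lemma L2_neg_locally_integrable: "g \<in> L2 {0<..} \<Longrightarrow> locally_integrable (\<lambda>t. - g t)"
  by (intro locally_integrable_uminus L2_locally_integrable)

lemma solves_u_L2:
  assumes "f \<in> L2 {0<..}" "locally_integrable w" "solves w u v" "AE t in lebesgue_on {0<..}. f t = u t"
  shows "u \<in> L2 {0<..}"
  by (rule L2_cong_AE[OF assms(1) _ assms(4)])
    (rule continuous_imp_measurable_on_sets_lebesgue[OF solves_u_continuous_pos[OF assms(2,3)]], simp)

lemma H0_add:
  assumes 1: "(f, g) \<in> H0_graph x \<alpha>" and 2: "(f', g') \<in> H0_graph x \<alpha>"
  shows "(\<lambda>t. f t + f' t, \<lambda>t. g t + g' t) \<in> H0_graph x \<alpha>"
proof -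
  obtain u v R where u: "solves (\<lambda>t. - g t) u v" "v 0 = 0" "AE t in lebesgue_on {0<..}. f t = u t"
    "\<And>t. R < t \<Longrightarrow> u t = 0" using H0_imp_solves[OF 1] by blast
  obtain u' v' R' where u': "solves (\<lambda>t. - g' t) u' v'" "v' 0 = 0" "AE t in lebesgue_on {0<..}. f' t = u' t"
    "\<And>t. R' < t \<Longrightarrow> u' t = 0" using H0_imp_solves[OF 2] by blast
  note L = H0_L2[OF 1] H0_L2[OF 2]
  have "solves (\<lambda>t. - (g t + g' t)) (\<lambda>t. u t + u' t) (\<lambda>t. v t + v' t)"
    using solves_add[OF _ _ u(1) u'(1)] L by (simp add: L2_neg_locally_integrable)
  moreover have "AE t in lebesgue_on {0<..}. f t + f' t = u t + u' t"
    using u(3) u'(3) by eventually_elim simp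
  ultimately show ?thesis
    using L u(2,4) u'(2,4) by (intro solves_imp_H0[where u = "\<lambda>t. u t + u' t" and v = "\<lambda>t. v t + v' t" and R = "max R R'"]) (auto intro: L2_add)
qed

lemma H0_scale:
  assumes 1: "(f, g) \<in> H0_graph x \<alpha>"
  shows "(\<lambda>t. c * f t, \<lambda>t. c * g t) \<in> H0_graph x \<alpha>"
proof -
  obtain u v R where u: "solves (\<lambda>t. - g t) u v" "v 0 = 0" "AE t in lebesgue_on {0<..}. f t = u t"
    "\<And>t. R < t \<Longrightarrow> u t = 0" using H0_imp_solves[OF 1] by blast
  have "solves (\<lambda>t. - (c * g t)) (\<lambda>t. c * u t) (\<lambda>t. c * v t)"
    using solves_scale[OF u(1), of c] by simp
  moreover have "AE t in lebesgue_on {0<..}. c * f t = c * u t"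
    using u(3) by eventually_elim simp
  ultimately show ?thesis
    using H0_L2[OF 1] u(2,4) by (intro solves_imp_H0[where u = "\<lambda>t. c * u t" and v = "\<lambda>t. c * v t" and R = R]) (auto intro: L2_scale)
qed

lemma H0_zero: "(\<lambda>_. 0, \<lambda>_. 0) \<in> H0_graph x \<alpha>"
proof (rule solves_imp_H0)
  show "solves (\<lambda>t. - 0) (\<lambda>_. 0) (\<lambda>_. 0)" by (simp add: solves_def)
qed auto

lemma Green_identity:
  assumes gk: "locally_integrable (\<lambda>t. - g t)" "locally_integrable (\<lambda>t. - k t)"
    and s1: "solves (\<lambda>t. - g t) u1 v1" "v1 0 = 0" and s2: "solves (\<lambda>t. - k t) u2 v2" "v2 0 = 0"
    and R: "0 \<le> R" "u1 R = 0" "v1 R = 0"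
  shows "integral {0..R} (\<lambda>t. g t * cnj (u2 t)) = integral {0..R} (\<lambda>t. u1 t * cnj (k t))"
proof -
  note s3 = solves_cnj[OF s2(1)]
  have k': "locally_integrable (\<lambda>t. cnj (- k t))" by (rule locally_integrable_cnj[OF gk(2)])
  have "integral {0..R} (\<lambda>t. u1 t * cnj (- k t) - cnj (u2 t) * - g t) = 0"
    using Lagrange_identity(2)[OF gk(1) k' s1(1) s3 R(1)] s1(2) s2(2) R by simp
  also have "(\<lambda>t. u1 t * cnj (- k t) - cnj (u2 t) * - g t) = (\<lambda>t. g t * cnj (u2 t) - u1 t * cnj (k t))"
    by (auto simp: mult.commute)
  finally have 0: "integral {0..R} (\<lambda>t. g t * cnj (u2 t) - u1 t * cnj (k t)) = 0" .
  have "(\<lambda>t. cnj (u2 t) * - g t) absolutely_integrable_on {0..R}"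
    by (intro abs_int_mult_continuous continuous_on_cnj solves_u_continuous[OF gk(2) s2(1)] locally_integrable_cell[OF gk(1)]) auto
  moreover have "(\<lambda>t. u1 t * cnj (- k t)) absolutely_integrable_on {0..R}"
    by (intro abs_int_mult_continuous solves_u_continuous[OF gk(1) s1(1)] locally_integrable_cell[OF k']) auto
  ultimately have "(\<lambda>t. g t * cnj (u2 t)) integrable_on {0..R}" "(\<lambda>t. u1 t * cnj (k t)) integrable_on {0..R}"
    by (auto simp: absolutely_integrable_on_def mult.commute dest: integrable_neg)
  with 0 show ?thesis by (simp add: HK_diff)
qed

text \<open>
  The boundary term of the Lagrange identity vanishes at zero by the Neumann condition and far out by
  the compact support.
\<close>

lemma H0_symmetric: "H0_graph x \<alpha> \<subseteq> graph_adjoint {0<..} (H0_graph x \<alpha>)"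
proof -
  have "l2_inner {0<..} g h = l2_inner {0<..} f k"
    if 1: "(f, g) \<in> H0_graph x \<alpha>" and 2: "(h, k) \<in> H0_graph x \<alpha>" for f g h k
  proof -
    obtain u v R where u: "solves (\<lambda>t. - g t) u v" "v 0 = 0" "AE t in lebesgue_on {0<..}. f t = u t"
      "\<And>t. R < t \<Longrightarrow> u t = 0" using H0_imp_solves[OF 1] by blast
    obtain u' v' R' where u': "solves (\<lambda>t. - k t) u' v'" "v' 0 = 0" "AE t in lebesgue_on {0<..}. h t = u' t"
      "\<And>t. R' < t \<Longrightarrow> u' t = 0" using H0_imp_solves[OF 2] by blast
    have L: "f \<in> L2 {0<..}" "g \<in> L2 {0<..}" "h \<in> L2 {0<..}" "k \<in> L2 {0<..}"
      using H0_L2[OF 1] H0_L2[OF 2] by auto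
    note loc = L(2)[THEN L2_neg_locally_integrable] L(4)[THEN L2_neg_locally_integrable]
    define B where "B = max R (max R' 0) + 1"
    have B: "0 \<le> B" "R < B" "max R 0 < B" "R' < B" by (auto simp: B_def)
    have uL: "u \<in> L2 {0<..}" by (rule solves_u_L2[OF L(1) loc(1) u(1,3)])
    have u'L: "u' \<in> L2 {0<..}" by (rule solves_u_L2[OF L(3) loc(2) u'(1,3)])
    have "l2_inner {0<..} g h = l2_inner {0<..} g u'"
      using L u'L u' by (intro l2_inner_cong_AE) auto
    also have "\<dots> = integral {0..B} (\<lambda>t. g t * cnj (u' t))"
      unfolding l2_inner_def using L u'L u'(4) B by (intro LINT_truncate L2_inner_integrable) auto
    also have "\<dots> = integral {0..B} (\<lambda>t. u t * cnj (k t))"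
      using B u(4) by (intro Green_identity[OF loc u(1,2) u'(1,2)] solves_v_zero_beyond[OF loc(1) u(1,4)]) auto
    also have "\<dots> = l2_inner {0<..} u k"
      unfolding l2_inner_def using L uL u(4) B by (intro LINT_truncate[symmetric] L2_inner_integrable) auto
    also have "\<dots> = l2_inner {0<..} f k"
      using L uL u by (intro l2_inner_cong_AE) auto
    finally show ?thesis .
  qed
  then show ?thesis
    using H0_L2 by (fastforce simp: graph_adjoint_def)
qed

text \<open>
  Regularity of the adjoint.  Let \<open>K\<close> be the solution with right-hand side \<open>- k\<close> and zero initial data; the
  Lagrange identity expresses the pairing with \<open>k\<close> through \<open>K\<close>, so that \<open>h - K\<close> annihilates every compactly
  supported \<open>w\<close> orthogonal to the zero-energy solution \<open>\<phi>\<close> with Neumann data.  Hence \<open>h - K\<close> is a multiple of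
  the conjugate of \<open>\<phi>\<close>, which is a zero-energy solution too.
\<close>

lemma adjoint_imp_solves:
  assumes hk: "(h, k) \<in> graph_adjoint {0<..} (H0_graph x \<alpha>)"
  obtains u v where "solves (\<lambda>t. - k t) u v" "v 0 = 0" "AE t in lebesgue_on {0<..}. h t = u t"
proof -
  let ?P = "{0<..} :: real set"
  have hL: "h \<in> L2 ?P" and kL: "k \<in> L2 ?P" using hk by (auto simp: graph_adjoint_def)
  have adj: "l2_inner ?P g h = l2_inner ?P f k" if "(f, g) \<in> H0_graph x \<alpha>" for f g
    using hk that by (auto simp: graph_adjoint_def)
  note kloc = L2_neg_locally_integrable[OF kL]
  note zloc = locally_integrable_zero
  obtain K K' where K: "solves (\<lambda>t. - k t) K K'" "K 0 = 0" "K' 0 = 0"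
    using solves_exists[OF kloc] by blast
  obtain \<phi> \<phi>' where \<phi>: "solves (\<lambda>_. 0) \<phi> \<phi>'" "\<phi> 0 = 1" "\<phi>' 0 = 0"
    using solves_exists[OF zloc] by blast
  obtain \<theta> \<theta>' where \<theta>: "solves (\<lambda>_. 0) \<theta> \<theta>'" "\<theta> 0 = 0" "\<theta>' 0 = 1"
    using solves_exists[OF zloc] by blast
  have wron: "\<phi> t * \<theta>' t - \<phi>' t * \<theta> t = 1" if "0 \<le> t" for t
    using Lagrange_identity(2)[OF zloc zloc \<phi>(1) \<theta>(1) that] \<phi> \<theta> by simp
  note contK = solves_u_continuous[OF kloc K(1)] and cont\<phi> = solves_u_continuous[OF zloc \<phi>(1)]
  have \<phi>1: "\<phi> t = 1" if t: "t \<in> {0<..<x 1}" for t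
  proof -
    have v: "\<phi>' s = 0" if "s \<in> {x 0..<x (Suc 0)}" for s
      using solvesD(1)[OF \<phi>(1) that] \<phi>(3) by (simp add: x0)
    have "integral {x 0..t} \<phi>' = integral {x 0..t} (\<lambda>_. 0)"
      using t by (intro integral_cong v) auto
    then show ?thesis
      using solvesD(2)[OF \<phi>(1), of t 0] t \<phi>(2) by (simp add: x0)
  qed
  \<comment> \<open>A second derivative \<open>w\<close> on \<open>[0, R]\<close> belongs to an element of the minimal operator as soon as
    \<open>\<integral> \<phi> w = 0\<close>.  The adjoint relation makes \<open>h - K\<close> orthogonal to all these \<open>w\<close>; testing with the
    component of \<open>h - K\<close> orthogonal to \<open>cnj \<phi>\<close> shows that this component vanishes.\<close>
  have loc: "\<exists>c. AE t in lebesgue_on ?P. t < R \<longrightarrow> h t = K t + c * cnj (\<phi> t)" if R: "0 < R" for R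
  proof -
    have "continuous_on {0..R} (\<lambda>t. (cmod (\<phi> t))\<^sup>2)" by (intro continuous_intros cont\<phi>)
    note i\<phi> = integral_eq_0_iff[OF this R]
    define a where "a = integral {0..R} (\<lambda>t. (cmod (\<phi> t))\<^sup>2)"
    have a0: "a \<noteq> 0"
      using i\<phi> R \<phi>(2) by (auto simp: a_def intro!: bexI[of _ 0])
    define c where "c = integral {0..R} (\<lambda>t. \<phi> t * (h t - K t)) / of_real a"
    define q where "q t = (if t \<le> R then K t + c * cnj (\<phi> t) else 0)" for t
    define w where "w t = (if t \<le> R then h t else 0) - q t" for t
    have mK: "K \<in> borel_measurable (lebesgue_on ?P)" and m\<phi>: "\<phi> \<in> borel_measurable (lebesgue_on ?P)"
      using solves_u_continuous_pos[OF kloc K(1)] solves_u_continuous_pos[OF zloc \<phi>(1)]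
      by (auto intro: continuous_imp_measurable_on_sets_lebesgue)
    have Rset: "{t \<in> space (lebesgue_on ?P). t \<le> R} \<in> sets (lebesgue_on ?P)"
      by (auto simp: sets_restrict_space space_restrict_space)
    have qm: "q \<in> borel_measurable (lebesgue_on ?P)"
      unfolding q_def by (intro measurable_If Rset borel_measurable_add borel_measurable_times
          borel_measurable_cnj mK m\<phi> borel_measurable_const)
    have "bounded ((\<lambda>t. K t + c * cnj (\<phi> t)) ` {0..R})"
      by (intro compact_imp_bounded compact_continuous_image continuous_intros contK cont\<phi>) auto
    then obtain B where "\<forall>y\<in>(\<lambda>t. K t + c * cnj (\<phi> t)) ` {0..R}. cmod y \<le> B"
      unfolding bounded_iff by blast
    then have qL: "q \<in> L2 ?P"
      by (intro L2_bounded_support[OF qm, of R B]) (auto simp: q_def)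
    have h1L: "(\<lambda>t. if t \<le> R then h t else 0) \<in> L2 ?P"
    proof (rule L2_bound[OF _ hL L2_zero, where C = 1])
      show "(\<lambda>t. if t \<le> R then h t else 0) \<in> borel_measurable (lebesgue_on ?P)"
        by (intro measurable_If Rset L2_measurable hL borel_measurable_const)
    qed auto
    have wL: "w \<in> L2 ?P"
      unfolding w_def by (rule L2_diff[OF h1L qL])
    have wout: "w t = 0" if "R < t" for t using that by (simp add: w_def q_def)
    have win: "w t = (h t - K t) - c * cnj (\<phi> t)" if "t \<le> R" for t
      using that by (simp add: w_def q_def)
    note wloc = L2_locally_integrable[OF wL]
    have zi: "(\<lambda>t. h t - K t) absolutely_integrable_on {0..R}"
      by (intro set_integral_diff L2_absolutely_integrable hL absolutely_integrable_continuous_real contK)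
    have orth: "integral {0..R} (\<lambda>t. \<phi> t * w t) = 0"
    proof -
      have i1: "(\<lambda>t. \<phi> t * (h t - K t)) integrable_on {0..R}"
        using abs_int_mult_continuous[OF zi cont\<phi>] by (simp add: absolutely_integrable_on_def)
      have i2: "(\<lambda>t. c * of_real ((cmod (\<phi> t))\<^sup>2)) integrable_on {0..R}"
        by (intro integrable_continuous_real continuous_intros cont\<phi>)
      have "integral {0..R} (\<lambda>t. \<phi> t * w t)
          = integral {0..R} (\<lambda>t. \<phi> t * (h t - K t) - c * of_real ((cmod (\<phi> t))\<^sup>2))"
        by (intro integral_cong) (simp only: atLeastAtMost_iff win complex_norm_square, simp add: algebra_simps)
      also have "\<dots> = integral {0..R} (\<lambda>t. \<phi> t * (h t - K t)) - integral {0..R} (\<lambda>t. c * of_real ((cmod (\<phi> t))\<^sup>2))"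
        by (rule HK_diff[OF i1 i2])
      also have "integral {0..R} (\<lambda>t. c * of_real ((cmod (\<phi> t))\<^sup>2)) = c * of_real a"
      proof -
        have "(\<lambda>t. (cmod (\<phi> t))\<^sup>2) integrable_on {0..R}"
          by (intro integrable_continuous_real continuous_intros cont\<phi>)
        from integral_linear[OF this bounded_linear_of_real[where 'a = complex]]
        show ?thesis by (simp add: a_def o_def del: of_real_power)
      qed
      also have "c * of_real a = integral {0..R} (\<lambda>t. \<phi> t * (h t - K t))"
        using a0 by (simp add: c_def)
      finally show ?thesis by simp
    qed
    have tail: "integral {0..t} (\<lambda>s. p s * w s) = integral {0..R} (\<lambda>s. p s * w s)" if "R \<le> t" for p t
      using that wout R by (intro integral_subset_zero) auto
    obtain u v where u: "solves w u v" "u 0 = integral {0..R} (\<lambda>t. \<theta> t * w t)" "v 0 = 0"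
      using solves_exists[OF wloc] by blast
    \<comment> \<open>The initial value of \<open>u\<close> is chosen so that beyond \<open>R\<close> both Wronskians of \<open>u\<close> with the basis
      \<open>\<phi>, \<theta>\<close> vanish, whence \<open>u = 0\<close> there.\<close>
    have uv0: "u t = 0 \<and> v t = 0" if t: "R \<le> t" for t
    proof -
      have t0: "0 \<le> t" using t R by simp
      have 1: "\<phi> t * v t - \<phi>' t * u t = 0"
        using Lagrange_identity(2)[OF zloc wloc \<phi>(1) u(1) t0] \<phi> u(3) tail[OF t, of \<phi>] orth by simp
      have 2: "\<theta> t * v t - \<theta>' t * u t = 0"
        using Lagrange_identity(2)[OF zloc wloc \<theta>(1) u(1) t0] \<theta> u tail[OF t, of \<theta>] by simp
      have "u t = u t * (\<phi> t * \<theta>' t - \<phi>' t * \<theta> t)" using wron[OF t0] by simp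
      also have "\<dots> = \<theta> t * (\<phi> t * v t - \<phi>' t * u t) - \<phi> t * (\<theta> t * v t - \<theta>' t * u t)"
        by (simp add: algebra_simps)
      finally have U: "u t = 0" using 1 2 by simp
      have "v t = v t * (\<phi> t * \<theta>' t - \<phi>' t * \<theta> t)" using wron[OF t0] by simp
      also have "\<dots> = \<theta>' t * (\<phi> t * v t - \<phi>' t * u t) - \<phi>' t * (\<theta> t * v t - \<theta>' t * u t)"
        by (simp add: algebra_simps)
      finally have V: "v t = 0" using 1 2 by simp
      from U V show ?thesis by simp
    qed
    have uL: "u \<in> L2 ?P"
    proof -
      have "bounded (u ` {0..R})"
        by (intro compact_imp_bounded compact_continuous_image solves_u_continuous[OF wloc u(1)]) auto
      then obtain B where "\<forall>y\<in>u ` {0..R}. cmod y \<le> B" unfolding bounded_iff by blast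
      moreover have "u \<in> borel_measurable (lebesgue_on ?P)"
        using solves_u_continuous_pos[OF wloc u(1)] by (rule continuous_imp_measurable_on_sets_lebesgue) auto
      ultimately show ?thesis
        using uv0 by (intro L2_bounded_support[of _ _ R B]) auto
    qed
    have mem: "(u, \<lambda>t. - w t) \<in> H0_graph x \<alpha>"
      by (rule solves_imp_H0[of _ _ u v R]) (use uL wL u uv0 in \<open>auto intro: L2_uminus\<close>)
    have "l2_inner ?P (\<lambda>t. - w t) h = l2_inner ?P u k" by (rule adj[OF mem])
    also have "\<dots> = integral {0..R} (\<lambda>t. u t * cnj (k t))"
      unfolding l2_inner_def using uL kL uv0 R by (intro LINT_truncate L2_inner_integrable) auto
    also have "\<dots> = integral {0..R} (\<lambda>t. - w t * cnj (K t))"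
      using Green_identity[of "\<lambda>t. - w t" k u v K K' R] wloc kloc u K uv0[of R] R by simp
    also have "l2_inner ?P (\<lambda>t. - w t) h = integral {0..R} (\<lambda>t. - w t * cnj (h t))"
      unfolding l2_inner_def using wL hL wout R by (intro LINT_truncate L2_inner_integrable L2_uminus) auto
    finally have eq: "integral {0..R} (\<lambda>t. - w t * cnj (h t)) = integral {0..R} (\<lambda>t. - w t * cnj (K t))" .
    have iwK: "(\<lambda>t. w t * cnj (K t)) integrable_on {0..R}"
      using abs_int_mult_continuous[OF locally_integrable_cell[OF wloc order_refl] continuous_on_cnj[OF contK]]
      by (simp add: absolutely_integrable_on_def mult.commute)
    have iw\<phi>: "(\<lambda>t. \<phi> t * w t) integrable_on {0..R}"
      using abs_int_mult_continuous[OF locally_integrable_cell[OF wloc order_refl] cont\<phi>]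
      by (simp add: absolutely_integrable_on_def)
    have wh: "integrable (lebesgue_on ?P) (\<lambda>t. w t * cnj (h t))"
      by (rule L2_inner_integrable[OF wL hL])
    have iwh: "(\<lambda>t. w t * cnj (h t)) integrable_on {0..R}"
    proof -
      have "(\<lambda>t. w t * cnj (h t)) absolutely_integrable_on ?P"
        using wh by (simp add: set_integrable_def integrable_restrict_space)
      then have "(\<lambda>t. w t * cnj (h t)) absolutely_integrable_on {0<..<R}"
        by (rule set_integrable_subset) auto
      then show ?thesis
        using absolutely_integrable_on_Icc_iff_Ioo absolutely_integrable_on_def by blast
    qed
    have "l2_inner ?P w w = integral {0..R} (\<lambda>t. w t * cnj (w t))"
      unfolding l2_inner_def using wL wout R by (intro LINT_truncate L2_inner_integrable) auto
    also have "\<dots> = integral {0..R} (\<lambda>t. (w t * cnj (h t) - w t * cnj (K t)) - cnj c * (\<phi> t * w t))"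
    proof (rule integral_cong)
      fix t assume "t \<in> {0..R}"
      then have "cnj (w t) = cnj (h t) - cnj (K t) - cnj c * \<phi> t" by (simp add: win)
      then have "w t * cnj (w t) = w t * (cnj (h t) - cnj (K t) - cnj c * \<phi> t)" by (simp only:)
      then show "w t * cnj (w t) = (w t * cnj (h t) - w t * cnj (K t)) - cnj c * (\<phi> t * w t)"
        by (simp only: right_diff_distrib mult_ac)
    qed
    also have "\<dots> = (integral {0..R} (\<lambda>t. w t * cnj (h t)) - integral {0..R} (\<lambda>t. w t * cnj (K t)))
        - cnj c * integral {0..R} (\<lambda>t. \<phi> t * w t)"
      using iwK iw\<phi> iwh
      by (simp add: HK_diff integrable_diff integrable_on_mult_right)
    also have "\<dots> = 0" using eq orth by simp
    finally have "l2_norm ?P w = 0" by (simp add: l2_inner_self)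
    then have "AE t in lebesgue_on ?P. w t = 0" by (rule l2_norm_eq_0[OF wL])
    then have "AE t in lebesgue_on ?P. t < R \<longrightarrow> h t = K t + c * cnj (\<phi> t)"
    proof eventually_elim
      case (elim t)
      show ?case
      proof
        assume "t < R"
        then have "h t - K t = c * cnj (\<phi> t)" using win[of t] elim by simp
        then show "h t = K t + c * cnj (\<phi> t)" by (simp add: diff_eq_eq add.commute)
      qed
    qed
    then show ?thesis by blast
  qed
  have x1: "0 < x 1" using x_less[of 0] x0 by simp
  obtain c where c: "AE t in lebesgue_on ?P. t < x 1 \<longrightarrow> h t = K t + c * cnj (\<phi> t)"
    using loc[OF x1] by blast
  have all: "AE t in lebesgue_on ?P. t < x (Suc n) \<longrightarrow> h t = K t + c * cnj (\<phi> t)" for n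
  proof -
    have "0 < x (Suc n)" using x_less[of n] x_nonneg[of n] by simp
    from loc[OF this] obtain c' where c': "AE t in lebesgue_on ?P. t < x (Suc n) \<longrightarrow> h t = K t + c' * cnj (\<phi> t)"
      by blast
    have "c = c'"
    proof (rule ccontr)
      assume ne: "c \<noteq> c'"
      have x1n: "x 1 \<le> x (Suc n)" using smono by (simp add: strict_mono_less_eq)
      have "AE t in lebesgue_on ?P. t \<notin> {0<..<x 1}"
        using c c'
      proof eventually_elim
        case (elim t)
        show ?case
        proof
          assume t: "t \<in> {0<..<x 1}"
          then have "h t = K t + c * cnj (\<phi> t)" "h t = K t + c' * cnj (\<phi> t)" using elim x1n by auto
          then show False using \<phi>1[OF t] ne by simp
        qed
      qed
      then obtain N where N: "negligible N" "\<And>t. t \<in> ?P \<Longrightarrow> t \<notin> N \<Longrightarrow> t \<notin> {0<..<x 1}"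
        by (rule AE_lebesgue_on_negligible) auto
      have "{0<..<x 1} \<subseteq> N"
      proof
        fix t assume "t \<in> {0<..<x 1}"
        then show "t \<in> N" using N(2)[of t] by fastforce
      qed
      then have "negligible {0<..<x 1}" by (rule negligible_subset[OF N(1)])
      then show False using open_not_negligible[of "{0<..<x 1}"] x1 by auto
    qed
    with c' show ?thesis by simp
  qed
  have hK: "AE t in lebesgue_on ?P. h t = K t + c * cnj (\<phi> t)"
  proof -
    have "AE t in lebesgue_on ?P. \<forall>n. t < x (Suc n) \<longrightarrow> h t = K t + c * cnj (\<phi> t)"
      using all unfolding AE_all_countable by blast
    then have "AE t in lebesgue_on ?P. t \<in> ?P \<longrightarrow> h t = K t + c * cnj (\<phi> t)"
    proof eventually_elim
      case (elim t)
      then show ?case using ex_cell[of t] by (metis greaterThan_iff less_imp_le)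
    qed
    then show ?thesis by (simp add: AE_restrict_space_iff)
  qed
  have "solves (\<lambda>t. c * cnj 0) (\<lambda>t. c * cnj (\<phi> t)) (\<lambda>t. c * cnj (\<phi>' t))"
    using solves_scale[OF solves_cnj[OF \<phi>(1)]] .
  from solves_add[OF kloc _ K(1) this]
  have "solves (\<lambda>t. - k t) (\<lambda>t. K t + c * cnj (\<phi> t)) (\<lambda>t. K' t + c * cnj (\<phi>' t))"
    by (simp add: zloc)
  then show thesis
    by (rule that) (use hK K \<phi> in auto)
qed

end

section \<open>Self-adjointness in the limit-point case\<close>

context point_interactions
begin

text \<open>
  One half of Weyl's alternative, without passing to nonreal spectral parameters.  If the boundary term
  \<open>W\<close> of two elements \<open>u1\<close>, \<open>u2\<close> of the adjoint domain does not vanish at infinity, then dividing the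
  Pluecker relation by \<open>W\<close> bounds any zero-energy solution \<open>y\<close> by \<open>|u1| + |u2|\<close> times its Wronskians with
  \<open>u1\<close> and \<open>u2\<close>.  These vary only through \<open>\<integral> |y| (|k1| + |k2|)\<close>, which Gronwall's argument keeps bounded.
  So \<open>y\<close> is dominated by \<open>|u1| + |u2|\<close> and square integrable.
\<close>

lemma homogeneous_L2_if_boundary_term:
  assumes k1: "k1 \<in> L2 {0<..}" and k2: "k2 \<in> L2 {0<..}"
    and s1: "solves (\<lambda>t. - k1 t) u1 v1" "v1 0 = 0" "u1 \<in> L2 {0<..}"
    and s2: "solves (\<lambda>t. - k2 t) u2 v2" "v2 0 = 0" "u2 \<in> L2 {0<..}"
    and ne: "l2_inner {0<..} k1 u2 \<noteq> l2_inner {0<..} u1 k2"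
    and y: "solves (\<lambda>_. 0) y y'"
  shows "y \<in> L2 {0<..}"
proof -
  let ?P = "{0<..} :: real set"
  define l where "l = l2_inner ?P k1 u2 - l2_inner ?P u1 k2"
  define U where "U t = cnj (u2 t)" for t
  define V where "V t = cnj (v2 t)" for t
  define W where "W t = u1 t * V t - v1 t * U t" for t
  note loc = k1[THEN L2_neg_locally_integrable] k2[THEN L2_neg_locally_integrable]
  note zloc = locally_integrable_zero
  have s3: "solves (\<lambda>t. cnj (- k2 t)) U V"
    using solves_cnj[OF s2(1)] by (simp add: U_def[abs_def] V_def[abs_def])
  have loc3: "locally_integrable (\<lambda>t. cnj (- k2 t))" by (rule locally_integrable_cnj[OF loc(2)])
  \<comment> \<open>By the Lagrange identity the boundary term \<open>W\<close> tends to the asymmetry \<open>l \<noteq> 0\<close>.\<close>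
  have Wint: "W t = integral {0..t} (\<lambda>s. k1 s * cnj (u2 s) - u1 s * cnj (k2 s))" if "0 \<le> t" for t
  proof -
    have "W t = integral {0..t} (\<lambda>s. u1 s * cnj (- k2 s) - U s * - k1 s)"
      using Lagrange_identity(2)[OF loc(1) loc3 s1(1) s3 that] s1(2) s2(2) by (simp add: W_def V_def)
    also have "(\<lambda>s. u1 s * cnj (- k2 s) - U s * - k1 s) = (\<lambda>s. k1 s * cnj (u2 s) - u1 s * cnj (k2 s))"
      by (auto simp: U_def mult.commute)
    finally show ?thesis .
  qed
  have Wlim: "(W \<longlongrightarrow> l) at_top"
  proof -
    let ?h = "\<lambda>s. k1 s * cnj (u2 s) - u1 s * cnj (k2 s)"
    have hi: "integrable (lebesgue_on ?P) ?h"
      by (intro Bochner_Integration.integrable_diff L2_inner_integrable k1 k2 s1 s2)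
    have hs: "set_integrable lebesgue ?P ?h"
      using hi by (simp add: set_integrable_def integrable_restrict_space)
    have neg: "negligible {t \<in> {0..} - ?P. ?h t \<noteq> 0}" "negligible {t \<in> ?P - {0..}. ?h t \<noteq> 0}"
      by (rule negligible_subset[of "{0}"]; force)+
    have hs0: "set_integrable lebesgue {0..} ?h"
      using hs absolutely_integrable_spike_set_eq[OF neg] by blast
    have "((\<lambda>b. LINT t:{0..b}|lebesgue. ?h t) \<longlongrightarrow> (LINT t:{0..}|lebesgue. ?h t)) at_top"
      by (rule tendsto_set_lebesgue_integral_at_top[OF _ hs0]) auto
    also have "(LINT t:{0..}|lebesgue. ?h t) = integral {0..} ?h"
      by (rule set_lebesgue_integral_eq_integral(2)[OF hs0])
    also have "\<dots> = integral ?P ?h" by (rule integral_spike_set[OF neg])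
    also have "\<dots> = (LINT t|lebesgue_on ?P. ?h t)"
      by (rule lebesgue_integral_eq_integral[OF hi, symmetric]) auto
    also have "\<dots> = l"
      unfolding l_def l2_inner_def
      by (intro Bochner_Integration.integral_diff L2_inner_integrable k1 k2 s1 s2)
    finally have "((\<lambda>b. LINT t:{0..b}|lebesgue. ?h t) \<longlongrightarrow> l) at_top" .
    moreover have "\<forall>\<^sub>F b in at_top. (LINT t:{0..b}|lebesgue. ?h t) = W b"
      using eventually_ge_at_top[of 0]
    proof eventually_elim
      case (elim b)
      have "set_integrable lebesgue {0..b} ?h" by (rule set_integrable_subset[OF hs0]) auto
      then show ?case using Wint[OF elim] set_lebesgue_integral_eq_integral(2) by metis
    qed
    ultimately show ?thesis by (rule Lim_transform_eventually)
  qed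
  define \<delta> where "\<delta> = cmod l / 2"
  have \<delta>: "\<delta> > 0" using ne by (simp add: \<delta>_def l_def)
  have "((\<lambda>t. cmod (W t)) \<longlongrightarrow> cmod l) at_top" by (rule tendsto_norm[OF Wlim])
  then have "\<forall>\<^sub>F t in at_top. \<delta> < cmod (W t)"
    by (rule order_tendstoD) (use \<delta> in \<open>simp add: \<delta>_def\<close>)
  then obtain T where T: "\<And>t. t \<ge> T \<Longrightarrow> \<delta> < cmod (W t)"
    by (auto simp: eventually_at_top_linorder)
  define p where "p t = cmod (u1 t) + cmod (u2 t)" for t
  define \<kappa> where "\<kappa> t = cmod (k1 t) + cmod (k2 t)" for t
  have p0: "p t \<ge> 0" and \<kappa>0: "\<kappa> t \<ge> 0" for t by (simp_all add: p_def \<kappa>_def)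
  note contu = solves_u_continuous[OF loc(1) s1(1)] solves_u_continuous[OF loc(2) s2(1)]
  note conty = solves_u_continuous[OF zloc y]
  have \<kappa>i: "(\<lambda>t. f t * \<kappa> t) integrable_on {a..b}" if "continuous_on {a..b} f" "0 \<le> a" for f :: "real \<Rightarrow> real" and a b
  proof -
    have ai: "k1 absolutely_integrable_on {a..b}" "k2 absolutely_integrable_on {a..b}"
      using L2_locally_integrable[OF k1] L2_locally_integrable[OF k2] that(2) by (auto intro: locally_integrable_cell)
    then have "\<kappa> absolutely_integrable_on {a..b}"
      unfolding \<kappa>_def by (intro set_integral_add set_integrable_norm)
    then have "(\<lambda>t. f t * \<kappa> t) absolutely_integrable_on {a..b}"
      using that(1) by (intro absolutely_integrable_bounded_measurable_product_real
          continuous_imp_measurable_on_sets_lebesgue compact_imp_bounded compact_continuous_image) auto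
    then show ?thesis by (simp add: absolutely_integrable_on_def)
  qed
  define Y where "Y t = integral {0..t} (\<lambda>s. cmod (y s) * \<kappa> s)" for t
  have yi: "(\<lambda>s. cmod (y s) * \<kappa> s) integrable_on {a..b}" if "0 \<le> a" for a b
    by (rule \<kappa>i) (use that in \<open>auto intro!: continuous_on_norm continuous_on_subset[OF conty[of b]]\<close>)
  have Ymono: "Y s \<le> Y t" if "0 \<le> s" "s \<le> t" for s t
    unfolding Y_def using that \<kappa>0 by (intro integral_subset_le yi) auto
  define M where "M = cmod (y 0 * V 0 - y' 0 * U 0) + cmod (y 0 * v1 0 - y' 0 * u1 0)"
  have M0: "M \<ge> 0" by (simp add: M_def)
  have pert: "cmod (y t * b t - y' t * a t) \<le> M + Y t"
    if sol: "solves f a b" and floc: "locally_integrable f" and fk: "\<And>s. cmod (f s) \<le> \<kappa> s"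
      and ini: "cmod (y 0 * b 0 - y' 0 * a 0) \<le> M" and t: "0 \<le> t" for f a b t
  proof -
    have "cmod (integral {0..t} (\<lambda>s. y s * f s - a s * 0)) \<le> Y t"
      unfolding Y_def
    proof (rule integral_norm_bound_integral)
      show "(\<lambda>s. y s * f s - a s * 0) integrable_on {0..t}"
        using abs_int_mult_continuous[OF locally_integrable_cell[OF floc order_refl] conty]
        by (simp add: absolutely_integrable_on_def)
      show "(\<lambda>s. cmod (y s) * \<kappa> s) integrable_on {0..t}" by (rule yi) simp
      show "cmod (y s * f s - a s * 0) \<le> cmod (y s) * \<kappa> s" for s
        using fk[of s] by (simp add: norm_mult mult_left_mono)
    qed
    then have "cmod ((y 0 * b 0 - y' 0 * a 0) + integral {0..t} (\<lambda>s. y s * f s - a s * 0)) \<le> M + Y t"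
      using ini norm_triangle_mono by blast
    then show ?thesis
      using Lagrange_identity(2)[OF zloc floc y sol t] by simp
  qed
  have key: "\<delta> * cmod (y t) \<le> p t * (M + Y t)" if t: "t \<ge> max T 0" for t
  proof -
    have 1: "cmod (y t * V t - y' t * U t) \<le> M + Y t"
      by (rule pert[OF s3 loc3]) (use t in \<open>auto simp: \<kappa>_def M_def\<close>)
    have 2: "cmod (y t * v1 t - y' t * u1 t) \<le> M + Y t"
      by (rule pert[OF s1(1) loc(1)]) (use t in \<open>auto simp: \<kappa>_def M_def\<close>)
    have "\<delta> * cmod (y t) \<le> cmod (W t) * cmod (y t)"
      using T[of t] t by (intro mult_right_mono) auto
    \<comment> \<open>the Pluecker relation between the Wronskians of \<open>y\<close>, \<open>u1\<close> and \<open>U\<close>\<close>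
    also have "\<dots> = cmod (u1 t * (y t * V t - y' t * U t) - U t * (y t * v1 t - y' t * u1 t))"
      by (simp add: W_def algebra_simps flip: norm_mult)
    also have "\<dots> \<le> cmod (u1 t * (y t * V t - y' t * U t)) + cmod (U t * (y t * v1 t - y' t * u1 t))"
      by (rule norm_triangle_ineq4)
    also have "\<dots> \<le> cmod (u1 t) * (M + Y t) + cmod (u2 t) * (M + Y t)"
      unfolding norm_mult using 1 2 by (intro add_mono mult_mono) (auto simp: U_def)
    also have "\<dots> = p t * (M + Y t)" by (simp add: p_def algebra_simps)
    finally show ?thesis .
  qed
  have Y0: "Y t \<ge> 0" if "0 \<le> t" for t using Ymono[OF order_refl that] by (simp add: Y_def)
  \<comment> \<open>Gronwall: \<open>p \<kappa>\<close> is integrable as a product of square integrable functions, so beyond a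
    suitable \<open>T'\<close> the estimate of \<open>y\<close> can be absorbed and \<open>Y\<close> stays bounded.\<close>
  have p\<kappa>: "integrable (lebesgue_on ?P) (\<lambda>t. p t * \<kappa> t)"
  proof -
    have "(\<lambda>t. p t * \<kappa> t) = (\<lambda>t. (cmod (u1 t) * cmod (k1 t) + cmod (u1 t) * cmod (k2 t))
        + (cmod (u2 t) * cmod (k1 t) + cmod (u2 t) * cmod (k2 t)))"
      by (auto simp: p_def \<kappa>_def algebra_simps)
    then show ?thesis
      using k1 k2 s1(3) s2(3) by (simp add: L2_prod_integrable)
  qed
  obtain T' where T': "T' \<ge> max T 0" "\<And>t. t \<ge> T' \<Longrightarrow> integral {T'..t} (\<lambda>s. p s * \<kappa> s) \<le> \<delta> / 2"
  proof -
    have ps: "set_integrable lebesgue ?P (\<lambda>t. p t * \<kappa> t)"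
      using p\<kappa> by (simp add: set_integrable_def integrable_restrict_space)
    define T1 where "T1 = max T 0 + 1"
    have ps1: "set_integrable lebesgue {T1..} (\<lambda>t. p t * \<kappa> t)"
      by (rule set_integrable_subset[OF ps]) (auto simp: T1_def)
    let ?L = "LINT t:{T1..}|lebesgue. p t * \<kappa> t"
    have "((\<lambda>b. LINT t:{T1..b}|lebesgue. p t * \<kappa> t) \<longlongrightarrow> ?L) at_top"
      by (rule tendsto_set_lebesgue_integral_at_top[OF _ ps1]) auto
    then have "\<forall>\<^sub>F b in at_top. \<bar>(LINT t:{T1..b}|lebesgue. p t * \<kappa> t) - ?L\<bar> < \<delta> / 4"
      using \<delta> by (auto simp: tendsto_iff dist_real_def dest!: spec[of _ "\<delta> / 4"])
    then obtain T2 where T2: "\<And>b. b \<ge> T2 \<Longrightarrow> \<bar>(LINT t:{T1..b}|lebesgue. p t * \<kappa> t) - ?L\<bar> < \<delta> / 4"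
      by (auto simp: eventually_at_top_linorder)
    have I: "(LINT t:{T1..b}|lebesgue. p t * \<kappa> t) = integral {T1..b} (\<lambda>s. p s * \<kappa> s)"
        "(\<lambda>s. p s * \<kappa> s) integrable_on {T1..b}" for b
      using set_lebesgue_integral_eq_integral[OF set_integrable_subset[OF ps1, of "{T1..b}"]] by auto
    show thesis
    proof (rule that[of "max T1 T2"])
      fix t assume t: "max T1 T2 \<le> t"
      have comb: "integral {T1..t} (\<lambda>s. p s * \<kappa> s) = integral {T1..max T1 T2} (\<lambda>s. p s * \<kappa> s) + integral {max T1 T2..t} (\<lambda>s. p s * \<kappa> s)"
        using t by (intro HK_combine[symmetric] I) auto
      show "integral {max T1 T2..t} (\<lambda>s. p s * \<kappa> s) \<le> \<delta> / 2"
      proof -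
        have "T2 \<le> t" "T2 \<le> max T1 T2" using t by auto
        from T2[OF this(1), unfolded I] T2[OF this(2), unfolded I] comb
        show ?thesis by linarith
      qed
    qed (simp add: T1_def max_def)
  qed
  have absorb: "a \<le> 2 * b + c" if "a \<le> b + (c + a) / 2" for a b c :: real
    using that by (simp add: field_simps)
  define M1 where "M1 = 2 * Y T' + M"
  have Yb: "Y t \<le> M1" if t: "t \<ge> T'" for t
  proof -
    have t0: "0 \<le> T'" using T'(1) by simp
    have pi: "(\<lambda>s. p s * \<kappa> s) integrable_on {T'..t}"
      by (rule \<kappa>i) (use t0 in \<open>auto simp: p_def intro!: continuous_intros continuous_on_subset[OF contu(1)[of t]] continuous_on_subset[OF contu(2)[of t]]\<close>)
    have "Y t = Y T' + integral {T'..t} (\<lambda>s. cmod (y s) * \<kappa> s)"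
      unfolding Y_def using t t0 yi by (intro HK_combine[symmetric]) auto
    also have "integral {T'..t} (\<lambda>s. cmod (y s) * \<kappa> s) \<le> integral {T'..t} (\<lambda>s. (M + Y t) / \<delta> * (p s * \<kappa> s))"
    proof (rule integral_le)
      show "(\<lambda>s. cmod (y s) * \<kappa> s) integrable_on {T'..t}" by (rule yi[OF t0])
      show "(\<lambda>s. (M + Y t) / \<delta> * (p s * \<kappa> s)) integrable_on {T'..t}" using pi by (rule integrable_on_mult_right)
      fix s assume s: "s \<in> {T'..t}"
      have "\<delta> * cmod (y s) \<le> p s * (M + Y s)" using s T'(1) by (intro key) auto
      also have "\<dots> \<le> p s * (M + Y t)" using s t0 p0 by (intro mult_left_mono add_left_mono Ymono) auto
      finally have "cmod (y s) \<le> (M + Y t) / \<delta> * p s"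
        using \<delta> by (simp add: field_simps)
      then show "cmod (y s) * \<kappa> s \<le> (M + Y t) / \<delta> * (p s * \<kappa> s)"
        using mult_right_mono[OF _ \<kappa>0[of s]] by (simp only: mult.assoc[symmetric])
    qed
    also have "\<dots> = (M + Y t) / \<delta> * integral {T'..t} (\<lambda>s. p s * \<kappa> s)" by simp
    also have "\<dots> \<le> (M + Y t) / \<delta> * (\<delta> / 2)"
      using T'(2)[OF t] \<delta> M0 Y0[of t] t t0 by (intro mult_left_mono) auto
    also have "\<dots> = (M + Y t) / 2" using \<delta> by simp
    finally have "Y t \<le> Y T' + (M + Y t) / 2" by simp
    then show ?thesis unfolding M1_def by (rule absorb)
  qed
  \<comment> \<open>Near zero \<open>y\<close> is bounded, beyond \<open>T'\<close> it is dominated by \<open>p\<close>.\<close>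
  have ym: "y \<in> borel_measurable (lebesgue_on ?P)"
    using solves_u_continuous_pos[OF zloc y] by (rule continuous_imp_measurable_on_sets_lebesgue) auto
  have Rset: "{t \<in> space (lebesgue_on ?P). t \<le> T'} \<in> sets (lebesgue_on ?P)"
    by (auto simp: sets_restrict_space space_restrict_space)
  have "bounded (y ` {0..T'})"
    by (intro compact_imp_bounded compact_continuous_image conty) auto
  then obtain B where B: "\<forall>z\<in>y ` {0..T'}. cmod z \<le> B" unfolding bounded_iff by blast
  have y1: "(\<lambda>t. if t \<le> T' then y t else 0) \<in> L2 ?P"
    using B by (intro L2_bounded_support[of _ _ T' B] measurable_If Rset ym borel_measurable_const) auto
  define C where "C = (M + M1) / \<delta>"
  have y2: "(\<lambda>t. if t \<le> T' then 0 else y t) \<in> L2 ?P"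
  proof (rule L2_bound[OF _ s1(3) s2(3), where C = "C\<^sup>2 * 2"])
    show "(\<lambda>t. if t \<le> T' then 0 else y t) \<in> borel_measurable (lebesgue_on ?P)"
      by (intro measurable_If Rset ym borel_measurable_const)
    have "(cmod (if t \<le> T' then 0 else y t))\<^sup>2 \<le> C\<^sup>2 * 2 * ((cmod (u1 t))\<^sup>2 + (cmod (u2 t))\<^sup>2)" for t
    proof (cases "t \<le> T'")
      case False
      then have "\<delta> * cmod (y t) \<le> p t * (M + Y t)" using T'(1) by (intro key) auto
      also have "\<dots> \<le> p t * (M + M1)" using False p0 Yb[of t] by (intro mult_left_mono) auto
      finally have "cmod (y t) \<le> C * p t" using \<delta> by (simp add: C_def field_simps)
      then have "(cmod (y t))\<^sup>2 \<le> (C * p t)\<^sup>2" by (intro power_mono) auto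
      also have "\<dots> \<le> C\<^sup>2 * (2 * ((cmod (u1 t))\<^sup>2 + (cmod (u2 t))\<^sup>2))"
        unfolding power_mult_distrib p_def using norm_add_sq_le[of "cmod (u1 t)" "cmod (u2 t)"]
        by (intro mult_left_mono) auto
      finally show ?thesis using False by (simp add: mult.assoc)
    qed simp
    then show "AE t in lebesgue_on ?P. (cmod (if t \<le> T' then 0 else y t))\<^sup>2 \<le> C\<^sup>2 * 2 * ((cmod (u1 t))\<^sup>2 + (cmod (u2 t))\<^sup>2)"
      by (intro AE_I2)
  qed
  have "(\<lambda>t. (if t \<le> T' then y t else 0) + (if t \<le> T' then 0 else y t)) = y" by auto
  then show ?thesis using L2_add[OF y1 y2] by simp
qed

lemma adjoint_single_valued:
  assumes k: "(\<lambda>_. 0, k) \<in> graph_adjoint {0<..} (H0_graph x \<alpha>)"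
  shows "AE t in lebesgue_on {0<..}. k t = 0"
proof -
  have kL: "k \<in> L2 {0<..}" using k by (simp add: graph_adjoint_def)
  note kloc = L2_neg_locally_integrable[OF kL]
  obtain u v where s: "solves (\<lambda>t. - k t) u v" "v 0 = 0" and u0: "AE t in lebesgue_on {0<..}. 0 = u t"
    using adjoint_imp_solves[OF k] by blast
  have upos: "u t = 0" if "0 < t" for t
    by (rule continuous_AE_zero[OF solves_u_continuous_pos[OF kloc s(1)] _ that]) (use u0 in auto)
  have v: "v t = v 0 + integral {0..t} (\<lambda>t. - k t)" if "0 \<le> t" for t
  proof (rule primitive_glue[OF kloc _ that])
    fix n t assume t: "t \<in> {x n..x (Suc n)}"
    have "u (x (Suc n)) = 0" using x_less[of n] x_nonneg[of n] by (intro upos) auto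
    then show "v t = v (x n) + integral {x n..t} (\<lambda>t. - k t)"
      using solvesD(1)[OF s(1), of t n] solvesD(3)[OF s(1), of n] t by (cases "t = x (Suc n)") auto
  qed
  note vloc = solves_v_locally_integrable[OF kloc s(1)]
  have vint: "integral {0..t} v = 0" if "0 \<le> t" for t
  proof -
    have "continuous_on {0..1} u" by (rule solves_u_continuous[OF kloc s(1)])
    then have "(u \<longlongrightarrow> u 0) (at_right 0)" by (rule continuous_on_Icc_at_rightD) simp
    moreover have "\<forall>\<^sub>F t in at_right 0. u t = 0"
      using upos by (intro eventually_at_rightI[of 0 1]) auto
    then have "(u \<longlongrightarrow> 0) (at_right 0)" by (rule tendsto_eventually)
    ultimately have "u 0 = 0" using tendsto_unique[OF trivial_limit_at_right_real] by blast
    then show ?thesis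
      using solves_u_primitive[OF kloc s(1) that] upos[of t] that by (cases "t = 0") auto
  qed
  have AEall: "AE t in lebesgue_on {0<..}. w t = 0"
    if w: "locally_integrable w" and z: "\<And>t. 0 \<le> t \<Longrightarrow> integral {0..t} w = 0" for w
  proof -
    have "AE t in lebesgue. t \<in> {0..real n} \<longrightarrow> w t = 0" for n
    proof -
      have "AE t in lebesgue_on {0..real n}. w t = 0"
        by (rule zero_integrals_imp_AE_zero[OF locally_integrable_cell[OF w order_refl]]) (use z in auto)
      then show ?thesis by (simp add: AE_restrict_space_iff)
    qed
    then have "AE t in lebesgue. \<forall>n. t \<in> {0..real n} \<longrightarrow> w t = 0"
      unfolding AE_all_countable by blast
    then have "AE t in lebesgue. t \<in> {0<..} \<longrightarrow> w t = 0"
    proof eventually_elim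
      case (elim t)
      then show ?case using real_arch_simple[of t] by force
    qed
    then show ?thesis by (simp add: AE_restrict_space_iff)
  qed
  have vc: "continuous_on {0<..} v"
  proof -
    have "isCont v t" if t: "0 < t" for t
    proof -
      have "continuous_on {0..t + 1} (\<lambda>t. v 0 + integral {0..t} (\<lambda>t. - k t))"
        by (intro continuous_intros primitive_continuous locally_integrable_cell[OF kloc]) auto
      then have "continuous_on {0..t + 1} v"
        by (rule continuous_on_eq) (rule v[symmetric], simp)
      then show ?thesis using t by (intro continuous_on_interior[of "{0..t + 1}"]) auto
    qed
    then show ?thesis by (simp add: continuous_at_imp_continuous_on)
  qed
  have vz: "v t = 0" if "0 < t" for t
    by (rule continuous_AE_zero[OF vc AEall[OF vloc vint] that]) auto
  have "integral {0..t} (\<lambda>t. - k t) = 0" if "0 \<le> t" for t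
    using v[OF that] vz[of t] s(2) that by (cases "t = 0") auto
  from AEall[OF kloc this] show ?thesis by simp
qed

text \<open>
  By \<open>homogeneous_L2_if_boundary_term\<close> a zero-energy solution outside \<open>L\<^sup>2\<close> makes the adjoint of the minimal
  operator symmetric.  A pair in the adjoint that is orthogonal to the graph of the minimal operator
  is then zero, so the adjoint equals the closure.  The same projection applied to the domain alone
  gives density.
\<close>

lemma limit_point_imp_self_adjoint:
  assumes lp: "solves (\<lambda>_. 0) y y'" "y \<notin> L2 {0<..}"
  shows "self_adjoint {0<..} (H_graph x \<alpha>)"
proof -
  let ?P = "{0<..} :: real set"
  define T where "T = H0_graph x \<alpha>"
  define A where "A = graph_adjoint ?P T"
  define H where "H = graph_closure ?P T"
  have TL: "T \<subseteq> L2 ?P \<times> L2 ?P" using H0_L2 by (auto simp: T_def)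
  have AL: "A \<subseteq> L2 ?P \<times> L2 ?P" by (auto simp: A_def graph_adjoint_def)
  have TA: "T \<subseteq> A" using H0_symmetric by (simp add: T_def A_def)
  have HA: "H \<subseteq> A"
  proof
    fix p assume "p \<in> H"
    then obtain f g F G where p: "p = (f, g)" and fg: "f \<in> L2 ?P" "g \<in> L2 ?P"
      and FG: "\<And>k::nat. (F k, G k) \<in> T" "(\<lambda>k. l2_norm ?P (\<lambda>x. F k x - f x)) \<longlonglongrightarrow> 0"
        "(\<lambda>k. l2_norm ?P (\<lambda>x. G k x - g x)) \<longlonglongrightarrow> 0"
      unfolding H_def graph_closure_def by blast
    have L: "F k \<in> L2 ?P" "G k \<in> L2 ?P" for k using FG(1)[of k] TL by auto
    have "l2_inner ?P b f = l2_inner ?P a g" if ab: "(a, b) \<in> T" for a b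
    proof -
      have abL: "a \<in> L2 ?P" "b \<in> L2 ?P" using ab TL by auto
      have "l2_inner ?P b (F k) = l2_inner ?P a (G k)" for k
        using FG(1)[of k] TA ab unfolding A_def graph_adjoint_def by blast
      then have "(\<lambda>k. l2_inner ?P a (G k)) \<longlonglongrightarrow> l2_inner ?P b f"
        using l2_inner_tendsto_right[OF L(1) fg(1) abL(2) FG(2)] by simp
      with l2_inner_tendsto_right[OF L(2) fg(2) abL(1) FG(3)] show ?thesis
        using LIMSEQ_unique by blast
    qed
    then show "p \<in> A" using p fg by (auto simp: A_def graph_adjoint_def)
  qed
  have Asym: "l2_inner ?P k1 h2 = l2_inner ?P h1 k2" if 1: "(h1, k1) \<in> A" and 2: "(h2, k2) \<in> A" for h1 k1 h2 k2
  proof (rule ccontr)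
    assume ne: "l2_inner ?P k1 h2 \<noteq> l2_inner ?P h1 k2"
    have L: "h1 \<in> L2 ?P" "k1 \<in> L2 ?P" "h2 \<in> L2 ?P" "k2 \<in> L2 ?P" using 1 2 AL by auto
    obtain u1 v1 where s1: "solves (\<lambda>t. - k1 t) u1 v1" "v1 0 = 0" "AE t in lebesgue_on ?P. h1 t = u1 t"
      using adjoint_imp_solves 1 unfolding A_def T_def by blast
    obtain u2 v2 where s2: "solves (\<lambda>t. - k2 t) u2 v2" "v2 0 = 0" "AE t in lebesgue_on ?P. h2 t = u2 t"
      using adjoint_imp_solves 2 unfolding A_def T_def by blast
    have uL: "u1 \<in> L2 ?P" "u2 \<in> L2 ?P"
      using solves_u_L2[OF L(1) L2_neg_locally_integrable[OF L(2)] s1(1,3)]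
        solves_u_L2[OF L(3) L2_neg_locally_integrable[OF L(4)] s2(1,3)] by auto
    have "l2_inner ?P k1 h2 = l2_inner ?P k1 u2" "l2_inner ?P h1 k2 = l2_inner ?P u1 k2"
      using L uL s1(3) s2(3) by (auto intro!: l2_inner_cong_AE)
    then have "y \<in> L2 ?P"
      using homogeneous_L2_if_boundary_term[OF L(2,4) s1(1,2) uL(1) s2(1,2) uL(2) _ lp(1)] ne by simp
    with lp(2) show False by contradiction
  qed
  have closure_cong: "(f', g') \<in> H"
    if fg: "(f, g) \<in> H" and L: "f' \<in> L2 ?P" "g' \<in> L2 ?P"
      and ae: "AE t in lebesgue_on ?P. f t = f' t" "AE t in lebesgue_on ?P. g t = g' t" for f g f' g'
  proof -
    obtain F G where FG: "f \<in> L2 ?P" "g \<in> L2 ?P" "\<And>k::nat. (F k, G k) \<in> T"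
        "(\<lambda>k. l2_norm ?P (\<lambda>x. F k x - f x)) \<longlonglongrightarrow> 0" "(\<lambda>k. l2_norm ?P (\<lambda>x. G k x - g x)) \<longlonglongrightarrow> 0"
      using fg unfolding H_def graph_closure_def by blast
    have FL: "F k \<in> L2 ?P" "G k \<in> L2 ?P" for k using FG(3)[of k] TL by auto
    have "l2_norm ?P (\<lambda>x. F k x - f x) = l2_norm ?P (\<lambda>x. F k x - f' x)"
      "l2_norm ?P (\<lambda>x. G k x - g x) = l2_norm ?P (\<lambda>x. G k x - g' x)" for k
      using ae by (auto intro!: l2_norm_cong_AE L2_measurable L2_diff FL FG L elim: eventually_mono)
    then show ?thesis
      using FG L unfolding H_def graph_closure_def by auto
  qed
  have T0: "T \<noteq> {}" using H0_zero by (auto simp: T_def)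
  have AH: "A \<subseteq> H"
  proof
    fix p assume "p \<in> A"
    then obtain h k where p: "p = (h, k)" and hk: "(h, k) \<in> A" by (cases p) auto
    have L: "h \<in> L2 ?P" "k \<in> L2 ?P" using hk AL by auto
    obtain F G where FG: "(F, G) \<in> H"
      and orth: "\<And>f g. (f, g) \<in> T \<Longrightarrow> l2_inner ?P f (\<lambda>x. h x - F x) + l2_inner ?P g (\<lambda>x. k x - G x) = 0"
      unfolding H_def
      by (rule l2_projection[OF TL T0 _ _ L]) (auto simp: T_def intro: H0_add H0_scale)
    have FGA: "(F, G) \<in> A" using FG HA by blast
    then have FL: "F \<in> L2 ?P" "G \<in> L2 ?P" using AL by auto
    define a where "a t = h t - F t" for t
    define b where "b t = k t - G t" for t
    have aL: "a \<in> L2 ?P" and bL: "b \<in> L2 ?P"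
      unfolding a_def b_def using L FL by (auto intro: L2_diff)
    have ab: "(a, b) \<in> A"
    proof -
      have "l2_inner ?P g a = l2_inner ?P f b" if fg: "(f, g) \<in> T" for f g
      proof -
        have fgL: "f \<in> L2 ?P" "g \<in> L2 ?P" using fg TL by auto
        have "l2_inner ?P g h = l2_inner ?P f k" "l2_inner ?P g F = l2_inner ?P f G"
          using hk FGA fg unfolding A_def graph_adjoint_def by blast+
        then show ?thesis
          unfolding a_def b_def by (simp add: l2_inner_diff_right L FL fgL)
      qed
      then show ?thesis using aL bL by (auto simp: A_def graph_adjoint_def)
    qed
    \<comment> \<open>Orthogonality to the graph of the minimal operator says that the rotated pair lies in the adjoint.\<close>
    have ba: "(b, \<lambda>t. - a t) \<in> A"
    proof -
      have "l2_inner ?P g b = l2_inner ?P f (\<lambda>t. - a t)" if "(f, g) \<in> T" for f g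
        using orth[OF that] unfolding l2_inner_uminus_right a_def[symmetric] b_def[symmetric]
        by (simp add: add_eq_0_iff2)
      then show ?thesis using aL bL by (auto simp: A_def graph_adjoint_def intro: L2_uminus)
    qed
    have "l2_inner ?P b b = l2_inner ?P a (\<lambda>t. - a t)" by (rule Asym[OF ab ba])
    then have "complex_of_real ((l2_norm ?P b)\<^sup>2) = complex_of_real (- (l2_norm ?P a)\<^sup>2)"
      unfolding l2_inner_uminus_right l2_inner_self by simp
    then have "(l2_norm ?P b)\<^sup>2 = - (l2_norm ?P a)\<^sup>2" by (simp only: of_real_eq_iff)
    then have "(l2_norm ?P b)\<^sup>2 = 0" "(l2_norm ?P a)\<^sup>2 = 0"
      using zero_le_power2[of "l2_norm ?P b"] zero_le_power2[of "l2_norm ?P a"] by linarith+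
    then have "l2_norm ?P b = 0" "l2_norm ?P a = 0" by simp_all
    then have "AE t in lebesgue_on ?P. a t = 0" "AE t in lebesgue_on ?P. b t = 0"
      using l2_norm_eq_0 aL bL by auto
    then have "AE t in lebesgue_on ?P. F t = h t" "AE t in lebesgue_on ?P. G t = k t"
      by (auto simp: a_def b_def elim: eventually_mono)
    then show "p \<in> H" using closure_cong[OF FG L] p by simp
  qed
  have HeqA: "H = A" using HA AH by blast
  have TH: "T \<subseteq> H" using TA HeqA by simp
  have adjH: "graph_adjoint ?P H = H"
  proof
    show "graph_adjoint ?P H \<subseteq> H"
      using TH unfolding HeqA A_def graph_adjoint_def by auto
    show "H \<subseteq> graph_adjoint ?P H"
    proof
      fix p assume p: "p \<in> H"
      obtain h k where hk: "p = (h, k)" by (cases p)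
      have "(h, k) \<in> A" using p hk HA by auto
      then show "p \<in> graph_adjoint ?P H"
        using Asym AL unfolding hk graph_adjoint_def HeqA by auto
    qed
  qed
  have dense: "densely_defined ?P H"
    unfolding densely_defined_def
  proof (intro ballI allI impI)
    fix f and e :: real assume f: "f \<in> L2 ?P" and e: "0 < e"
    \<comment> \<open>Projecting in the first component only, the rest \<open>f - F\<close> is orthogonal to the domain, that is,
      \<open>(0, f - F)\<close> lies in the adjoint.\<close>
    define D :: l2_graph where "D = {(h, \<lambda>_. 0 :: complex) | h. \<exists>k. (h, k) \<in> T}"
    have DL: "D \<subseteq> L2 ?P \<times> L2 ?P" using TL by (auto simp: D_def)
    have Dne: "D \<noteq> {}" using T0 by (auto simp: D_def)
    obtain F G where FG: "(F, G) \<in> graph_closure ?P D"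
      and orth: "\<And>a b. (a, b) \<in> D \<Longrightarrow> l2_inner ?P a (\<lambda>x. f x - F x) + l2_inner ?P b (\<lambda>x. 0 - G x) = 0"
    proof (rule l2_projection[OF DL Dne _ _ f L2_zero])
      show "(\<lambda>x. a x + a' x, \<lambda>x. b x + b' x) \<in> D" if D: "(a, b) \<in> D" "(a', b') \<in> D" for a b a' b'
      proof -
        obtain k k' where "b = (\<lambda>_. 0)" "b' = (\<lambda>_. 0)" "(a, k) \<in> T" "(a', k') \<in> T"
          using D by (auto simp: D_def)
        then show ?thesis using H0_add[of a k a' k'] by (auto simp: D_def T_def)
      qed
      show "(\<lambda>x. c * a x, \<lambda>x. c * b x) \<in> D" if D: "(a, b) \<in> D" for a b c
      proof -
        obtain k where "b = (\<lambda>_. 0)" "(a, k) \<in> T"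
          using D by (auto simp: D_def)
        then show ?thesis using H0_scale[of a k c] by (auto simp: D_def T_def)
      qed
    qed blast
    obtain Fs Gs where Fs: "F \<in> L2 ?P" "\<And>k::nat. (Fs k, Gs k) \<in> D" "(\<lambda>k. l2_norm ?P (\<lambda>x. Fs k x - F x)) \<longlonglongrightarrow> 0"
      using FG unfolding graph_closure_def by blast
    have "(\<lambda>_. 0, \<lambda>t. f t - F t) \<in> A"
    proof -
      have "l2_inner ?P b (\<lambda>_. 0) = l2_inner ?P a (\<lambda>t. f t - F t)" if "(a, b) \<in> T" for a b
      proof -
        have "(a, \<lambda>_. 0) \<in> D" using that by (auto simp: D_def)
        from orth[OF this] show ?thesis by (simp add: l2_inner_def)
      qed
      then show ?thesis using f Fs(1) by (auto simp: A_def graph_adjoint_def intro: L2_diff)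
    qed
    then have ae: "AE t in lebesgue_on ?P. f t - F t = 0"
      using adjoint_single_valued unfolding A_def T_def by blast
    obtain n where n: "l2_norm ?P (\<lambda>x. Fs n x - F x) < e"
      using order_tendstoD(2)[OF Fs(3) e] by (auto simp: eventually_sequentially)
    obtain k where k: "(Fs n, k) \<in> T" using Fs(2)[of n] by (auto simp: D_def)
    then have FnL: "Fs n \<in> L2 ?P" using TL by auto
    have "l2_norm ?P (\<lambda>x. Fs n x - f x) = l2_norm ?P (\<lambda>x. Fs n x - F x)"
      using ae by (intro l2_norm_cong_AE L2_measurable L2_diff FnL f Fs) (auto elim: eventually_mono)
    with n have "l2_norm ?P (\<lambda>x. Fs n x - f x) < e" by simp
    moreover have "(Fs n, k) \<in> H" using k TH by blast
    ultimately show "\<exists>(h, k)\<in>H. l2_norm ?P (\<lambda>x. h x - f x) < e" by auto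
  qed
  show ?thesis
    using dense adjH unfolding self_adjoint_def H_graph_def H_def T_def by simp
qed

end

section \<open>Recurrences without two square-summable solutions\<close>

lemma summable_nonneg_le:
  fixes a b :: "nat \<Rightarrow> real"
  assumes "summable b" "\<And>n. 0 \<le> a n" "\<And>n. a n \<le> b n"
  shows "summable a"
  by (rule summable_comparison_test'[OF assms(1), of 0]) (use assms in auto)

text \<open>
  Discrete energy estimate: \<open>y\<^sub>n q\<^sub>n\<close> increases by \<open>D\<^sub>n q\<^sub>n\<^sup>2 + b\<^sub>n y\<^bsub>n+1\<^esub>\<^sup>2\<close>.  If \<open>\<Sum> D\<^sub>n q\<^sub>n\<^sup>2\<close> diverged, this product would
  eventually be positive and \<open>|y|\<close> would grow, which contradicts square summability because
  \<open>\<Sum> D\<^sub>n\<close> diverges.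
\<close>

lemma slopes_summable:
  fixes D b y q :: "nat \<Rightarrow> real"
  assumes D: "\<And>n. 0 < D n" and div: "\<not> summable D"
    and y: "\<And>n. y (Suc n) = y n + D n * q n" and q: "\<And>n. q (Suc n) = q n + b n * y (Suc n)"
    and C: "0 \<le> C" and b: "\<And>n. - C * D n \<le> b n"
    and s: "summable (\<lambda>n. D n * (y (Suc n))\<^sup>2)"
  shows "summable (\<lambda>n. D n * (q n)\<^sup>2)"
proof (rule ccontr)
  assume ns: "\<not> summable (\<lambda>n. D n * (q n)\<^sup>2)"
  define S where "S = (\<Sum>n. D n * (y (Suc n))\<^sup>2)"
  have S: "(\<Sum>k<n. D k * (y (Suc k))\<^sup>2) \<le> S" for n
    unfolding S_def using D by (intro sum_le_suminf s) (auto simp: less_imp_le)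
  have step: "y n * q n + D n * (q n)\<^sup>2 - C * (D n * (y (Suc n))\<^sup>2) \<le> y (Suc n) * q (Suc n)" for n
  proof -
    have "y (Suc n) * q (Suc n) = y n * q n + D n * (q n)\<^sup>2 + b n * (y (Suc n))\<^sup>2"
      unfolding q[of n] by (simp add: y power2_eq_square algebra_simps)
    moreover have "- C * D n * (y (Suc n))\<^sup>2 \<le> b n * (y (Suc n))\<^sup>2"
      by (intro mult_right_mono b) auto
    ultimately show ?thesis by (simp add: algebra_simps)
  qed
  have low: "y 0 * q 0 + (\<Sum>k<n. D k * (q k)\<^sup>2) - C * (\<Sum>k<n. D k * (y (Suc k))\<^sup>2) \<le> y n * q n" for n
  proof (induction n)
    case (Suc n)
    then show ?case using step[of n] by (simp add: distrib_left)
  qed simp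
  obtain N where N: "C * S - y 0 * q 0 < (\<Sum>k<N. D k * (q k)\<^sup>2)"
  proof (rule ccontr)
    assume "\<not> thesis"
    then have "(\<Sum>k<n. D k * (q k)\<^sup>2) \<le> C * S - y 0 * q 0" for n
      using that by (meson not_less)
    then have "summable (\<lambda>n. D n * (q n)\<^sup>2)"
      using D by (intro summableI_nonneg_bounded) (auto simp: less_imp_le)
    with ns show False by contradiction
  qed
  have pos: "0 < y n * q n" if "N \<le> n" for n
  proof -
    have "(\<Sum>k<N. D k * (q k)\<^sup>2) \<le> (\<Sum>k<n. D k * (q k)\<^sup>2)"
      using that D by (intro sum_mono2) (auto simp: less_imp_le)
    moreover have "C * (\<Sum>k<n. D k * (y (Suc k))\<^sup>2) \<le> C * S"
      by (intro mult_left_mono S C)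
    ultimately show ?thesis using low[of n] N by linarith
  qed
  have grow: "(y N)\<^sup>2 \<le> (y n)\<^sup>2" if "N \<le> n" for n
    using that
  proof (induction n rule: dec_induct)
    case (step n)
    have "(y (Suc n))\<^sup>2 = (y n)\<^sup>2 + 2 * D n * (y n * q n) + (D n * q n)\<^sup>2"
      by (simp add: y power2_eq_square algebra_simps)
    moreover have "0 \<le> 2 * D n * (y n * q n)"
      using mult_nonneg_nonneg[of "2 * D n" "y n * q n"] pos[OF step(1)] D[of n] by simp
    ultimately have "(y n)\<^sup>2 \<le> (y (Suc n))\<^sup>2" by simp
    with step show ?case by linarith
  qed simp
  have yN: "0 < (y N)\<^sup>2" using pos[of N] by auto
  have "summable (\<lambda>n. D n * (y N)\<^sup>2)"
  proof (rule summable_comparison_test'[OF s, of N])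
    fix n assume "N \<le> n"
    then show "norm (D n * (y N)\<^sup>2) \<le> D n * (y (Suc n))\<^sup>2"
      using D[of n] grow[of "Suc n"] by (simp add: abs_mult mult_left_mono)
  qed
  then have "summable (\<lambda>n. D n * (y N)\<^sup>2 * inverse ((y N)\<^sup>2))" by (rule summable_mult2)
  with yN div show False by (simp add: mult.assoc)
qed

lemma abs_mult_le_squares: "\<bar>u * v\<bar> \<le> u\<^sup>2 + (v :: real)\<^sup>2"
proof -
  have "2 * \<bar>u\<bar> * \<bar>v\<bar> \<le> \<bar>u\<bar>\<^sup>2 + \<bar>v\<bar>\<^sup>2" by (rule sum_squares_bound)
  moreover have "0 \<le> \<bar>u\<bar> * \<bar>v\<bar>" by simp
  ultimately show ?thesis unfolding abs_mult power2_abs by linarith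
qed

text \<open>
  The constant Wronskian is a sum of products of square-summable sequences, which forces
  \<open>\<Sum> D\<^sub>n < \<infinity>\<close>.
\<close>

lemma bounded_below_not_both_l2:
  fixes D b y q z p :: "nat \<Rightarrow> real"
  assumes D: "\<And>n. 0 < D n" and div: "\<not> summable D"
    and y: "\<And>n. y (Suc n) = y n + D n * q n" and q: "\<And>n. q (Suc n) = q n + b n * y (Suc n)"
    and z: "\<And>n. z (Suc n) = z n + D n * p n" and p: "\<And>n. p (Suc n) = p n + b n * z (Suc n)"
    and C: "0 \<le> C" and b: "\<And>n. - C * D n \<le> b n"
    and sy: "summable (\<lambda>n. D n * (y n)\<^sup>2)" "summable (\<lambda>n. D n * (y (Suc n))\<^sup>2)"
    and sz: "summable (\<lambda>n. D n * (z n)\<^sup>2)" "summable (\<lambda>n. D n * (z (Suc n))\<^sup>2)"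
    and W: "\<And>n. \<bar>y n * p n - q n * z n\<bar> = 1"
  shows False
proof -
  have sq: "summable (\<lambda>n. D n * (q n)\<^sup>2)" by (rule slopes_summable[OF D div y q C b sy(2)])
  have sp: "summable (\<lambda>n. D n * (p n)\<^sup>2)" by (rule slopes_summable[OF D div z p C b sz(2)])
  have "summable (\<lambda>n. (D n * (y n)\<^sup>2 + D n * (p n)\<^sup>2) + (D n * (q n)\<^sup>2 + D n * (z n)\<^sup>2))"
    by (intro summable_add sy sz sq sp)
  then have "summable D"
  proof (rule summable_nonneg_le)
    show "D n \<le> (D n * (y n)\<^sup>2 + D n * (p n)\<^sup>2) + (D n * (q n)\<^sup>2 + D n * (z n)\<^sup>2)" for n
    proof -
      have "1 \<le> \<bar>y n * p n\<bar> + \<bar>q n * z n\<bar>" using W[of n] by linarith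
      also have "\<dots> \<le> ((y n)\<^sup>2 + (p n)\<^sup>2) + ((q n)\<^sup>2 + (z n)\<^sup>2)" by (intro add_mono abs_mult_le_squares)
      finally have "D n * 1 \<le> D n * (((y n)\<^sup>2 + (p n)\<^sup>2) + ((q n)\<^sup>2 + (z n)\<^sup>2))"
        using D[of n] by (intro mult_left_mono) auto
      then show ?thesis by (simp add: distrib_left)
    qed
  qed (use D in \<open>auto simp: less_imp_le\<close>)
  with div show False by contradiction
qed

text \<open>
  Passing from \<open>y\<^sub>n\<close> to \<open>(-1)\<^sup>n y\<^sub>n\<close> replaces the coefficient \<open>b\<^sub>n\<close> by \<open>B\<^sub>n = - b\<^sub>n - 2 (1 / D\<^sub>n + 1 / D\<^bsub>n+1\<^esub>)\<close> and
  reduces very negative coefficients to coefficients bounded from below.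
\<close>

lemma alternating_not_both_l2:
  fixes D b y q z p :: "nat \<Rightarrow> real"
  assumes D: "\<And>n. 0 < D n" and div: "\<not> summable D"
    and y: "\<And>n. y (Suc n) = y n + D n * q n" and q: "\<And>n. q (Suc n) = q n + b n * y (Suc n)"
    and z: "\<And>n. z (Suc n) = z n + D n * p n" and p: "\<And>n. p (Suc n) = p n + b n * z (Suc n)"
    and C: "0 \<le> C" and b: "\<And>n. b n \<le> - 2 * (1 / D n + 1 / D (Suc n)) + C * D n"
    and sy: "summable (\<lambda>n. D n * (y n)\<^sup>2)" "summable (\<lambda>n. D n * (y (Suc n))\<^sup>2)"
    and sz: "summable (\<lambda>n. D n * (z n)\<^sup>2)" "summable (\<lambda>n. D n * (z (Suc n))\<^sup>2)"
    and W: "\<And>n. \<bar>y n * p n - q n * z n\<bar> = 1"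
  shows False
proof -
  define alt where "alt f n = (-1) ^ n * f n" for f :: "nat \<Rightarrow> real" and n
  define slope where "slope f n = (alt f (Suc n) - alt f n) / D n" for f n
  define B where "B n = - b n - 2 * (1 / D n + 1 / D (Suc n))" for n
  have D0: "D n \<noteq> 0" for n using D[of n] by simp
  have sq: "(alt f n)\<^sup>2 = (f n)\<^sup>2" for f n
  proof -
    have "((-1 :: real) ^ n)\<^sup>2 = 1" by (metis power_even_eq power_minus1_even)
    then show ?thesis by (simp add: alt_def power_mult_distrib)
  qed
  have step1: "alt f (Suc n) = alt f n + D n * slope f n" for f n
    using D0 by (simp add: slope_def)
  have slope_eq: "slope f n = - ((-1) ^ n * (2 * f n / D n + g n))"
    if f: "\<And>n. f (Suc n) = f n + D n * g n" for f g n
    using D0[of n] by (simp add: slope_def alt_def f field_simps)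
  have step2: "slope f (Suc n) = slope f n + B n * alt f (Suc n)"
    if f: "\<And>n. f (Suc n) = f n + D n * g n" and g: "\<And>n. g (Suc n) = g n + b n * f (Suc n)" for f g n
  proof -
    have fn: "f n = f (Suc n) - D n * g n" using f[of n] by simp
    have "slope f (Suc n) = (-1) ^ n * (2 * f (Suc n) / D (Suc n) + g n + b n * f (Suc n))"
      unfolding slope_eq[OF f, of "Suc n"] g[of n] by (simp add: algebra_simps)
    moreover have "slope f n = - ((-1) ^ n * (2 * f (Suc n) / D n - g n))"
      unfolding slope_eq[OF f, of n] using D0[of n] by (simp add: fn field_simps)
    moreover have "B n * alt f (Suc n) = (-1) ^ n * (b n * f (Suc n) + 2 * f (Suc n) / D n + 2 * f (Suc n) / D (Suc n))"
      by (simp add: B_def alt_def algebra_simps)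
    ultimately show ?thesis by (simp add: algebra_simps)
  qed
  show False
  proof (rule bounded_below_not_both_l2[OF D div step1 step2[OF y q] step1 step2[OF z p] C])
    show "- C * D n \<le> B n" for n using b[of n] by (simp add: B_def)
    show "\<bar>alt y n * slope z n - slope y n * alt z n\<bar> = 1" for n
    proof -
      have "(-1 :: real) ^ n * (-1) ^ n = 1" by (simp flip: power_add mult_2)
      moreover have "alt y n * slope z n - slope y n * alt z n = ((-1) ^ n * (-1) ^ n) * (q n * z n - y n * p n)"
        unfolding slope_eq[OF y] slope_eq[OF z] alt_def by (simp add: algebra_simps)
      ultimately have "alt y n * slope z n - slope y n * alt z n = - (y n * p n - q n * z n)"
        by simp
      then show ?thesis using W[of n] by simp
    qed
  qed (simp_all add: sq sy sz)
qed

text \<open>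
  The Wronskian taken over two steps, \<open>y\<^bsub>n+2\<^esub> z\<^sub>n - z\<^bsub>n+2\<^esub> y\<^sub>n\<close>, equals \<open>D\<^sub>n + D\<^bsub>n+1\<^esub> + D\<^sub>n D\<^bsub>n+1\<^esub> b\<^sub>n\<close> up to sign.
  Square summability of both solutions makes its product with \<open>D\<^bsub>n+1\<^esub>\<close> summable, which limits the size
  of \<open>b\<^sub>n\<close>.
\<close>

lemma strong_coupling_not_both_l2:
  fixes D b y q z p :: "nat \<Rightarrow> real"
  assumes D: "\<And>n. 0 < D n" and anti: "\<And>n. D (Suc n) \<le> D n" and ratio: "\<And>n. D n \<le> R * D (Suc n)"
    and sqs: "summable (\<lambda>n. (D n)\<^sup>2)"
    and y: "\<And>n. y (Suc n) = y n + D n * q n" and q: "\<And>n. q (Suc n) = q n + b n * y (Suc n)"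
    and z: "\<And>n. z (Suc n) = z n + D n * p n" and p: "\<And>n. p (Suc n) = p n + b n * z (Suc n)"
    and sy: "summable (\<lambda>n. D n * (y n)\<^sup>2)" "summable (\<lambda>n. D n * (y (Suc n))\<^sup>2)"
    and sz: "summable (\<lambda>n. D n * (z n)\<^sup>2)" "summable (\<lambda>n. D n * (z (Suc n))\<^sup>2)"
    and W: "\<And>n. \<bar>y n * p n - q n * z n\<bar> = 1"
  shows "summable (\<lambda>n. \<bar>b n\<bar> * D n ^ 3)"
proof -
  let ?s = "\<lambda>n. (D n * (y n)\<^sup>2 + D n * (z n)\<^sup>2) + (D (Suc n) * (y (Suc (Suc n)))\<^sup>2 + D (Suc n) * (z (Suc (Suc n)))\<^sup>2)"
  have ident: "D (Suc n) * \<bar>D n + D (Suc n) + D n * D (Suc n) * b n\<bar> \<le> ?s n" for n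
  proof -
    have "y (Suc (Suc n)) * z n - z (Suc (Suc n)) * y n
        = - (y n * p n - q n * z n) * (D n + D (Suc n) + D n * D (Suc n) * b n)"
      unfolding y[of "Suc n"] z[of "Suc n"] q[of n] p[of n] unfolding y[of n] z[of n] by algebra
    then have "\<bar>D n + D (Suc n) + D n * D (Suc n) * b n\<bar> = \<bar>y (Suc (Suc n)) * z n - z (Suc (Suc n)) * y n\<bar>"
      using W[of n] by (simp add: abs_mult abs_minus_commute)
    also have "\<dots> \<le> \<bar>y (Suc (Suc n)) * z n\<bar> + \<bar>z (Suc (Suc n)) * y n\<bar>" by linarith
    also have "\<dots> \<le> ((y (Suc (Suc n)))\<^sup>2 + (z n)\<^sup>2) + ((z (Suc (Suc n)))\<^sup>2 + (y n)\<^sup>2)"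
    proof -
      show ?thesis by (intro add_mono abs_mult_le_squares)
    qed
    finally have "D (Suc n) * \<bar>D n + D (Suc n) + D n * D (Suc n) * b n\<bar>
        \<le> D (Suc n) * (((y (Suc (Suc n)))\<^sup>2 + (z n)\<^sup>2) + ((z (Suc (Suc n)))\<^sup>2 + (y n)\<^sup>2))"
      using D[of "Suc n"] by (intro mult_left_mono) auto
    moreover have "D (Suc n) * (z n)\<^sup>2 \<le> D n * (z n)\<^sup>2" "D (Suc n) * (y n)\<^sup>2 \<le> D n * (y n)\<^sup>2"
      using anti by (auto intro: mult_right_mono)
    ultimately show ?thesis by (simp add: distrib_left)
  qed
  have R0: "0 \<le> R"
    using ratio[of 0] D[of 0] D[of "Suc 0"] by (metis less_le_trans less_imp_le zero_less_mult_pos2)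
  have "summable (\<lambda>n. ?s n + 2 * (D n)\<^sup>2)"
  proof (intro summable_add summable_mult sqs sy sz)
    show "summable (\<lambda>n. D (Suc n) * (y (Suc (Suc n)))\<^sup>2)"
      by (rule summable_Suc_iff[THEN iffD2, OF sy(2)])
    show "summable (\<lambda>n. D (Suc n) * (z (Suc (Suc n)))\<^sup>2)"
      by (rule summable_Suc_iff[THEN iffD2, OF sz(2)])
  qed
  then have "summable (\<lambda>n. R\<^sup>2 * (?s n + 2 * (D n)\<^sup>2))" by (rule summable_mult)
  then show ?thesis
  proof (rule summable_nonneg_le)
    fix n
    show "0 \<le> \<bar>b n\<bar> * D n ^ 3" using D[of n] by simp
    have "D n * D (Suc n) * \<bar>b n\<bar> = \<bar>D n * D (Suc n) * b n\<bar>"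
      using D[of n] D[of "Suc n"] by (simp add: abs_mult)
    also have "\<dots> \<le> \<bar>D n + D (Suc n) + D n * D (Suc n) * b n\<bar> + (D n + D (Suc n))"
      using D[of n] D[of "Suc n"] by linarith
    finally have "D (Suc n) * (D n * D (Suc n) * \<bar>b n\<bar>)
        \<le> D (Suc n) * (\<bar>D n + D (Suc n) + D n * D (Suc n) * b n\<bar> + (D n + D (Suc n)))"
      using D[of "Suc n"] by (intro mult_left_mono) auto
    also have "\<dots> \<le> ?s n + 2 * (D n)\<^sup>2"
    proof -
      have "D (Suc n) * (D n + D (Suc n)) \<le> D n * (D n + D n)"
        using D[of n] D[of "Suc n"] anti[of n] by (intro mult_mono add_left_mono) auto
      then show ?thesis using ident[of n] by (simp add: distrib_left power2_eq_square)
    qed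
    finally have 1: "D (Suc n) * (D n * D (Suc n) * \<bar>b n\<bar>) \<le> ?s n + 2 * (D n)\<^sup>2" .
    have "\<bar>b n\<bar> * D n ^ 3 = \<bar>b n\<bar> * D n * (D n)\<^sup>2" by (simp add: power2_eq_square power3_eq_cube)
    also have "\<dots> \<le> \<bar>b n\<bar> * D n * (R * D (Suc n))\<^sup>2"
      using D[of n] ratio[of n] by (intro mult_left_mono power_mono) auto
    also have "\<dots> = R\<^sup>2 * (D (Suc n) * (D n * D (Suc n) * \<bar>b n\<bar>))"
      by (simp add: power2_eq_square)
    also have "\<dots> \<le> R\<^sup>2 * (?s n + 2 * (D n)\<^sup>2)"
      using 1 by (intro mult_left_mono) auto
    finally show "\<bar>b n\<bar> * D n ^ 3 \<le> R\<^sup>2 * (?s n + 2 * (D n)\<^sup>2)" .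
  qed
qed

section \<open>Node values of zero-energy solutions\<close>

context point_interactions
begin

lemma homogeneous_nodes:
  assumes s: "solves (\<lambda>_. 0) y y'"
  shows "y (x (Suc n)) = y (x n) + of_real (x (Suc n) - x n) * y' (x n)"
    and "y' (x (Suc n)) = y' (x n) + of_real (\<alpha> (Suc n)) * y (x (Suc n))"
    and "\<And>t. t \<in> {x n..x (Suc n)} \<Longrightarrow> y t = y (x n) + of_real (t - x n) * y' (x n)"
proof -
  show *: "y t = y (x n) + of_real (t - x n) * y' (x n)" if t: "t \<in> {x n..x (Suc n)}" for t
  proof -
    have "integral {x n..t} y' = integral {x n..t} (\<lambda>_. y' (x n))"
    proof (rule integral_spike[of "{x (Suc n)}"])
      fix r assume "r \<in> {x n..t} - {x (Suc n)}"
      then have "r \<in> {x n..<x (Suc n)}" using t by auto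
      from solvesD(1)[OF s this] show "y' (x n) = y' r" by simp
    qed simp
    also have "\<dots> = of_real (t - x n) * y' (x n)"
      using t by (simp add: scaleR_conv_of_real)
    finally show ?thesis using solvesD(2)[OF s t] by simp
  qed
  show "y (x (Suc n)) = y (x n) + of_real (x (Suc n) - x n) * y' (x n)"
    using x_less[of n] by (intro *) auto
  show "y' (x (Suc n)) = y' (x n) + of_real (\<alpha> (Suc n)) * y (x (Suc n))"
    using solvesD(3)[OF s, of n] by simp
qed

text \<open>
  The real part \<open>a + q s\<close> of a zero-energy solution is affine on a cell of length \<open>d\<close>, and
  integrating over \<open>0 \<le> s \<le> d\<close> gives \<open>6 \<integral> (a + q s)\<^sup>2 = d (a\<^sup>2 + (a + d q)\<^sup>2) + d (2 a + d q)\<^sup>2\<close>.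
\<close>

lemma homogeneous_L2_imp_nodes_summable:
  assumes s: "solves (\<lambda>_. 0) y y'" and yL: "y \<in> L2 {0<..}"
  shows "summable (\<lambda>n. (x (Suc n) - x n) * ((Re (y (x n)))\<^sup>2 + (Re (y (x (Suc n))))\<^sup>2))"
proof -
  define h where "h t = (cmod (y t))\<^sup>2" for t
  have hc: "continuous_on {a..b} h" if "0 \<le> a" for a b
    unfolding h_def
    by (intro continuous_intros continuous_on_subset[OF solves_u_continuous[OF locally_integrable_zero s, of b]])
      (use that in auto)
  have hi: "h integrable_on {a..b}" if "0 \<le> a" for a b
    by (rule integrable_continuous_real[OF hc[OF that]])
  have hP: "integrable (lebesgue_on {0<..}) h"
    unfolding h_def by (rule L2_sq_integrable[OF yL])
  have cell: "(x (Suc n) - x n) * ((Re (y (x n)))\<^sup>2 + (Re (y (x (Suc n))))\<^sup>2) \<le> 6 * integral {x n..x (Suc n)} h" for n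
  proof -
    define d where "d = x (Suc n) - x n"
    define a where "a = Re (y (x n))"
    define q where "q = Re (y' (x n))"
    have d0: "0 < d" using x_less[of n] by (simp add: d_def)
    have Re: "Re (y t) = a + (t - x n) * q" if "t \<in> {x n..x (Suc n)}" for t
      using homogeneous_nodes(3)[OF s that] by (simp add: a_def q_def)
    define r where "r = q\<^sup>2 / 3"
    define F where "F t = a\<^sup>2 * (t - x n) + a * q * (t - x n)\<^sup>2 + r * (t - x n) ^ 3" for t
    have "(F has_real_derivative (a\<^sup>2 + 2 * a * q * (t - x n) + 3 * r * (t - x n)\<^sup>2)) (at t within {x n..x (Suc n)})" for t
      unfolding F_def by (auto intro!: derivative_eq_intros simp: power2_eq_square algebra_simps)
    moreover have "a\<^sup>2 + 2 * a * q * (t - x n) + 3 * r * (t - x n)\<^sup>2 = (a + (t - x n) * q)\<^sup>2" for t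
      by (simp add: r_def power2_eq_square algebra_simps)
    ultimately have "(F has_real_derivative (a + (t - x n) * q)\<^sup>2) (at t within {x n..x (Suc n)})" for t
      by simp
    then have "((\<lambda>t. (a + (t - x n) * q)\<^sup>2) has_integral (F (x (Suc n)) - F (x n))) {x n..x (Suc n)}"
      using x_less[of n] by (intro fundamental_theorem_of_calculus)
        (auto simp flip: has_real_derivative_iff_has_vector_derivative)
    then have I: "integral {x n..x (Suc n)} (\<lambda>t. (a + (t - x n) * q)\<^sup>2) = F (x (Suc n)) - F (x n)"
      "(\<lambda>t. (a + (t - x n) * q)\<^sup>2) integrable_on {x n..x (Suc n)}"
      by (auto simp: integral_unique has_integral_integrable)
    have le: "integral {x n..x (Suc n)} (\<lambda>t. (a + (t - x n) * q)\<^sup>2) \<le> integral {x n..x (Suc n)} h"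
    proof (rule integral_le[OF I(2) hi[OF x_nonneg]])
      fix t assume "t \<in> {x n..x (Suc n)}"
      from Re[OF this] show "(a + (t - x n) * q)\<^sup>2 \<le> h t"
        unfolding h_def cmod_power2 by simp
    qed
    have "d * (a\<^sup>2 + (a + d * q)\<^sup>2) \<le> d * (a\<^sup>2 + (a + d * q)\<^sup>2) + d * (2 * a + d * q)\<^sup>2"
      using d0 by simp
    also have "\<dots> = 6 * (F (x (Suc n)) - F (x n))"
      by (simp add: F_def r_def d_def[symmetric] power2_eq_square power3_eq_cube algebra_simps)
    also have "\<dots> \<le> 6 * integral {x n..x (Suc n)} h"
      using le unfolding I(1) by simp
    finally have "d * (a\<^sup>2 + (a + d * q)\<^sup>2) \<le> 6 * integral {x n..x (Suc n)} h" .
    moreover have "Re (y (x (Suc n))) = a + d * q"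
      using Re[of "x (Suc n)"] x_less[of n] by (simp add: d_def)
    ultimately show ?thesis by (simp add: a_def d_def)
  qed
  have sum: "(\<Sum>k<n. integral {x k..x (Suc k)} h) = integral {0..x n} h" for n
  proof (induction n)
    case (Suc n)
    have "integral {0..x n} h + integral {x n..x (Suc n)} h = integral {0..x (Suc n)} h"
      by (rule HK_combine) (auto simp: x_nonneg x_less less_imp_le hi)
    with Suc show ?case by simp
  qed (simp add: x0)
  have bound: "integral {0..x n} h \<le> integral {0<..} h" for n
  proof -
    have "integral {0..x n} h = integral {0<..x n} h"
      by (rule integral_spike_set[OF negligible_Icc_Ioc])
    also have "\<dots> \<le> integral {0<..} h"
    proof (rule integral_subset_le)
      show "h integrable_on {0<..}" by (rule integrable_on_lebesgue_on[OF hP]) auto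
      show "h integrable_on {0<..x n}"
        by (rule integrable_spike_set[OF hi[of 0 "x n"] negligible_Icc_Ioc]) simp
    qed (auto simp: h_def)
    finally show ?thesis .
  qed
  show ?thesis
  proof (rule summableI_nonneg_bounded)
    show "0 \<le> (x (Suc n) - x n) * ((Re (y (x n)))\<^sup>2 + (Re (y (x (Suc n))))\<^sup>2)" for n
      using x_less[of n] by simp
    show "(\<Sum>k<n. (x (Suc k) - x k) * ((Re (y (x k)))\<^sup>2 + (Re (y (x (Suc k))))\<^sup>2)) \<le> 6 * integral {0<..} h" for n
    proof -
      have "(\<Sum>k<n. (x (Suc k) - x k) * ((Re (y (x k)))\<^sup>2 + (Re (y (x (Suc k))))\<^sup>2))
          \<le> (\<Sum>k<n. 6 * integral {x k..x (Suc k)} h)" by (rule sum_mono) (rule cell)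
      also have "\<dots> = 6 * integral {0..x n} h" by (simp add: sum sum_distrib_left[symmetric])
      finally show ?thesis using bound[of n] by linarith
    qed
  qed
qed

text \<open>
  The node values \<open>y\<close>, \<open>z\<close> and slopes \<open>q\<close>, \<open>p\<close> are those of the zero-energy solutions with initial data
  \<open>(1, 0)\<close> and \<open>(0, 1)\<close>.
\<close>

lemma self_adjoint_if_not_both_l2:
  assumes not_both: "\<And>y q z p :: nat \<Rightarrow> real.
      (\<And>n. y (Suc n) = y n + (x (Suc n) - x n) * q n) \<Longrightarrow> (\<And>n. q (Suc n) = q n + \<alpha> (Suc n) * y (Suc n)) \<Longrightarrow>
      (\<And>n. z (Suc n) = z n + (x (Suc n) - x n) * p n) \<Longrightarrow> (\<And>n. p (Suc n) = p n + \<alpha> (Suc n) * z (Suc n)) \<Longrightarrow>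
      (\<And>n. y n * p n - q n * z n = 1) \<Longrightarrow>
      summable (\<lambda>n. (x (Suc n) - x n) * (y n)\<^sup>2) \<Longrightarrow> summable (\<lambda>n. (x (Suc n) - x n) * (y (Suc n))\<^sup>2) \<Longrightarrow>
      summable (\<lambda>n. (x (Suc n) - x n) * (z n)\<^sup>2) \<Longrightarrow> summable (\<lambda>n. (x (Suc n) - x n) * (z (Suc n))\<^sup>2) \<Longrightarrow> False"
  shows "self_adjoint {0<..} (H_graph x \<alpha>)"
proof -
  obtain \<phi> \<phi>' where \<phi>: "solves (\<lambda>_. 0) \<phi> \<phi>'" "\<phi> 0 = 1" "\<phi>' 0 = 0"
    using solves_exists[OF locally_integrable_zero] by blast
  obtain \<theta> \<theta>' where \<theta>: "solves (\<lambda>_. 0) \<theta> \<theta>'" "\<theta> 0 = 0" "\<theta>' 0 = 1"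
    using solves_exists[OF locally_integrable_zero] by blast
  have "\<not> (\<phi> \<in> L2 {0<..} \<and> \<theta> \<in> L2 {0<..})"
  proof
    assume L: "\<phi> \<in> L2 {0<..} \<and> \<theta> \<in> L2 {0<..}"
    have split: "summable (\<lambda>n. (x (Suc n) - x n) * (Re (u (x n)))\<^sup>2)"
      "summable (\<lambda>n. (x (Suc n) - x n) * (Re (u (x (Suc n))))\<^sup>2)"
      if "solves (\<lambda>_. 0) u u'" "u \<in> L2 {0<..}" for u u'
    proof -
      note S = homogeneous_L2_imp_nodes_summable[OF that]
      have d: "0 \<le> x (Suc n) - x n" for n using x_less[of n] by simp
      show "summable (\<lambda>n. (x (Suc n) - x n) * (Re (u (x n)))\<^sup>2)"
        "summable (\<lambda>n. (x (Suc n) - x n) * (Re (u (x (Suc n))))\<^sup>2)"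
        by (rule summable_nonneg_le[OF S]; use d in \<open>auto intro: mult_left_mono\<close>)+
    qed
    have rec: "Re (u (x (Suc n))) = Re (u (x n)) + (x (Suc n) - x n) * Re (u' (x n))"
      "Re (u' (x (Suc n))) = Re (u' (x n)) + \<alpha> (Suc n) * Re (u (x (Suc n)))"
      if "solves (\<lambda>_. 0) u u'" for u u' n
    proof -
      show "Re (u (x (Suc n))) = Re (u (x n)) + (x (Suc n) - x n) * Re (u' (x n))"
        unfolding homogeneous_nodes(1)[OF that, of n] by simp
      show "Re (u' (x (Suc n))) = Re (u' (x n)) + \<alpha> (Suc n) * Re (u (x (Suc n)))"
        unfolding homogeneous_nodes(2)[OF that, of n] by simp
    qed
    have W: "Re (\<phi> (x n)) * Re (\<theta>' (x n)) - Re (\<phi>' (x n)) * Re (\<theta> (x n)) = 1" for n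
    proof (induction n)
      case 0
      then show ?case using \<phi> \<theta> by (simp add: x0)
    next
      case (Suc n)
      have "Re (\<phi> (x (Suc n))) * Re (\<theta>' (x (Suc n))) - Re (\<phi>' (x (Suc n))) * Re (\<theta> (x (Suc n)))
          = Re (\<phi> (x n)) * Re (\<theta>' (x n)) - Re (\<phi>' (x n)) * Re (\<theta> (x n))"
        unfolding rec(2)[OF \<phi>(1), of n] rec(2)[OF \<theta>(1), of n]
        unfolding rec(1)[OF \<phi>(1), of n] rec(1)[OF \<theta>(1), of n] by algebra
      with Suc show ?case by simp
    qed
    show False
      by (rule not_both[of "\<lambda>n. Re (\<phi> (x n))" "\<lambda>n. Re (\<phi>' (x n))" "\<lambda>n. Re (\<theta> (x n))" "\<lambda>n. Re (\<theta>' (x n))"])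
        (use rec[OF \<phi>(1)] rec[OF \<theta>(1)] W split[OF \<phi>(1)] split[OF \<theta>(1)] L in \<open>simp_all only:\<close>)
  qed
  then show ?thesis
    using limit_point_imp_self_adjoint \<phi>(1) \<theta>(1) by blast
qed

end

section \<open>The logarithmic mesh\<close>

lemma lnp_bounds:
  assumes eta: "0 < \<eta>" "\<eta> \<le> 1" and m: "2 \<le> m"
  shows "1 / 2 \<le> lnp \<eta> m" and "lnp \<eta> m \<le> lnp \<eta> (Suc m)" and "lnp \<eta> (Suc m) \<le> 2 * lnp \<eta> m"
proof -
  have l2: "ln 2 \<le> ln (real m)" using m by simp
  have half: "1 / 2 \<le> ln (2::real)" using ln2_ge_two_thirds by linarith
  have lpos: "0 < ln (real m)" using l2 half by linarith
  show "1 / 2 \<le> lnp \<eta> m"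
  proof -
    have "1 / 2 \<le> (1 / 2) powr \<eta>"
      using powr_mono'[of \<eta> 1 "1 / 2 :: real"] eta by simp
    also have "\<dots> \<le> lnp \<eta> m"
      unfolding lnp_def using eta l2 half by (intro powr_mono2) auto
    finally show ?thesis .
  qed
  show "lnp \<eta> m \<le> lnp \<eta> (Suc m)"
    unfolding lnp_def using eta m lpos by (intro powr_mono2) auto
  have "ln (real (Suc m)) \<le> ln ((real m)\<^sup>2)"
  proof -
    have "m + 1 \<le> m * m" using mult_le_mono[OF m order_refl[of m]] m by linarith
    then have "real (m + 1) \<le> real (m * m)" by (simp only: of_nat_le_iff)
    then show ?thesis using m by (simp add: power2_eq_square)
  qed
  also have "\<dots> = 2 * ln (real m)" using m by (simp add: ln_realpow)
  finally have "lnp \<eta> (Suc m) \<le> (2 * ln (real m)) powr \<eta>"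
    unfolding lnp_def using eta m by (intro powr_mono2) auto
  also have "\<dots> = 2 powr \<eta> * lnp \<eta> m"
    unfolding lnp_def using lpos by (simp add: powr_mult)
  also have "\<dots> \<le> 2 * lnp \<eta> m"
    using powr_mono[of \<eta> 1 "2::real"] eta by (intro mult_right_mono) (auto simp: lnp_def)
  finally show "lnp \<eta> (Suc m) \<le> 2 * lnp \<eta> m" .
qed

text \<open>
  Comparison with the increments of \<open>ln (ln n)\<close>, which are at most \<open>1 / (n ln n)\<close>.
\<close>

lemma not_summable_inverse_n_lnp:
  assumes eta: "0 < \<eta>" "\<eta> \<le> 1"
  shows "\<not> summable (\<lambda>n. 1 / (real (n + 2) * lnp \<eta> (n + 2)))"
proof
  assume "summable (\<lambda>n. 1 / (real (n + 2) * lnp \<eta> (n + 2)))"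
  then have s: "summable (\<lambda>n. 1 / (real (n + 3) * lnp \<eta> (n + 3)))"
    by (subst (asm) summable_Suc_iff[symmetric]) (simp add: numeral_eq_Suc)
  have step: "ln (ln (real (Suc n + 3))) - ln (ln (real (n + 3))) \<le> 1 / (real (n + 3) * lnp \<eta> (n + 3))" for n
  proof -
    define m where "m = real (n + 3)"
    have m3: "3 \<le> m" by (simp add: m_def)
    have l1: "1 \<le> ln m"
      using ln_ge_iff[of m 1] exp_le m3 by linarith
    have "ln (m + 1) - ln m \<le> 1 / m"
    proof -
      have "ln (m + 1) - ln m = ln (1 + 1 / m)" using m3 ln_div[of "m + 1" m] by (simp add: add_divide_distrib add.commute)
      also have "\<dots> \<le> 1 / m" using m3 by (intro ln_add_one_self_le_self) simp
      finally show ?thesis .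
    qed
    have "ln (ln (m + 1)) - ln (ln m) = ln (ln (m + 1) / ln m)"
      using m3 l1 by (subst ln_div) auto
    also have "\<dots> \<le> ln (m + 1) / ln m - 1"
      using m3 l1 by (intro ln_le_minus_one) auto
    also have "\<dots> = (ln (m + 1) - ln m) / ln m" using l1 by (simp add: field_simps)
    also have "\<dots> \<le> (1 / m) / ln m" using \<open>ln (m + 1) - ln m \<le> 1 / m\<close> l1 by (intro divide_right_mono) auto
    also have "\<dots> = 1 / (m * ln m)" by simp
    also have "\<dots> \<le> 1 / (m * (ln m) powr \<eta>)"
    proof -
      have "(ln m) powr \<eta> \<le> ln m" using powr_mono[of \<eta> 1 "ln m"] eta l1 by simp
      moreover have "0 < (ln m) powr \<eta>" using l1 by simp
      ultimately show ?thesis using m3 by (intro divide_left_mono mult_left_mono) auto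
    qed
    finally show ?thesis by (simp add: m_def lnp_def add_ac)
  qed
  have tele: "ln (ln (real (n + 3))) - ln (ln 3) \<le> (\<Sum>k<n. 1 / (real (k + 3) * lnp \<eta> (k + 3)))" for n
  proof (induction n)
    case (Suc n)
    then show ?case using step[of n] by simp
  qed simp
  have le: "(\<Sum>k<n. 1 / (real (k + 3) * lnp \<eta> (k + 3))) \<le> (\<Sum>k. 1 / (real (k + 3) * lnp \<eta> (k + 3)))" for n
    by (intro sum_le_suminf s) (auto simp: lnp_def)
  have bd: "ln (ln (real (n + 3))) \<le> ln (ln 3) + (\<Sum>k. 1 / (real (k + 3) * lnp \<eta> (k + 3)))" for n
    using tele[of n] le[of n] by linarith
  define B where "B = ln (ln 3) + (\<Sum>k. 1 / (real (k + 3) * lnp \<eta> (k + 3)))"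
  have "filterlim (\<lambda>n. real (n + 3)) at_top sequentially"
    by (rule filterlim_compose[OF filterlim_real_sequentially filterlim_add_const_nat_at_top])
  then have "filterlim (\<lambda>n. ln (ln (real (n + 3)))) at_top sequentially"
    by (rule filterlim_compose[OF ln_at_top filterlim_compose[OF ln_at_top]])
  then have "\<forall>\<^sub>F n in sequentially. B < ln (ln (real (n + 3)))"
    by (simp add: filterlim_at_top_dense)
  then obtain n where "B < ln (ln (real (n + 3)))" by (auto simp: eventually_sequentially)
  with bd[of n] show False by (simp add: B_def)
qed

lemma G_nonneg:
  assumes "0 < \<eta>" "2 \<le> n" shows "0 \<le> G \<eta> n"
  using assms by (simp add: G_def lnp_def)

theorem mainTheorem6:
  fixes \<eta> :: real and d x \<alpha> :: "nat \<Rightarrow> real"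
  assumes eta: "0 < \<eta>" "\<eta> \<le> 1"
    and d1: "d 1 > 0"
    and d: "\<And>n. n \<ge> 2 \<Longrightarrow> d n = 1 / (real n * lnp \<eta> n)"
    and x0: "x 0 = 0"
    and x: "\<And>n. n \<ge> 1 \<Longrightarrow> x n = x (n - 1) + d n"
    and sa: "\<not> summable (\<lambda>k. let n = k + 2 in \<bar>\<alpha> n\<bar> * real n powr (-3) * lnp (-3 * \<eta>) n)
      \<or> (\<exists>C\<^sub>1>0. \<forall>n\<ge>2. \<alpha> n \<le> - 2 * (real n * lnp \<eta> n + real (n + 1) * lnp \<eta> (n + 1))
                               - G \<eta> n + C\<^sub>1 / (real n * lnp \<eta> n))
      \<or> (\<exists>C\<^sub>2>0. \<forall>n\<ge>2. \<alpha> n \<ge> G \<eta> n - C\<^sub>2 / (real n * lnp \<eta> n))"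
  shows "self_adjoint {0<..} (H_graph x \<alpha>)"
proof -
  \<comment> \<open>The first cell has arbitrary length \<open>d 1\<close>; the recurrences are used from the node \<open>x 1\<close> on.\<close>
  define D where "D n = d (n + 2)" for n
  define b where "b n = \<alpha> (n + 2)" for n
  have D_eq: "D n = 1 / (real (n + 2) * lnp \<eta> (n + 2))" for n
    by (simp add: D_def d)
  have inv: "1 / D n = real (n + 2) * lnp \<eta> (n + 2)" for n by (simp add: D_eq)
  note B = lnp_bounds[OF eta]
  have lpos: "0 < lnp \<eta> (n + 2)" for n using B(1)[of "n + 2"] by simp
  have Dpos: "0 < D n" for n using lpos[of n] by (simp add: D_eq)
  have dpos: "0 < d (Suc n)" for n
    using d1 Dpos[of "n - 1"] by (cases n) (auto simp: D_def)
  have xS: "x (Suc n) = x n + d (Suc n)" for n using x[of "Suc n"] by simp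
  have Dx: "x (Suc (Suc n)) - x (Suc n) = D n" for n by (simp add: xS D_def)
  have anti: "D (Suc n) \<le> D n" for n
    unfolding D_eq using lpos[of n] lpos[of "Suc n"] B(2)[of "n + 2"]
    by (intro divide_left_mono mult_mono mult_pos_pos) auto
  have ratio: "D n \<le> 3 * D (Suc n)" for n
  proof -
    have "real (Suc n + 2) * lnp \<eta> (Suc n + 2) \<le> (3 / 2 * real (n + 2)) * (2 * lnp \<eta> (n + 2))"
      using B(3)[of "n + 2"] lpos[of n] lpos[of "Suc n"] by (intro mult_mono) auto
    also have "\<dots> = 3 * (real (n + 2) * lnp \<eta> (n + 2))" by simp
    finally have "1 / D (Suc n) \<le> 3 * (1 / D n)" unfolding inv .
    then show ?thesis using Dpos[of n] Dpos[of "Suc n"] by (simp add: field_simps)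
  qed
  have sqs: "summable (\<lambda>n. (D n)\<^sup>2)"
  proof -
    have "summable (\<lambda>n. inverse (real n ^ 2))" by (rule inverse_power_summable) simp
    then have "summable (\<lambda>n. inverse (real (n + 2) ^ 2))" by (subst summable_iff_shift)
    then have "summable (\<lambda>n. 4 * inverse (real (n + 2) ^ 2))" by (rule summable_mult)
    then show ?thesis
    proof (rule summable_nonneg_le)
      fix n
      have "D n \<le> 1 / (real (n + 2) * (1 / 2))"
        unfolding D_eq using B(1)[of "n + 2"] lpos[of n] by (intro divide_left_mono mult_left_mono) auto
      then have "D n \<le> 2 / real (n + 2)" by simp
      then have "(D n)\<^sup>2 \<le> (2 / real (n + 2))\<^sup>2" using Dpos[of n] by (intro power_mono) auto
      also have "\<dots> = 4 * inverse (real (n + 2) ^ 2)"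
        unfolding power_divide by (simp add: divide_inverse)
      finally show "(D n)\<^sup>2 \<le> 4 * inverse (real (n + 2) ^ 2)" .
    qed simp
  qed
  have div: "\<not> summable D"
    using not_summable_inverse_n_lnp[OF eta] by (simp add: D_eq[abs_def])
  have unb: "\<exists>n. R < x n" for R
  proof (rule ccontr)
    assume "\<not> (\<exists>n. R < x n)"
    then have R: "x n \<le> R" for n by (simp add: not_less)
    have sum: "x (Suc n) = x 1 + (\<Sum>k<n. D k)" for n
      by (induction n) (simp_all add: xS D_def)
    have "summable D"
    proof (rule summableI_nonneg_bounded)
      show "(\<Sum>k<n. D k) \<le> R - x 1" for n using sum[of n] R[of "Suc n"] by simp
    qed (simp add: Dpos less_imp_le)
    with div show False by contradiction
  qed
  interpret point_interactions x \<alpha>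
    by unfold_locales (use x0 xS dpos unb in \<open>auto intro: strict_monoI_Suc\<close>)
  show ?thesis
  proof (rule self_adjoint_if_not_both_l2)
    fix y q z p :: "nat \<Rightarrow> real"
    assume y: "\<And>n. y (Suc n) = y n + (x (Suc n) - x n) * q n" and q: "\<And>n. q (Suc n) = q n + \<alpha> (Suc n) * y (Suc n)"
      and z: "\<And>n. z (Suc n) = z n + (x (Suc n) - x n) * p n" and p: "\<And>n. p (Suc n) = p n + \<alpha> (Suc n) * z (Suc n)"
      and W: "\<And>n. y n * p n - q n * z n = 1"
      and s: "summable (\<lambda>n. (x (Suc n) - x n) * (y n)\<^sup>2)" "summable (\<lambda>n. (x (Suc n) - x n) * (y (Suc n))\<^sup>2)"
        "summable (\<lambda>n. (x (Suc n) - x n) * (z n)\<^sup>2)" "summable (\<lambda>n. (x (Suc n) - x n) * (z (Suc n))\<^sup>2)"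
    define Y where "Y n = y (Suc n)" for n
    define Q where "Q n = q (Suc n)" for n
    define Z where "Z n = z (Suc n)" for n
    define P where "P n = p (Suc n)" for n
    have rec: "Y (Suc n) = Y n + D n * Q n" "Q (Suc n) = Q n + b n * Y (Suc n)"
      "Z (Suc n) = Z n + D n * P n" "P (Suc n) = P n + b n * Z (Suc n)" for n
      using y[of "Suc n"] q[of "Suc n"] z[of "Suc n"] p[of "Suc n"] unfolding Dx
      by (simp_all add: Y_def Q_def Z_def P_def b_def)
    have S: "summable (\<lambda>n. D n * (Y n)\<^sup>2)" "summable (\<lambda>n. D n * (Y (Suc n))\<^sup>2)"
      "summable (\<lambda>n. D n * (Z n)\<^sup>2)" "summable (\<lambda>n. D n * (Z (Suc n))\<^sup>2)"
      using s[THEN summable_Suc_iff[THEN iffD2]] by (simp_all only: Dx Y_def Z_def)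
    have W1: "\<bar>Y n * P n - Q n * Z n\<bar> = 1" for n
      using W[of "Suc n"] by (simp add: Y_def P_def Q_def Z_def)
    from sa show False
    proof (elim disjE exE conjE)
      assume ns: "\<not> summable (\<lambda>k. let n = k + 2 in \<bar>\<alpha> n\<bar> * real n powr (-3) * lnp (-3 * \<eta>) n)"
      have eq: "(let n = k + 2 in \<bar>\<alpha> n\<bar> * real n powr (-3) * lnp (-3 * \<eta>) n) = \<bar>b k\<bar> * D k ^ 3" for k
      proof -
        define l where "l = ln (real (k + 2))"
        have l0: "0 < l" by (simp add: l_def)
        have "lnp (-3 * \<eta>) (k + 2) = (l powr \<eta>) powr (-3)"
          by (simp add: lnp_def l_def powr_powr mult.commute)
        also have "\<dots> = inverse ((l powr \<eta>) ^ 3)"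
          using l0 powr_realpow[of "l powr \<eta>" 3] by (simp add: powr_minus)
        finally have 1: "lnp (-3 * \<eta>) (k + 2) = inverse (lnp \<eta> (k + 2) ^ 3)"
          by (simp add: lnp_def l_def)
        have "real (k + 2) powr (-3) = inverse (real (k + 2) powr 3)" by (rule powr_minus)
        also have "real (k + 2) powr 3 = real (k + 2) ^ 3"
          using powr_realpow[of "real (k + 2)" 3] by simp
        finally have 2: "real (k + 2) powr (-3) = inverse (real (k + 2) ^ 3)" .
        have "D k ^ 3 = inverse (real (k + 2) ^ 3) * inverse (lnp \<eta> (k + 2) ^ 3)"
          unfolding D_eq by (simp add: divide_inverse power_mult_distrib power_inverse)
        then show ?thesis unfolding Let_def 1 2 b_def by (simp only: mult.assoc)
      qed
      have "summable (\<lambda>k. \<bar>b k\<bar> * D k ^ 3)"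
        by (rule strong_coupling_not_both_l2[OF Dpos anti ratio sqs rec S W1])
      with ns show False unfolding eq by contradiction
    next
      fix C :: real assume C: "0 < C" "\<forall>n\<ge>2. \<alpha> n \<le> - 2 * (real n * lnp \<eta> n + real (n + 1) * lnp \<eta> (n + 1))
                               - G \<eta> n + C / (real n * lnp \<eta> n)"
      show False
      proof (rule alternating_not_both_l2[OF Dpos div rec _ _ S W1])
        show "b n \<le> - 2 * (1 / D n + 1 / D (Suc n)) + C * D n" for n
        proof -
          have "b n \<le> - 2 * (1 / D n + 1 / D (Suc n)) - G \<eta> (n + 2) + C * D n"
            using C(2)[rule_format, of "n + 2"] unfolding inv by (simp add: b_def D_eq)
          then show ?thesis using G_nonneg[OF eta(1), of "n + 2"] by simp
        qed
      qed (use C in simp)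
    next
      fix C :: real assume C: "0 < C" "\<forall>n\<ge>2. \<alpha> n \<ge> G \<eta> n - C / (real n * lnp \<eta> n)"
      show False
      proof (rule bounded_below_not_both_l2[OF Dpos div rec _ _ S W1])
        show "- C * D n \<le> b n" for n
          using C(2)[rule_format, of "n + 2"] G_nonneg[OF eta(1), of "n + 2"] by (simp add: b_def D_eq)
      qed (use C in simp)
    qed
  qed
qed

end
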